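(* The following decision problem is NP-complete: given a finite simple undirected graph $G$, decide whether $G$ is a tolerance graph. The problem remains NP-complete even if the given graph $G$ is known to be a trapezoid graph.
   Context: A simple undirected graph $G=(V,E)$ with $V=\{v_1,\ldots,v_n\}$ is a tolerance graph if there exist closed intervals $I_1,\ldots,I_n$ on the real line and positive real numbers $t_1,\ldots,t_n$ such that for all $i\neq j$, $v_iv_j\in E$ if and only if $|I_i\cap I_j|\geq \min\{t_i,t_j\}$ (here $|I|$ denotes the length of an interval). A trapezoid graph is the intersection graph of a finite family of trapezoids each having two vertices on a line $L_1$ and two vertices on a parallel line $L_2$ (vertices of the graph correspond to trapezoids, adjacent iff the trapezoids intersect). *)

theory Defs
  imports
    "HOL-Analysis.Analysis"
    "HOL-Computational_Algebra.Polynomial"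
    "Graph_Theory.Pair_Digraph"
begin

section \<open>Polynomial-time Turing machines\<close>

text \<open>
  Deterministic multi-tape machines with two-way infinite tapes. The machine is in one of the
  states \<open>0, ..., n_states\<close>, where \<open>0\<close> is the start state and \<open>n_states\<close> is the only halting
  state. Tape symbols are \<open>0, ..., n_symbols - 1\<close>, where \<open>0\<close> is the blank, \<open>1\<close> stands for the
  bit \<open>False\<close> and \<open>2\<close> for the bit \<open>True\<close>. The transition function maps the state and the
  scanned symbols to the next state and, for each tape, the symbol to write and the head movement.
\<close>

record tm =
  n_tapes :: nat
  n_states :: nat
  n_symbols :: nat
  delta :: "nat \<Rightarrow> nat list \<Rightarrow> nat \<times> (nat \<times> int) list"

definition wf_tm :: "tm \<Rightarrow> bool" where
  "wf_tm M \<longleftrightarrow> n_tapes M \<ge> 1 \<and> n_symbols M \<ge> 3 \<and>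
    (\<forall>q s. q < n_states M \<and> length s = n_tapes M \<and> set s \<subseteq> {..<n_symbols M} \<longrightarrow>
      (case delta M q s of (q', acts) \<Rightarrow>
        q' \<le> n_states M \<and> length acts = n_tapes M \<and>
        (\<forall>(a, d) \<in> set acts. a < n_symbols M \<and> d \<in> {-1, 0, 1})))"

text \<open>A tape consists of its contents and the position of the head.\<close>

type_synonym tape = "(int \<Rightarrow> nat) \<times> int"

type_synonym config = "nat \<times> tape list"

fun act_on_tape :: "nat \<times> int \<Rightarrow> tape \<Rightarrow> tape" where
  "act_on_tape (a, d) (f, h) = (f(h := a), h + d)"

fun step :: "tm \<Rightarrow> config \<Rightarrow> config" where
  "step M (q, ts) =
    (if q < n_states M
     then case delta M q (map (\<lambda>(f, h). f h) ts) of (q', acts) \<Rightarrow> (q', map2 act_on_tape acts ts)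
     else (q, ts))"

definition word_tape :: "bool list \<Rightarrow> int \<Rightarrow> nat" where
  "word_tape x i = (if 0 \<le> i \<and> nat i < length x then (if x ! nat i then 2 else 1) else 0)"

definition init_config :: "tm \<Rightarrow> bool list \<Rightarrow> config" where
  "init_config M x = (0, (word_tape x, 0) # replicate (n_tapes M - 1) (\<lambda>_. 0, 0))"

text \<open>
  The input is on the first tape and the output on the last one. As halted configurations do not
  change any more, the machine halts after at most \<open>t\<close> steps iff it is in the halting state after
  exactly \<open>t\<close> applications of \<open>step\<close>.
\<close>

definition outputs_within :: "tm \<Rightarrow> bool list \<Rightarrow> bool list \<Rightarrow> nat \<Rightarrow> bool" where
  "outputs_within M x y t \<longleftrightarrow>
    (case (step M ^^ t) (init_config M x) of (q, ts) \<Rightarrow>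
      q = n_states M \<and> fst (last ts) = word_tape y)"

definition polytime :: "(bool list \<Rightarrow> bool list) \<Rightarrow> bool" where
  "polytime f \<longleftrightarrow>
    (\<exists>M (p :: nat poly). wf_tm M \<and> (\<forall>x. outputs_within M x (f x) (poly p (length x))))"


section \<open>NP-completeness\<close>

text \<open>
  The bits of \<open>x\<close> are doubled, so that the first unequal pair of bits separates \<open>x\<close> from \<open>u\<close>.
\<close>

definition pair_code :: "bool list \<Rightarrow> bool list \<Rightarrow> bool list" where
  "pair_code x u = concat (map (\<lambda>b. [b, b]) x) @ [True, False] @ u"

definition has_certificate ::
    "(bool list \<Rightarrow> bool list) \<Rightarrow> nat poly \<Rightarrow> bool list \<Rightarrow> bool" where
  "has_certificate v p x \<longleftrightarrow> (\<exists>u. length u \<le> poly p (length x) \<and> v (pair_code x u) = [True])"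

definition NP :: "bool list set set" where
  "NP = {L. \<exists>v p. polytime v \<and> (\<forall>x. x \<in> L \<longleftrightarrow> has_certificate v p x)}"

definition poly_reducible :: "bool list set \<Rightarrow> bool list set \<Rightarrow> bool" (infix \<open>\<le>\<^sub>p\<close> 50) where
  "L \<le>\<^sub>p L' \<longleftrightarrow> (\<exists>f. polytime f \<and> (\<forall>x. x \<in> L \<longleftrightarrow> f x \<in> L'))"

definition NP_complete :: "bool list set \<Rightarrow> bool" where
  "NP_complete L \<longleftrightarrow> L \<in> NP \<and> (\<forall>L' \<in> NP. L' \<le>\<^sub>p L)"

text \<open>
  Restricted input classes are handled as promise problems, given by the yes-instances \<open>Y\<close> and the
  no-instances \<open>N\<close>. Nothing is required of a verifier's verdict on words outside \<open>Y \<union> N\<close>,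
  while a reduction to the problem may only produce words in \<open>Y \<union> N\<close>.
\<close>

definition promise_NP_complete :: "bool list set \<Rightarrow> bool list set \<Rightarrow> bool" where
  "promise_NP_complete Y N \<longleftrightarrow>
    (\<exists>v p. polytime v \<and> (\<forall>x \<in> Y. has_certificate v p x) \<and> (\<forall>x \<in> N. \<not> has_certificate v p x)) \<and>
    (\<forall>L \<in> NP. \<exists>f. polytime f \<and> (\<forall>x. (x \<in> L \<longrightarrow> f x \<in> Y) \<and> (x \<notin> L \<longrightarrow> f x \<in> N)))"

lemma NP_complete_iff_promise: "NP_complete L \<longleftrightarrow> promise_NP_complete L (- L)"
proof -
  have "L \<in> NP \<longleftrightarrow> (\<exists>v p. polytime v \<and>
      (\<forall>x \<in> L. has_certificate v p x) \<and> (\<forall>x \<in> - L. \<not> has_certificate v p x))"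
    unfolding NP_def by blast
  moreover have "L' \<le>\<^sub>p L \<longleftrightarrow> (\<exists>f. polytime f \<and>
      (\<forall>x. (x \<in> L' \<longrightarrow> f x \<in> L) \<and> (x \<notin> L' \<longrightarrow> f x \<in> - L)))" for L'
    unfolding poly_reducible_def by blast
  ultimately show ?thesis
    unfolding NP_complete_def promise_NP_complete_def by presburger
qed


section \<open>Tolerance graphs and trapezoid graphs\<close>

text \<open>
  A finite simple undirected graph is a \<open>pair_graph\<close>: a finite loop-free digraph whose set of arcs
  \<open>parcs G\<close> is symmetric.
\<close>

definition tolerance_graph :: "'a pair_pre_digraph \<Rightarrow> bool" where
  "tolerance_graph G \<longleftrightarrow> pair_graph G \<and>
    (\<exists>(l :: 'a \<Rightarrow> real) r t.
      (\<forall>v \<in> pverts G. l v \<le> r v \<and> t v > 0) \<and>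
      (\<forall>u \<in> pverts G. \<forall>v \<in> pverts G. u \<noteq> v \<longrightarrow>
        ((u, v) \<in> parcs G \<longleftrightarrow>
          measure lborel ({l u..r u} \<inter> {l v..r v}) \<ge> min (t u) (t v))))"

definition is_line :: "(real ^ 2) set \<Rightarrow> bool" where
  "is_line L \<longleftrightarrow> affine L \<and> aff_dim L = 1"

definition trapezoid_between :: "(real ^ 2) set \<Rightarrow> (real ^ 2) set \<Rightarrow> (real ^ 2) set \<Rightarrow> bool" where
  "trapezoid_between L1 L2 T \<longleftrightarrow>
    (\<exists>a b c d. a \<in> L1 \<and> b \<in> L1 \<and> a \<noteq> b \<and> c \<in> L2 \<and> d \<in> L2 \<and> c \<noteq> d \<and>
      T = convex hull {a, b, c, d})"

definition trapezoid_graph :: "'a pair_pre_digraph \<Rightarrow> bool" where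
  "trapezoid_graph G \<longleftrightarrow> pair_graph G \<and>
    (\<exists>L1 L2 T. is_line L1 \<and> is_line L2 \<and> affine_parallel L1 L2 \<and> L1 \<noteq> L2 \<and>
      (\<forall>v \<in> pverts G. trapezoid_between L1 L2 (T v)) \<and>
      (\<forall>u \<in> pverts G. \<forall>v \<in> pverts G. u \<noteq> v \<longrightarrow>
        ((u, v) \<in> parcs G \<longleftrightarrow> T u \<inter> T v \<noteq> {})))"


section \<open>Graphs as problem instances\<close>

text \<open>Every finite simple graph is isomorphic to one with vertex set \<open>{0, ..., n - 1}\<close>.\<close>

definition graph_instance :: "nat pair_pre_digraph \<Rightarrow> bool" where
  "graph_instance G \<longleftrightarrow> pair_graph G \<and> (\<exists>n. pverts G = {..<n})"

text \<open>The rows of the adjacency matrix, one after the other.\<close>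

definition graph_code :: "nat pair_pre_digraph \<Rightarrow> bool list" where
  "graph_code G = (let n = card (pverts G) in
    concat (map (\<lambda>i. map (\<lambda>j. (i, j) \<in> parcs G) [0..<n]) [0..<n]))"

lemma length_concat_rows: "length (concat (map (\<lambda>i. map (f i) [0..<n]) [0..<m])) = m * n"
  by (induction m) auto

lemma nth_concat_rows:
  assumes "i < m" "j < n"
  shows "concat (map (\<lambda>i. map (f i) [0..<n]) [0..<m]) ! (i * n + j) = f i j"
  using assms
proof (induction m)
  case 0
  then show ?case by simp
next
  case (Suc m)
  show ?case
  proof (cases "i < m")
    case True
    have "i * n + j < Suc i * n" using Suc.prems by simp
    also have "\<dots> \<le> m * n" using True by (intro mult_le_mono1) simp
    finally show ?thesis
      using Suc True by (simp add: nth_append length_concat_rows)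
  next
    case False
    then have "i = m" using Suc.prems by simp
    then show ?thesis
      using Suc.prems by (simp add: nth_append length_concat_rows)
  qed
qed

lemma inj_on_graph_code: "inj_on graph_code {G. graph_instance G}"
proof (rule inj_onI, clarsimp)
  fix G H
  assume G: "graph_instance G" and H: "graph_instance H" and eq: "graph_code G = graph_code H"
  from G obtain n where n: "pverts G = {..<n}" and pG: "pair_graph G"
    by (auto simp: graph_instance_def)
  from H obtain m where m: "pverts H = {..<m}" and pH: "pair_graph H"
    by (auto simp: graph_instance_def)
  have "length (graph_code G) = n * n" "length (graph_code H) = m * m"
    using n m by (simp_all only: graph_code_def Let_def length_concat_rows card_lessThan)
  with eq have "n = m"
    by (metis power2_eq_square power2_eq_iff_nonneg zero_le)
  have arcs: "(i, j) \<in> parcs G \<longleftrightarrow> (i, j) \<in> parcs H" if "i < n" "j < n" for i j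
    using nth_concat_rows[OF that, of "\<lambda>i j. (i, j) \<in> parcs G"]
      nth_concat_rows[OF that, of "\<lambda>i j. (i, j) \<in> parcs H"] eq n m \<open>n = m\<close>
    by (simp add: graph_code_def Let_def)
  interpret G: pair_graph G by (rule pG)
  interpret H: pair_graph H by (rule pH)
  have "parcs G \<subseteq> {..<n} \<times> {..<n}" "parcs H \<subseteq> {..<n} \<times> {..<n}"
    using G.arc_fst_in_verts G.arc_snd_in_verts H.arc_fst_in_verts H.arc_snd_in_verts n m \<open>n = m\<close>
    by (auto simp: mem_Times_iff)
  with arcs have "parcs G = parcs H" by auto
  with n m \<open>n = m\<close> show "G = H" by simp
qed

end

theory Submission
  imports Defs "Jordan_Normal_Form.Determinant"
begin

text \<open>
  Hardness. An arbitrary problem in NP is reduced to the satisfiability of a CNF formula describing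
  the computation tableau of its verifier, and the formula is turned into a graph as follows. In the
  join of two copies of a graph, the vertices of one copy all have bounded tolerances, because
  vertices with unbounded tolerance are pairwise non-adjacent; hence a copy of the incomparability
  graph of a poset is represented by parallelograms between two lines, whose slopes are the
  tolerances. Every configuration \<open>2 + 2\<close> in the poset then forces a comparison of slopes. Truth
  values are the directions of these comparisons, and a cycle of elements along which all
  comparisons agree is impossible, which encodes a clause. The poset always has a representation by
  trapezoids. The reduction is definable in first-order logic with polynomially bounded quantifiers,
  and such functions are computable in polynomial time.

  Membership. Which pairs of vertices are adjacent depends only on the truth of the inequalities
  \<open>l y + t z \<le> r x\<close>. The resulting system of linear inequalities has coefficients in
  \<open>{-1, 0, 1}\<close>, so by Cramer's rule it has an integral solution of polynomial bit length. This
  solution is the certificate, together with the borrows of the subtractions that decide the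
  inequalities, which makes the verification first-order definable as well.
\<close>

section \<open>Register programs on Turing machines\<close>

text \<open>Exchanging the two lines keeps the poset and reverses every slope comparison, so the
  truth values of the slots are determined only up to complementation. A cycle can therefore only
  express that its slots do not all agree. One slot of each cycle is tied to a common constant slot,
  the reference for false; this turns not-all-equal into a clause. Conversely, a cycle whose slots
  do not all agree is realised by giving its upward and downward steps weights of total 0. The
  tableau only propagates forward in time. Uniqueness of state, head position or symbol is never
  demanded: the variables describing the true run are forced, and the output clauses forbid every
  other result. For membership, strict inequalities get the right-hand side 1 by scaling. With all
  right-hand sides in {0, 1}, a vertex of the solution set may be multiplied by the absolute value
  of a determinant, which clears denominators and violates nothing. Non-adjacency has to be verified
  too, so an inequality and its negation are each certified by a subtraction of their own.\<close>

text \<open>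
  The registers of a program are the head positions of a Turing machine. Tape \<open>0\<close> carries the
  input, and the other register tapes carry nothing but a mark in cell \<open>0\<close>, which serves as the
  zero test. A condition is a conjunction of (possibly negated) tests for scanned symbols.
\<close>

type_synonym cnd = "(nat \<times> nat \<times> bool) list"

datatype com = Inc nat | Dec nat | Out bool | Seq com com (infixr \<open>;;\<close> 60)
  | Cond cnd com com | Loop cnd com

type_synonym rstate = "(nat \<Rightarrow> nat) \<times> bool list"

definition scan :: "bool list \<Rightarrow> (nat \<Rightarrow> nat) \<Rightarrow> nat \<Rightarrow> nat" where
  "scan x h i = (if i = 0 then word_tape x (int (h 0)) else if h i = 0 then 1 else 0)"

definition ctest :: "bool list \<Rightarrow> (nat \<Rightarrow> nat) \<Rightarrow> cnd \<Rightarrow> bool" where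
  "ctest x h C \<longleftrightarrow> (\<forall>(i, a, b) \<in> set C. (scan x h i = a) = b)"

text \<open>By the rule \<open>Le\<close> the time is only an upper bound, so branches need not be
  balanced. Decrementing requires a positive register; hence no head ever passes to the left of cell
  0.\<close>

inductive exec :: "bool list \<Rightarrow> com \<Rightarrow> rstate \<Rightarrow> nat \<Rightarrow> rstate \<Rightarrow> bool" for x where
  Inc: "exec x (Inc i) (h, w) 1 (h(i := Suc (h i)), w)"
| Dec: "h i > 0 \<Longrightarrow> exec x (Dec i) (h, w) 1 (h(i := h i - 1), w)"
| Out: "exec x (Out b) (h, w) 1 (h, w @ [b])"
| Seq: "exec x c s t s1 \<Longrightarrow> exec x d s1 t' s2 \<Longrightarrow> exec x (c ;; d) s (t + t') s2"
| CondT: "ctest x (fst s) C \<Longrightarrow> exec x c s t s' \<Longrightarrow> exec x (Cond C c d) s (t + 1) s'"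
| CondF: "\<not> ctest x (fst s) C \<Longrightarrow> exec x d s t s' \<Longrightarrow> exec x (Cond C c d) s (t + 1) s'"
| LoopF: "\<not> ctest x (fst s) C \<Longrightarrow> exec x (Loop C c) s 1 s"
| LoopT: "ctest x (fst s) C \<Longrightarrow> exec x c s t s1 \<Longrightarrow> exec x (Loop C c) s1 t' s2 \<Longrightarrow>
    exec x (Loop C c) s (t + t' + 1) s2"
| Le: "exec x c s t s' \<Longrightarrow> t \<le> t' \<Longrightarrow> exec x c s t' s'"

lemma exec_loop:
  assumes "\<And>j. j < n \<Longrightarrow> ctest x (fst (S j)) C"
    and "\<And>j. j < n \<Longrightarrow> exec x c (S j) t (S (Suc j))"
    and "\<not> ctest x (fst (S n)) C"
  shows "exec x (Loop C c) (S 0) (n * (t + 1) + 1) (S n)"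
  using assms
proof (induction n arbitrary: S)
  case 0
  then show ?case using exec.LoopF[of x "S 0" C c] by simp
next
  case (Suc n)
  have "exec x (Loop C c) (S (Suc 0)) (n * (t + 1) + 1) (S (Suc n))"
    using Suc.IH[of "\<lambda>j. S (Suc j)"] Suc.prems by simp
  from exec.LoopT[OF _ _ this] Suc.prems(1)[of 0] Suc.prems(2)[of 0]
  have "exec x (Loop C c) (S 0) (t + (n * (t + 1) + 1) + 1) (S (Suc n))" by simp
  then show ?case by (simp add: algebra_simps)
qed

fun regs :: "com \<Rightarrow> nat set" where
  "regs (Inc i) = {i}"
| "regs (Dec i) = {i}"
| "regs (Out b) = {}"
| "regs (c ;; d) = regs c \<union> regs d"
| "regs (Cond C c d) = fst ` set C \<union> regs c \<union> regs d"
| "regs (Loop C c) = fst ` set C \<union> regs c"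

lemma finite_regs: "finite (regs c)"
  by (induction c) auto

section \<open>Compilation of register programs into Turing machines\<close>

definition emb :: "tm \<Rightarrow> nat \<Rightarrow> nat \<Rightarrow> nat \<Rightarrow> nat list \<Rightarrow> nat \<times> (nat \<times> int) list" where
  "emb M off ex q s =
    (case delta M (q - off) s of (q', a) \<Rightarrow> (if q' = n_states M then ex else q' + off, a))"

definition stest :: "nat list \<Rightarrow> cnd \<Rightarrow> bool" where
  "stest s C \<longleftrightarrow> (\<forall>(i, a, b) \<in> set C. (s ! i = a) = b)"

abbreviation machine :: "nat \<Rightarrow> nat \<Rightarrow> (nat \<Rightarrow> nat list \<Rightarrow> nat \<times> (nat \<times> int) list) \<Rightarrow> tm" where
  "machine K n d \<equiv> \<lparr>n_tapes = K, n_states = n, n_symbols = 3, delta = d\<rparr>"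

abbreviation keep :: "nat list \<Rightarrow> (nat \<times> int) list" where
  "keep s \<equiv> map (\<lambda>a. (a, 0)) s"

text \<open>The halting state of a component is rerouted by \<open>emb\<close>: to the start of the
  next component in a sequence, to the test state 0 in a loop. A test costs one step that leaves all
  tapes unchanged. Tape \<open>K - 1\<close> is the output tape, the registers are the tapes before
  it.\<close>

fun cmp :: "nat \<Rightarrow> com \<Rightarrow> tm" where
  "cmp K (Inc i) = machine K 1
    (\<lambda>q s. (1, map (\<lambda>j. (s ! j, if j = i then 1 else 0)) [0..<K]))"
| "cmp K (Dec i) = machine K 1
    (\<lambda>q s. (1, map (\<lambda>j. (s ! j, if j = i then -1 else 0)) [0..<K]))"
| "cmp K (Out b) = machine K 1
    (\<lambda>q s. (1, map (\<lambda>j. if j = K - 1 then (if b then 2 else 1, 1) else (s ! j, 0)) [0..<K]))"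
| "cmp K (c ;; d) = (let M1 = cmp K c; M2 = cmp K d; n1 = n_states M1; n2 = n_states M2 in
    machine K (n1 + n2) (\<lambda>q s. if q < n1 then emb M1 0 n1 q s else emb M2 n1 (n1 + n2) q s))"
| "cmp K (Cond C c d) = (let M1 = cmp K c; M2 = cmp K d; n1 = n_states M1; n2 = n_states M2 in
    machine K (1 + n1 + n2) (\<lambda>q s.
      if q = 0 then (if stest s C then 1 else 1 + n1, keep s)
      else if q < 1 + n1 then emb M1 1 (1 + n1 + n2) q s
      else emb M2 (1 + n1) (1 + n1 + n2) q s))"
| "cmp K (Loop C c) = (let M1 = cmp K c; n1 = n_states M1 in
    machine K (1 + n1) (\<lambda>q s.
      if q = 0 then (if stest s C then 1 else 1 + n1, keep s) else emb M1 1 0 q s))"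

lemma cmp_simps [simp]:
  "n_tapes (cmp K c) = K" "n_symbols (cmp K c) = 3" "n_states (cmp K c) > 0"
  by (induction c) (auto simp: Let_def)

definition okd :: "nat \<Rightarrow> nat \<Rightarrow> nat \<times> (nat \<times> int) list \<Rightarrow> bool" where
  "okd K n r \<longleftrightarrow> fst r \<le> n \<and> length (snd r) = K \<and>
    (\<forall>(a, d) \<in> set (snd r). a < 3 \<and> d \<in> {-1, 0, 1})"

lemma wf_tm_alt: "wf_tm M \<longleftrightarrow> n_tapes M \<ge> 1 \<and> n_symbols M \<ge> 3 \<and>
    (n_symbols M = 3 \<longrightarrow> (\<forall>q s. q < n_states M \<and> length s = n_tapes M \<and> set s \<subseteq> {..<3} \<longrightarrow>
      okd (n_tapes M) (n_states M) (delta M q s)))"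
  if "n_symbols M = 3"
  using that unfolding wf_tm_def okd_def by (simp add: case_prod_unfold)

lemma okd_emb:
  assumes "okd K (n_states M) (delta M (q - off) s)" "ex \<le> n" "off + n_states M \<le> Suc n"
  shows "okd K n (emb M off ex q s)"
  using assms by (auto simp: okd_def emb_def split: prod.splits)

lemma nth_lt_3: "set s \<subseteq> {..<3} \<Longrightarrow> i < length s \<Longrightarrow> s ! i < (3 :: nat)"
  using nth_mem by fastforce

lemma wf_cmp: "wf_tm (cmp (Suc k) c)"
proof (induction c)
  case (Seq c d)
  have c: "okd (Suc k) (n_states (cmp (Suc k) c)) (delta (cmp (Suc k) c) q s)"
    if "q < n_states (cmp (Suc k) c)" "length s = Suc k" "set s \<subseteq> {..<3}" for q s
    using Seq that by (simp add: wf_tm_alt)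
  have d: "okd (Suc k) (n_states (cmp (Suc k) d)) (delta (cmp (Suc k) d) q s)"
    if "q < n_states (cmp (Suc k) d)" "length s = Suc k" "set s \<subseteq> {..<3}" for q s
    using Seq that by (simp add: wf_tm_alt)
  show ?case
    by (auto simp: wf_tm_alt Let_def intro!: okd_emb c d)
next
  case (Cond C c d)
  have c: "okd (Suc k) (n_states (cmp (Suc k) c)) (delta (cmp (Suc k) c) q s)"
    if "q < n_states (cmp (Suc k) c)" "length s = Suc k" "set s \<subseteq> {..<3}" for q s
    using Cond that by (simp add: wf_tm_alt)
  have d: "okd (Suc k) (n_states (cmp (Suc k) d)) (delta (cmp (Suc k) d) q s)"
    if "q < n_states (cmp (Suc k) d)" "length s = Suc k" "set s \<subseteq> {..<3}" for q s
    using Cond that by (simp add: wf_tm_alt)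
  have k: "okd (Suc k) n (q, keep s)" if "q \<le> n" "length s = Suc k" "set s \<subseteq> {..<3}" for q s n
    using that by (auto simp: okd_def)
  show ?case
    by (auto simp: wf_tm_alt Let_def intro!: okd_emb c d k)
next
  case (Loop C c)
  have c: "okd (Suc k) (n_states (cmp (Suc k) c)) (delta (cmp (Suc k) c) q s)"
    if "q < n_states (cmp (Suc k) c)" "length s = Suc k" "set s \<subseteq> {..<3}" for q s
    using Loop that by (simp add: wf_tm_alt)
  have k: "okd (Suc k) n (q, keep s)" if "q \<le> n" "length s = Suc k" "set s \<subseteq> {..<3}" for q s n
    using that by (auto simp: okd_def)
  show ?case
    by (auto simp: wf_tm_alt Let_def intro!: okd_emb c k)
qed (auto simp: wf_tm_alt okd_def nth_lt_3)

section \<open>Simulation of programs by the compiled machines\<close>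

definition reach :: "tm \<Rightarrow> nat \<Rightarrow> config \<Rightarrow> config \<Rightarrow> bool" where
  "reach M t c c' \<longleftrightarrow> (\<exists>t' \<le> t. (step M ^^ t') c = c')"

lemma reach_0: "reach M t c c"
  unfolding reach_def by (rule exI[of _ 0]) simp

lemma reach_mono: "reach M t c c' \<Longrightarrow> t \<le> t' \<Longrightarrow> reach M t' c c'"
  unfolding reach_def using le_trans by blast

lemma reach_trans: "reach M t c c' \<Longrightarrow> reach M t' c' c'' \<Longrightarrow> reach M (t + t') c c''"
  unfolding reach_def
proof (elim exE conjE)
  fix a b assume "a \<le> t" "(step M ^^ a) c = c'" "b \<le> t'" "(step M ^^ b) c' = c''"
  then show "\<exists>u \<le> t + t'. (step M ^^ u) c = c''"
    by (intro exI[of _ "b + a"]) (auto simp: funpow_add)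
qed

lemma reach_step: "reach M (Suc t) c c'" if "reach M t (step M c) c'"
  using that unfolding reach_def
proof (elim exE conjE)
  fix u assume "u \<le> t" "(step M ^^ u) (step M c) = c'"
  then show "\<exists>v \<le> Suc t. (step M ^^ v) c = c'"
    by (intro exI[of _ "Suc u"]) (simp add: funpow_swap1)
qed

lemma reach_one: "step M c = c' \<Longrightarrow> reach M 1 c c'"
  using reach_step[of M 0] reach_0 by simp

lemma step_halted: "(step M ^^ t) (n_states M, ts) = (n_states M, ts)"
  by (induction t) auto

text \<open>Both machines run in lockstep until \<open>M\<close> halts for the first time; at that
  step \<open>N\<close> enters \<open>ex\<close> instead. The given run of \<open>M\<close> may idle
  in its halting state afterwards, so \<open>N\<close> can only be claimed to need at most
  \<open>t\<close> steps. The assumption on \<open>ts\<close> keeps the scanned symbols inside the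
  alphabet, where \<open>wf_tm\<close> controls the transitions.\<close>

lemma reach_emb:
  assumes d: "\<And>q s. q < n_states M \<Longrightarrow> length s = n_tapes M \<Longrightarrow> delta N (q + off) s = emb M off ex (q + off) s"
    and n: "\<And>q. q < n_states M \<Longrightarrow> q + off < n_states N"
    and wf: "wf_tm M" "n_symbols M = 3"
    and r: "(step M ^^ t) (q, ts) = (n_states M, ts')" "q < n_states M"
    and ts: "length ts = n_tapes M" "\<forall>(f, h) \<in> set ts. \<forall>i. f i < 3"
  shows "reach N t (q + off, ts) (ex, ts')"
  using r ts
proof (induction t arbitrary: q ts)
  case 0
  then show ?case by simp
next
  case (Suc t)
  define s where "s = map (\<lambda>(f, h). f h) ts"
  obtain q' acts where D: "delta M q s = (q', acts)" by fastforce
  have s: "length s = n_tapes M" "set s \<subseteq> {..<3}"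
    using Suc.prems by (auto simp: s_def)
  have ok: "okd (n_tapes M) (n_states M) (q', acts)"
    using wf s Suc.prems(2) unfolding wf_tm_alt[OF wf(2)] D[symmetric] by simp
  define ts1 where "ts1 = map2 act_on_tape acts ts"
  have S1: "step M (q, ts) = (q', ts1)"
    using Suc.prems D by (simp add: s_def ts1_def)
  have S2: "step N (q + off, ts) = (if q' = n_states M then ex else q' + off, ts1)"
    using Suc.prems D d[OF Suc.prems(2) s(1)] n[of q] by (simp add: s_def ts1_def emb_def)
  have r: "(step M ^^ t) (q', ts1) = (n_states M, ts')"
    using Suc.prems(1) S1 by (simp only: funpow_simps_right comp_apply)
  show ?case
  proof (cases "q' = n_states M")
    case True
    then have "ts1 = ts'" using r by (simp add: step_halted)
    then show ?thesis using S2 True by (intro reach_step) (simp add: reach_0)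
  next
    case False
    have l: "length ts1 = n_tapes M" using ok Suc.prems by (simp add: ts1_def okd_def)
    have "\<forall>(f, h) \<in> set ts1. \<forall>i. f i < 3"
    proof clarify
      fix f h i assume "(f, h) \<in> set ts1"
      then obtain a d f' h' where z: "((a, d), (f', h')) \<in> set (zip acts ts)"
        "(f, h) = act_on_tape (a, d) (f', h')"
        by (auto simp: ts1_def)
      have "a < 3" using ok set_zip_leftD[OF z(1)] by (auto simp: okd_def)
      moreover have "f' i < 3" using Suc.prems(4) set_zip_rightD[OF z(1)] by auto
      ultimately
      show "f i < 3" using z(2) by simp
    qed
    then have "reach N t (q' + off, ts1) (ex, ts')"
      using Suc.IH[OF r _ l] False ok by (auto simp: okd_def)
    then show ?thesis using S2 False by (intro reach_step) simp
  qed
qed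

definition cont :: "bool list \<Rightarrow> nat \<Rightarrow> int \<Rightarrow> nat" where
  "cont x i = (if i = 0 then word_tape x else (\<lambda>p. if p = 0 then 1 else 0))"

fun tapes :: "nat \<Rightarrow> bool list \<Rightarrow> rstate \<Rightarrow> tape list" where
  "tapes k x (h, w) = map (\<lambda>i. (cont x i, int (h i))) [0..<k] @ [(word_tape w, int (length w))]"

lemma length_tapes [simp]: "length (tapes k x s) = Suc k"
  by (cases s) simp

lemma tapes_lt_3: "\<forall>(f, h) \<in> set (tapes k x s). \<forall>i. f i < 3"
  by (cases s) (auto simp: cont_def word_tape_def)

lemma scanned: "i < k \<Longrightarrow> map (\<lambda>(f, h). f h) (tapes k x (h, w)) ! i = scan x h i"
  by (simp add: nth_append scan_def cont_def)

lemma stest_scanned: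
  assumes "fst ` set C \<subseteq> {..<k}"
  shows "stest (map (\<lambda>(f, h). f h) (tapes k x s)) C \<longleftrightarrow> ctest x (fst s) C"
proof -
  have "map (\<lambda>(f, h). f h) (tapes k x s) ! i = scan x (fst s) i" if "(i, a, b) \<in> set C" for i a b
    using assms that scanned[of i k x "fst s" "snd s"] by force
  then show ?thesis unfolding stest_def ctest_def
    by (intro ball_cong refl) (simp only: split_paired_all prod.case)
qed

lemma keep_tapes: "map2 act_on_tape (map ((\<lambda>a. (a, 0)) \<circ> (\<lambda>(f, h). f h)) ts) ts = ts"
  by (induction ts) auto

lemma nth_tapes:
  "i < k \<Longrightarrow> tapes k x (h, w) ! i = (cont x i, int (h i))"
  "tapes k x (h, w) ! k = (word_tape w, int (length w))"
  by (simp_all add: nth_append)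

lemma word_tape_snoc:
  "(word_tape w)(int (length w) := (if b then 2 else 1)) = word_tape (w @ [b])"
  by (auto simp: word_tape_def fun_eq_iff nth_append)

lemma map2_upt_eqI:
  assumes "length ts = n" "length ts' = n" "\<And>j. j < n \<Longrightarrow> act_on_tape (F j) (ts ! j) = ts' ! j"
  shows "map2 act_on_tape (map F [0..<n]) ts = ts'"
  using assms by (intro nth_equalityI) (auto simp del: upt_Suc)

text \<open>Register tapes keep their contents and only their heads move. The output head always
  stands on the first blank cell behind the output, so \<open>Out\<close> is one write followed by a
  move to the right.\<close>

lemma reach_cmp:
  assumes "exec x c s t s'" "regs c \<subseteq> {..<k}"
  shows "reach (cmp (Suc k) c) t (0, tapes k x s) (n_states (cmp (Suc k) c), tapes k x s')"
  using assms
proof (induction rule: exec.induct)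
  case (Inc i h w)
  have "map2 act_on_tape (map (\<lambda>j. (map (\<lambda>(f, h). f h) (tapes k x (h, w)) ! j, if j = i then 1 else 0)) [0..<Suc k])
      (tapes k x (h, w)) = tapes k x (h(i := Suc (h i)), w)"
    using Inc by (intro map2_upt_eqI) (auto simp: less_Suc_eq nth_tapes simp del: upt_Suc tapes.simps)
  then show ?case by (intro reach_one) (simp del: upt_Suc tapes.simps)
next
  case (Dec h i w)
  have "map2 act_on_tape (map (\<lambda>j. (map (\<lambda>(f, h). f h) (tapes k x (h, w)) ! j, if j = i then -1 else 0)) [0..<Suc k])
      (tapes k x (h, w)) = tapes k x (h(i := h i - 1), w)"
    using Dec by (intro map2_upt_eqI) (auto simp: less_Suc_eq nth_tapes of_nat_diff simp del: upt_Suc tapes.simps)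
  then show ?case by (intro reach_one) (simp del: upt_Suc tapes.simps)
next
  case (Out b h w)
  have "map2 act_on_tape (map (\<lambda>j. if j = k then (if b then 2 else 1, 1)
        else (map (\<lambda>(f, h). f h) (tapes k x (h, w)) ! j, 0)) [0..<Suc k])
      (tapes k x (h, w)) = tapes k x (h, w @ [b])"
    by (intro map2_upt_eqI)
      (auto simp: less_Suc_eq nth_tapes word_tape_snoc[of w True, symmetric, simplified]
        word_tape_snoc[of w False, symmetric, simplified] simp del: upt_Suc tapes.simps)
  then show ?case by (intro reach_one) (simp del: upt_Suc tapes.simps)
next
  case (Seq c s t s1 d t' s2)
  let ?M1 = "cmp (Suc k) c" and ?M2 = "cmp (Suc k) d" and ?N = "cmp (Suc k) (c ;; d)"
  from Seq obtain u where u: "u \<le> t" "(step ?M1 ^^ u) (0, tapes k x s) = (n_states ?M1, tapes k x s1)"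
    unfolding reach_def by auto
  from Seq obtain u' where u': "u' \<le> t'" "(step ?M2 ^^ u') (0, tapes k x s1) = (n_states ?M2, tapes k x s2)"
    unfolding reach_def by auto
  have "reach ?N u (0 + 0, tapes k x s) (n_states ?M1, tapes k x s1)"
    by (rule reach_emb[OF _ _ _ _ u(2)]) (simp_all add: Let_def wf_cmp tapes_lt_3 del: tapes.simps)
  moreover have "reach ?N u' (0 + n_states ?M1, tapes k x s1) (n_states ?N, tapes k x s2)"
    by (rule reach_emb[OF _ _ _ _ u'(2)]) (simp_all add: Let_def wf_cmp tapes_lt_3 del: tapes.simps)
  ultimately have "reach ?N (u + u') (0, tapes k x s) (n_states ?N, tapes k x s2)"
    unfolding add_0 by (rule reach_trans)
  then show ?case by (rule reach_mono) (use u u' in simp)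
next
  case (CondT s C c t s' d)
  let ?M1 = "cmp (Suc k) c" and ?M2 = "cmp (Suc k) d" and ?N = "cmp (Suc k) (Cond C c d)"
  from CondT obtain u where u: "u \<le> t" "(step ?M1 ^^ u) (0, tapes k x s) = (n_states ?M1, tapes k x s')"
    unfolding reach_def by auto
  have "reach ?N u (0 + 1, tapes k x s) (n_states ?N, tapes k x s')"
    by (rule reach_emb[OF _ _ _ _ u(2)]) (simp_all add: Let_def wf_cmp tapes_lt_3 del: tapes.simps)
  moreover have "step ?N (0, tapes k x s) = (1, tapes k x s)"
    using CondT by (simp add: Let_def stest_scanned keep_tapes del: tapes.simps)
  ultimately have "reach ?N (Suc t) (0, tapes k x s) (n_states ?N, tapes k x s')"
    unfolding add_0 by (intro reach_step) (simp only: reach_mono[OF _ u(1)])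
  then show ?case by (rule reach_mono) simp
next
  case (CondF s C d t s' c)
  let ?M1 = "cmp (Suc k) c" and ?M2 = "cmp (Suc k) d" and ?N = "cmp (Suc k) (Cond C c d)"
  from CondF obtain u where u: "u \<le> t" "(step ?M2 ^^ u) (0, tapes k x s) = (n_states ?M2, tapes k x s')"
    unfolding reach_def by auto
  have "reach ?N u (0 + (1 + n_states ?M1), tapes k x s) (n_states ?N, tapes k x s')"
    by (rule reach_emb[OF _ _ _ _ u(2)]) (simp_all add: Let_def wf_cmp tapes_lt_3 del: tapes.simps)
  moreover have "step ?N (0, tapes k x s) = (1 + n_states ?M1, tapes k x s)"
    using CondF by (simp add: Let_def stest_scanned keep_tapes del: tapes.simps)
  ultimately have "reach ?N (Suc t) (0, tapes k x s) (n_states ?N, tapes k x s')"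
    unfolding add_0 by (intro reach_step) (simp only: reach_mono[OF _ u(1)])
  then show ?case by (rule reach_mono) simp
next
  case (LoopF s C c)
  let ?N = "cmp (Suc k) (Loop C c)"
  have "step ?N (0, tapes k x s) = (n_states ?N, tapes k x s)"
    using LoopF by (simp add: Let_def stest_scanned keep_tapes del: tapes.simps)
  then show ?case by (rule reach_one)
next
  case (LoopT s C c t s1 t' s2)
  let ?M1 = "cmp (Suc k) c" and ?N = "cmp (Suc k) (Loop C c)"
  from LoopT obtain u where u: "u \<le> t" "(step ?M1 ^^ u) (0, tapes k x s) = (n_states ?M1, tapes k x s1)"
    unfolding reach_def by auto
  have "reach ?N u (0 + 1, tapes k x s) (0, tapes k x s1)"
    by (rule reach_emb[OF _ _ _ _ u(2)]) (simp_all add: Let_def wf_cmp tapes_lt_3 del: tapes.simps)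
  then have "reach ?N t (1, tapes k x s) (0, tapes k x s1)" unfolding add_0 by (rule reach_mono[OF _ u(1)])
  moreover have "step ?N (0, tapes k x s) = (1, tapes k x s)"
    using LoopT by (simp add: Let_def stest_scanned keep_tapes del: tapes.simps)
  ultimately have "reach ?N (Suc t) (0, tapes k x s) (0, tapes k x s1)"
    by (intro reach_step) (simp only:)
  from reach_trans[OF this LoopT.IH(2)[OF LoopT.prems]]
  have "reach ?N (Suc t + t') (0, tapes k x s) (n_states ?N, tapes k x s2)" .
  moreover have "Suc t + t' = t + t' + 1" by simp
  ultimately show ?case by (simp only:)
next
  case (Le c s t s' t')
  then show ?case using reach_mono by blast
qed

definition mark :: "nat \<Rightarrow> nat list \<Rightarrow> (nat \<times> int) list" where
  "mark k s = map (\<lambda>j. (if 0 < j \<and> j < k then 1 else s ! j, 0)) [0..<Suc k]"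

definition with_marks :: "nat \<Rightarrow> tm \<Rightarrow> tm" where
  "with_marks k M = machine (Suc k) (Suc (n_states M))
    (\<lambda>q s. if q = 0 then (1, mark k s) else emb M 1 (Suc (n_states M)) q s)"

lemma act_mark:
  assumes "k \<ge> 1" and ts: "ts = (word_tape x, 0) # replicate k (\<lambda>_. 0, 0)"
  shows "map2 act_on_tape (mark k (map (\<lambda>(f, h). f h) ts)) ts = tapes k x (\<lambda>_. 0, [])"
  unfolding mark_def
proof (rule map2_upt_eqI)
  fix i assume i: "i < Suc k"
  show "act_on_tape (if 0 < i \<and> i < k then 1 else map (\<lambda>(f, h). f h) ts ! i, 0) (ts ! i)
      = tapes k x (\<lambda>_. 0, []) ! i"
  proof (cases "i = 0")
    case True
    then show ?thesis using assms by (simp add: nth_append cont_def)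
  next
    case False
    then have "ts ! i = (\<lambda>_. 0, 0)" "length ts = Suc k" using i by (simp_all add: ts nth_Cons')
    then show ?thesis using i False assms(1)
      by (cases "i < k") (auto simp: nth_append cont_def word_tape_def fun_eq_iff less_Suc_eq)
  qed
qed (simp_all add: ts)

lemma wf_with_marks:
  assumes "wf_tm M" "n_tapes M = Suc k" "n_symbols M = 3"
  shows "wf_tm (with_marks k M)"
proof -
  have "okd (Suc k) (n_states M) (delta M q s)"
    if "q < n_states M" "length s = Suc k" "set s \<subseteq> {..<3}" for q s
    using assms that by (simp add: wf_tm_alt)
  moreover have "okd (Suc k) (Suc (n_states M)) (1, mark k s)"
    if "length s = Suc k" "set s \<subseteq> {..<3}" for s
    using that by (auto simp: okd_def mark_def nth_lt_3 simp del: upt_Suc)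
  ultimately show ?thesis
    by (auto simp: with_marks_def wf_tm_alt intro!: okd_emb)
qed

lemma step_with_marks:
  assumes "k \<ge> 1"
  shows "step (with_marks k M) (init_config (with_marks k M) x) = (1, tapes k x (\<lambda>_. 0, []))"
proof -
  define ts :: "tape list" where "ts = (word_tape x, 0) # replicate k (\<lambda>_. 0, 0)"
  have "init_config (with_marks k M) x = (0, ts)"
    by (simp add: init_config_def with_marks_def ts_def)
  moreover have "0 < n_states (with_marks k M)" "\<And>s. delta (with_marks k M) 0 s = (1, mark k s)"
    by (simp_all add: with_marks_def)
  ultimately show ?thesis
    using act_mark[OF assms ts_def] by (simp only: step.simps if_True prod.case)
qed

lemma polytime_exec:
  assumes ex: "\<And>x. \<exists>h. exec x c (\<lambda>_. 0, []) (poly p (length x)) (h, f x)"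
  shows "polytime f"
proof -
  obtain k0 where "regs c \<subseteq> {..<k0}"
    using finite_nat_iff_bounded[of "regs c"] finite_regs[of c] by blast
  \<comment> \<open>At least one tape precedes the output tape, so the input tape and the output
    tape are different.\<close>
  then obtain k where k: "regs c \<subseteq> {..<k}" "k \<ge> 1"
    by (metis le_add2 lessThan_subset_iff le_add1 order_trans)
  define M where "M = cmp (Suc k) c"
  define N where "N = with_marks k M"
  have "wf_tm N" unfolding N_def M_def by (intro wf_with_marks wf_cmp cmp_simps)
  moreover have "outputs_within N x (f x) (poly (p + 1) (length x))" for x
  proof -
    define s :: rstate where "s = (\<lambda>_. 0, [])"
    define t where "t = poly p (length x)"
    obtain h where h: "exec x c s t (h, f x)" using ex[of x] unfolding s_def t_def by (elim exE)
    define s' where "s' = (h, f x)"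
    obtain u where u: "u \<le> t" "(step M ^^ u) (0, tapes k x s) = (n_states M, tapes k x s')"
      using reach_cmp[OF h k(1)] unfolding reach_def M_def s'_def by blast
    have "reach N u (0 + 1, tapes k x s) (n_states N, tapes k x s')"
      by (rule reach_emb[OF _ _ _ _ u(2)])
        (simp_all add: N_def M_def with_marks_def wf_cmp tapes_lt_3 del: tapes.simps)
    then have "reach N (Suc t) (init_config N x) (n_states N, tapes k x s')"
      unfolding N_def by (intro reach_step)
        (simp only: step_with_marks[OF k(2)] s_def add_0 reach_mono[OF _ u(1)])
    then obtain v where v: "v \<le> Suc t" "(step N ^^ v) (init_config N x) = (n_states N, tapes k x s')"
      unfolding reach_def by blast
    have "(step N ^^ (Suc t - v + v)) (init_config N x) = (n_states N, tapes k x s')"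
      by (simp only: funpow_add comp_apply v(2) step_halted)
    then show ?thesis using v(1) by (simp add: outputs_within_def s'_def t_def)
  qed
  ultimately show ?thesis unfolding polytime_def by blast
qed

section \<open>First-order definable functions are computable in polynomial time\<close>

text \<open>
  Bound variables are named, not indexed: \<open>wff d\<close> demands that they are numbered increasingly from
  \<open>d\<close> on, so that the numbers can serve as registers.
\<close>

datatype trm = V nat | Cn nat | Pl trm trm | Ti trm trm

datatype fm = Ls trm trm | Bt trm | Ng fm | An fm fm | Ex nat trm fm

fun tv :: "(nat \<Rightarrow> nat) \<Rightarrow> trm \<Rightarrow> nat" where
  "tv e (V i) = e i"
| "tv e (Cn c) = c"
| "tv e (Pl a b) = tv e a + tv e b"
| "tv e (Ti a b) = tv e a * tv e b"

fun fv :: "bool list \<Rightarrow> (nat \<Rightarrow> nat) \<Rightarrow> fm \<Rightarrow> bool" where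
  "fv x e (Ls a b) \<longleftrightarrow> tv e a < tv e b"
| "fv x e (Bt a) \<longleftrightarrow> tv e a < length x \<and> x ! tv e a"
| "fv x e (Ng \<phi>) \<longleftrightarrow> \<not> fv x e \<phi>"
| "fv x e (An \<phi> \<psi>) \<longleftrightarrow> fv x e \<phi> \<and> fv x e \<psi>"
| "fv x e (Ex v b \<phi>) \<longleftrightarrow> (\<exists>i < tv e b. fv x (e(v := i)) \<phi>)"

fun wft :: "nat \<Rightarrow> trm \<Rightarrow> bool" where
  "wft d (V i) \<longleftrightarrow> i < d"
| "wft d (Cn c) \<longleftrightarrow> True"
| "wft d (Pl a b) \<longleftrightarrow> wft d a \<and> wft d b"
| "wft d (Ti a b) \<longleftrightarrow> wft d a \<and> wft d b"

fun wff :: "nat \<Rightarrow> fm \<Rightarrow> bool" where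
  "wff d (Ls a b) \<longleftrightarrow> wft d a \<and> wft d b"
| "wff d (Bt a) \<longleftrightarrow> wft d a"
| "wff d (Ng \<phi>) \<longleftrightarrow> wff d \<phi>"
| "wff d (An \<phi> \<psi>) \<longleftrightarrow> wff d \<phi> \<and> wff d \<psi>"
| "wff d (Ex v b \<phi>) \<longleftrightarrow> d \<le> v \<and> wft d b \<and> wff (Suc v) \<phi>"

lemma tv_cong: "wft d t \<Longrightarrow> (\<And>i. i < d \<Longrightarrow> e i = e' i) \<Longrightarrow> tv e t = tv e' t"
  by (induction t) auto

text \<open>
  Register \<open>0\<close> is the input head, \<open>1\<close> holds truth values, \<open>2\<close> counts the remaining output bits, and
  variable \<open>v\<close> is kept in register \<open>v + 3\<close>. Registers from \<open>m\<close> on are scratch and hold \<open>0\<close>.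
\<close>

abbreviation nz :: "nat \<Rightarrow> nat \<times> nat \<times> bool" where "nz i \<equiv> (i, 0, True)"

abbreviation Skip :: com where "Skip \<equiv> Loop [(0, 0, True), (0, 0, False)] (Out True)"

fun incs :: "nat \<Rightarrow> nat \<Rightarrow> com" where
  "incs 0 g = Skip"
| "incs (Suc c) g = Inc g ;; incs c g"

text \<open>Reading a register destroys it. A variable is therefore moved to \<open>g\<close> and to
  the scratch register \<open>m\<close> at the same time and then restored from \<open>m\<close>. A
  product is a repeated addition whose counter is the value of the first factor, kept in
  \<open>m\<close>; deeper terms use scratch registers beyond \<open>m\<close>.\<close>

fun ct :: "trm \<Rightarrow> nat \<Rightarrow> nat \<Rightarrow> com" where
  "ct (V i) g m = Loop [nz (i + 3)] (Dec (i + 3) ;; Inc g ;; Inc m) ;; Loop [nz m] (Dec m ;; Inc (i + 3))"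
| "ct (Cn c) g m = incs c g"
| "ct (Pl a b) g m = ct a g m ;; ct b g m"
| "ct (Ti a b) g m = ct a m (Suc m) ;; Loop [nz m] (Dec m ;; ct b g (Suc m))"

text \<open>The result is added to register 1, which has to be 0 at the start. A quantifier searches
  downwards from its bound, so that the quantified variable is itself the loop counter, and it stops
  at the first witness found.\<close>

fun cf :: "nat \<Rightarrow> fm \<Rightarrow> com" where
  "cf d (Ls a b) = ct a (d + 3) (d + 5) ;; ct b (d + 4) (d + 5) ;;
    Loop [nz (d + 3), nz (d + 4)] (Dec (d + 3) ;; Dec (d + 4)) ;;
    Cond [nz (d + 4)] (Inc 1) Skip ;; Loop [nz (d + 3)] (Dec (d + 3)) ;; Loop [nz (d + 4)] (Dec (d + 4))"
| "cf d (Bt a) = ct a (d + 3) (d + 4) ;; Loop [nz (d + 3)] (Dec (d + 3) ;; Inc (d + 4) ;; Inc 0) ;;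
    Cond [(0, 2, True)] (Inc 1) Skip ;; Loop [nz (d + 4)] (Dec (d + 4) ;; Dec 0)"
| "cf d (Ng \<phi>) = cf d \<phi> ;; Cond [nz 1] (Dec 1) (Inc 1)"
| "cf d (An \<phi> \<psi>) = cf d \<phi> ;; Cond [nz 1] (Dec 1 ;; cf d \<psi>) Skip"
| "cf d (Ex v b \<phi>) = ct b (v + 3) (v + 4) ;;
    Loop [nz (v + 3), (1, 0, False)] (Dec (v + 3) ;; cf (Suc v) \<phi>) ;; Loop [nz (v + 3)] (Dec (v + 3))"

text \<open>Values of terms (\<open>tb\<close>), time for terms (\<open>tc\<close>) and time for
  formulas (\<open>fc\<close>) as polynomials in the input length, where \<open>B\<close> bounds the
  variables. Each quantifier enlarges \<open>B\<close> by the bound of its range; as the nesting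
  depth is fixed, everything stays polynomial.\<close>

fun tb :: "trm \<Rightarrow> nat poly \<Rightarrow> nat poly" where
  "tb (V i) B = B"
| "tb (Cn c) B = [:c:]"
| "tb (Pl a b) B = tb a B + tb b B"
| "tb (Ti a b) B = tb a B * tb b B"

fun tc :: "trm \<Rightarrow> nat poly \<Rightarrow> nat poly" where
  "tc (V i) B = [:7:] * B + [:2:]"
| "tc (Cn c) B = [:c + 1:]"
| "tc (Pl a b) B = tc a B + tc b B"
| "tc (Ti a b) B = tc a B + (tb a B * (tc b B + [:2:]) + 1)"

fun fc :: "fm \<Rightarrow> nat poly \<Rightarrow> nat poly" where
  "fc (Ls a b) B = tc a B + tc b B + [:10:] * (tb a B + tb b B) + [:10:]"
| "fc (Bt a) B = tc a B + [:10:] * tb a B + [:10:]"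
| "fc (Ng \<phi>) B = fc \<phi> B + [:3:]"
| "fc (An \<phi> \<psi>) B = fc \<phi> B + fc \<psi> B + [:5:]"
| "fc (Ex v b \<phi>) B = tc b B + tb b B * (fc \<phi> (B + tb b B) + [:4:]) + [:5:]"

lemma tv_le:
  "wft d t \<Longrightarrow> (\<And>i. i < d \<Longrightarrow> e i \<le> poly B n) \<Longrightarrow> tv e t \<le> poly (tb t B) n"
  by (induction t) (auto intro: add_mono mult_mono)

lemma ctest_nz: "i > 0 \<Longrightarrow> ctest x h [nz i] \<longleftrightarrow> h i > 0"
  by (auto simp: ctest_def scan_def)

lemma exec_Skip: "exec x Skip s 1 s"
  by (rule exec.LoopF) (auto simp: ctest_def)

lemma exec_seq: "exec x c s t s1 \<Longrightarrow> exec x d s1 t' s2 \<Longrightarrow> t + t' \<le> T \<Longrightarrow> exec x (c ;; d) s T s2"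
  by (rule exec.Le[OF exec.Seq])

lemma exec_inc: "(h' :: nat \<Rightarrow> nat) = h(i := Suc (h i)) \<Longrightarrow> exec x (Inc i) (h, w) 1 (h', w)"
  using exec.Inc by simp

lemma exec_dec: "h i > 0 \<Longrightarrow> (h' :: nat \<Rightarrow> nat) = h(i := h i - 1) \<Longrightarrow> exec x (Dec i) (h, w) 1 (h', w)"
  using exec.Dec by simp

lemmas exec_inc_Suc = exec_inc[unfolded One_nat_def]
lemmas exec_dec_Suc = exec_dec[unfolded One_nat_def]

lemma exec_incs:
  fixes h :: "nat \<Rightarrow> nat" and w :: "bool list"
  shows "exec x (incs c g) (h, w) (c + 1) (h(g := h g + c), w)"
proof (induction c arbitrary: h)
  case 0
  then show ?case using exec_Skip[of x "(h, w)"] by simp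
next
  case (Suc c)
  have "exec x (incs c g) (h(g := Suc (h g)), w) (c + 1) ((h(g := Suc (h g)))(g := (h(g := Suc (h g))) g + c), w)"
    by (rule Suc.IH)
  from exec_seq[OF exec_inc[OF refl] this order_refl]
  have "exec x (incs (Suc c) g) (h, w) (Suc c + 1) (h(g := h g + Suc c), w)" by simp
  then show ?case by (rule exec.Le) simp
qed

lemma exec_clear:
  fixes h :: "nat \<Rightarrow> nat" and w :: "bool list"
  assumes "i > 0" "h i \<le> n"
  shows "exec x (Loop [nz i] (Dec i)) (h, w) (2 * n + 1) (h(i := 0), w)"
proof -
  define S where "S j = (h(i := h i - j), w)" for j
  have "exec x (Loop [nz i] (Dec i)) (S 0) (h i * (1 + 1) + 1) (S (h i))"
    using assms unfolding S_def
    by (intro exec_loop) (auto simp: ctest_def scan_def intro!: exec_dec_Suc)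
  then show ?thesis using assms by (auto simp: S_def elim!: exec.Le)
qed

text \<open>The target \<open>g\<close> is the output counter or lies beyond the variables, so
  accumulating into it does not disturb the evaluation of further terms.\<close>

lemma exec_ct:
  fixes h :: "nat \<Rightarrow> nat" and w :: "bool list"
  assumes "wft d t" "d + 3 \<le> m" "g < m" "g = 2 \<or> d + 3 \<le> g" "\<And>j. j \<ge> m \<Longrightarrow> h j = 0"
    and "\<And>i. i < d \<Longrightarrow> h (i + 3) \<le> poly B n"
  shows "exec x (ct t g m) (h, w) (poly (tc t B) n) (h(g := h g + tv (\<lambda>i. h (i + 3)) t), w)"
  using assms
proof (induction t g m arbitrary: h rule: ct.induct)
  case (1 i g m)
  let ?i = "i + 3"
  define N where "N = h ?i"
  have ne: "?i \<noteq> g" "?i \<noteq> m" "g \<noteq> m" "m > 0" "?i > 0" using 1 by auto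
  define S where "S j = (h(?i := N - j, g := h g + j, m := j), w)" for j
  define S' where "S' j = (h(?i := j, g := h g + N, m := N - j), w)" for j
  have "exec x (Loop [nz ?i] (Dec ?i ;; Inc g ;; Inc m)) (S 0) (N * (3 + 1) + 1) (S N)"
  proof (rule exec_loop)
    fix j assume j: "j < N"
    show "ctest x (fst (S j)) [nz ?i]" using ne j by (simp add: ctest_nz S_def)
    show "exec x (Dec ?i ;; Inc g ;; Inc m) (S j) 3 (S (Suc j))"
      unfolding S_def using ne j
      by (intro exec_seq[OF exec_dec[OF _ refl] exec_seq[OF exec_inc[OF refl] exec_inc order_refl]])
        (auto simp: fun_eq_iff)
  qed (use ne in \<open>simp add: ctest_nz S_def\<close>)
  moreover have "exec x (Loop [nz m] (Dec m ;; Inc ?i)) (S' 0) (N * (2 + 1) + 1) (S' N)"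
  proof (rule exec_loop)
    fix j assume j: "j < N"
    show "ctest x (fst (S' j)) [nz m]" using ne j by (simp add: ctest_nz S'_def)
    show "exec x (Dec m ;; Inc ?i) (S' j) 2 (S' (Suc j))"
      unfolding S'_def using ne j
      by (intro exec_seq[OF exec_dec[OF _ refl] exec_inc]) (auto simp: fun_eq_iff)
  qed (use ne in \<open>simp add: ctest_nz S'_def\<close>)
  moreover have "S 0 = (h, w)" "S N = S' 0" "S' N = (h(g := h g + N), w)"
    using ne 1(5)[of m] by (auto simp: S_def S'_def N_def fun_eq_iff)
  ultimately have "exec x (ct (V i) g m) (h, w) (N * (3 + 1) + 1 + (N * (2 + 1) + 1)) (h(g := h g + N), w)"
    unfolding ct.simps by (metis exec.Seq)
  then have "exec x (ct (V i) g m) (h, w) (N * (3 + 1) + 1 + (N * (2 + 1) + 1))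
      (h(g := h g + tv (\<lambda>i. h (i + 3)) (V i)), w)" by (simp add: N_def)
  moreover have "N \<le> poly B n" using 1 by (auto simp: N_def)
  ultimately show ?case by (elim exec.Le) simp
next
  case (2 c g m)
  have "exec x (ct (Cn c) g m) (h, w) (c + 1) (h(g := h g + tv (\<lambda>i. h (i + 3)) (Cn c)), w)"
    using exec_incs[of x c g h w] by simp
  then show ?case by (rule exec.Le) simp
next
  case (3 a b g m)
  define h1 where "h1 = h(g := h g + tv (\<lambda>i. h (i + 3)) a)"
  have e: "tv (\<lambda>i. h1 (i + 3)) b = tv (\<lambda>i. h (i + 3)) b"
    by (rule tv_cong[of d]) (use 3 in \<open>auto simp: h1_def\<close>)
  have "exec x (ct a g m) (h, w) (poly (tc a B) n) (h1, w)"
    unfolding h1_def using 3 by (intro "3.IH") auto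
  moreover have "exec x (ct b g m) (h1, w) (poly (tc b B) n) (h1(g := h1 g + tv (\<lambda>i. h1 (i + 3)) b), w)"
    using 3(3-) by (intro "3.IH") (auto simp: h1_def)
  ultimately have "exec x (ct (Pl a b) g m) (h, w) (poly (tc a B) n + poly (tc b B) n)
      (h1(g := h1 g + tv (\<lambda>i. h1 (i + 3)) b), w)" unfolding ct.simps by (rule exec.Seq)
  then have "exec x (ct (Pl a b) g m) (h, w) (poly (tc a B) n + poly (tc b B) n)
      (h(g := h g + tv (\<lambda>i. h (i + 3)) (Pl a b)), w)"
    unfolding e by (simp add: h1_def add.assoc)
  then show ?case by (rule exec.Le) simp
next
  case (4 a b g m)
  define A where "A = tv (\<lambda>i. h (i + 3)) a"
  define Bv where "Bv = tv (\<lambda>i. h (i + 3)) b"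
  have ne: "g \<noteq> m" "m > 0" using 4 by auto
  define S where "S j = (h(m := A - j, g := h g + j * Bv), w)" for j
  have a: "exec x (ct a m (Suc m)) (h, w) (poly (tc a B) n) (h(m := h m + A), w)"
    unfolding A_def using 4(3-) by (intro "4.IH") auto
  have "exec x (Loop [nz m] (Dec m ;; ct b g (Suc m))) (S 0) (A * ((1 + poly (tc b B) n) + 1) + 1) (S A)"
  proof (rule exec_loop)
    fix j assume j: "j < A"
    show "ctest x (fst (S j)) [nz m]" using ne j by (simp add: ctest_nz S_def)
    define h1 where "h1 = h(m := A - Suc j, g := h g + j * Bv)"
    have e: "tv (\<lambda>i. h1 (i + 3)) b = Bv"
      unfolding Bv_def by (rule tv_cong[of d]) (use 4 in \<open>auto simp: h1_def\<close>)
    have "exec x (ct b g (Suc m)) (h1, w) (poly (tc b B) n) (h1(g := h1 g + tv (\<lambda>i. h1 (i + 3)) b), w)"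
      using 4(3-) by (intro "4.IH") (auto simp: h1_def)
    moreover have "exec x (Dec m) (S j) 1 (h1, w)"
      unfolding S_def using ne j by (intro exec_dec) (auto simp: h1_def fun_eq_iff)
    ultimately have "exec x (Dec m ;; ct b g (Suc m)) (S j) (1 + poly (tc b B) n) (h1(g := h1 g + Bv), w)"
      unfolding e by (intro exec.Seq)
    then show "exec x (Dec m ;; ct b g (Suc m)) (S j) (1 + poly (tc b B) n) (S (Suc j))"
      using ne by (simp add: S_def h1_def fun_upd_twist algebra_simps)
  qed (use ne in \<open>simp add: ctest_nz S_def\<close>)
  moreover have "S 0 = (h(m := h m + A), w)" "S A = (h(g := h g + A * Bv), w)"
    using ne 4(7)[of m] by (auto simp: S_def fun_eq_iff)
  moreover have "A \<le> poly (tb a B) n" unfolding A_def by (rule tv_le[of d]) (use 4 in auto)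
  then have "A * ((1 + poly (tc b B) n) + 1) \<le> poly (tb a B) n * (poly (tc b B) n + 2)"
    by (intro mult_mono) auto
  moreover have "A * Bv = tv (\<lambda>i. h (i + 3)) (Ti a b)" by (simp add: A_def Bv_def)
  ultimately have "exec x (ct (Ti a b) g m) (h, w) (poly (tc (Ti a b) B) n)
      (h(g := h g + tv (\<lambda>i. h (i + 3)) (Ti a b)), w)"
    using a unfolding ct.simps by (intro exec_seq) auto
  then show ?case by (rule exec.Le) simp
qed

text \<open>Everything but register 1 is restored, including the input head and all scratch
  registers. This is what makes subformulas composable although they share their scratch
  space.\<close>

lemma exec_cf:
  fixes h :: "nat \<Rightarrow> nat" and w :: "bool list"
  assumes "wff d \<phi>" "h 0 = 0" "h 1 = 0" "\<And>j. j \<ge> d + 3 \<Longrightarrow> h j = 0"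
    and "\<And>i. i < d \<Longrightarrow> h (i + 3) \<le> poly B n"
  shows "exec x (cf d \<phi>) (h, w) (poly (fc \<phi> B) n) (h(1 := if fv x (\<lambda>i. h (i + 3)) \<phi> then 1 else 0), w)"
  using assms
proof (induction d \<phi> arbitrary: h B rule: cf.induct)
  case (1 d a b)
  define va where "va = tv (\<lambda>i. h (i + 3)) a"
  define vb where "vb = tv (\<lambda>i. h (i + 3)) b"
  define k where "k = min va vb"
  let ?p = "d + 3" and ?q = "d + 4"
  have z: "h ?p = 0" "h ?q = 0" using 1 by auto
  define h1 where "h1 = h(?p := va)"
  define h2 where "h2 = h1(?q := vb)"
  define S where "S j = (h(?p := va - j, ?q := vb - j), w)" for j
  define h3 where "h3 = h(?p := va - k, ?q := vb - k, 1 := if va < vb then 1 else 0)"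
  have "exec x (ct a ?p (d + 5)) (h, w) (poly (tc a B) n) (h(?p := h ?p + va), w)"
    unfolding va_def using 1 by (intro exec_ct) auto
  then have a: "exec x (ct a ?p (d + 5)) (h, w) (poly (tc a B) n) (h1, w)"
    by (simp add: h1_def z)
  have e: "tv (\<lambda>i. h1 (i + 3)) b = vb"
    unfolding vb_def by (rule tv_cong[of d]) (use 1 in \<open>auto simp: h1_def\<close>)
  have "exec x (ct b ?q (d + 5)) (h1, w) (poly (tc b B) n) (h1(?q := h1 ?q + tv (\<lambda>i. h1 (i + 3)) b), w)"
    using 1 by (intro exec_ct) (auto simp: h1_def)
  then have b: "exec x (ct b ?q (d + 5)) (h1, w) (poly (tc b B) n) (h2, w)"
    unfolding e by (simp add: h2_def h1_def z)
  have "exec x (Loop [nz ?p, nz ?q] (Dec ?p ;; Dec ?q)) (S 0) (k * (2 + 1) + 1) (S k)"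
  proof (rule exec_loop)
    fix j assume j: "j < k"
    then show "ctest x (fst (S j)) [nz ?p, nz ?q]" by (simp add: S_def k_def ctest_def scan_def)
    show "exec x (Dec ?p ;; Dec ?q) (S j) 2 (S (Suc j))"
      unfolding S_def using j
      by (intro exec_seq[OF exec_dec[OF _ refl] exec_dec]) (auto simp: k_def fun_eq_iff)
  qed (auto simp: S_def k_def ctest_def scan_def)
  moreover have "S 0 = (h2, w)" by (auto simp: S_def h2_def h1_def)
  ultimately have c: "exec x (Loop [nz ?p, nz ?q] (Dec ?p ;; Dec ?q)) (h2, w) (k * (2 + 1) + 1) (S k)"
    by simp
  have f: "exec x (Cond [nz ?q] (Inc 1) Skip) (S k) (1 + 1) (h3, w)"
  proof (cases "va < vb")
    case True
    then show ?thesis using 1(3) by (intro exec.CondT)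
      (auto simp: S_def h3_def k_def ctest_def scan_def fun_eq_iff intro!: exec_inc_Suc)
  next
    case False
    then have "S k = (h3, w)" using 1(3) by (auto simp: S_def h3_def k_def fun_eq_iff)
    moreover have "\<not> ctest x (fst (S k)) [nz ?q]"
      using False by (auto simp: S_def k_def ctest_def scan_def)
    ultimately show ?thesis using exec.CondF[OF _ exec_Skip] by metis
  qed
  have g: "exec x (Loop [nz ?p] (Dec ?p)) (h3, w) (2 * va + 1) (h3(?p := 0), w)"
    by (rule exec_clear) (auto simp: h3_def)
  have "exec x (Loop [nz ?q] (Dec ?q)) (h3(?p := 0), w) (2 * vb + 1) (h3(?p := 0, ?q := 0), w)"
    by (rule exec_clear) (auto simp: h3_def)
  moreover have "h3(?p := 0, ?q := 0) = h(1 := if va < vb then 1 else 0)"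
    using z by (auto simp: h3_def fun_eq_iff)
  ultimately have i: "exec x (Loop [nz ?q] (Dec ?q)) (h3(?p := 0), w) (2 * vb + 1)
      (h(1 := if va < vb then 1 else 0), w)" by metis
  have "va \<le> poly (tb a B) n" "vb \<le> poly (tb b B) n" "k \<le> va"
    using 1 unfolding va_def vb_def k_def by (auto intro!: tv_le[of d])
  then have T: "poly (tc a B) n + (poly (tc b B) n + (k * (2 + 1) + 1 + (1 + 1 + (2 * va + 1 + (2 * vb + 1)))))
      \<le> poly (fc (Ls a b) B) n" by simp
  have f': "fv x (\<lambda>i. h (i + 3)) (Ls a b) \<longleftrightarrow> va < vb" by (simp add: va_def vb_def)
  show ?case unfolding f' cf.simps
    by (rule exec.Le[OF exec.Seq[OF a exec.Seq[OF b exec.Seq[OF c exec.Seq[OF f exec.Seq[OF g i]]]]] T])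
next
  case (2 d a)
  define va where "va = tv (\<lambda>i. h (i + 3)) a"
  let ?p = "d + 3" and ?q = "d + 4"
  let ?r = "if va < length x \<and> x ! va then 1 else 0 :: nat"
  have z: "h ?p = 0" "h ?q = 0" "h 0 = 0" "h 1 = 0" using 2 by auto
  have a: "exec x (ct a ?p ?q) (h, w) (poly (tc a B) n) (h(?p := h ?p + va), w)"
    unfolding va_def using 2 by (intro exec_ct) auto
  define S where "S j = (h(?p := va - j, ?q := j, 0 := j), w)" for j
  define S' where "S' j = (h(1 := ?r, ?q := va - j, 0 := va - j), w)" for j
  have b: "exec x (Loop [nz ?p] (Dec ?p ;; Inc ?q ;; Inc 0)) (S 0) (va * (3 + 1) + 1) (S va)"
  proof (rule exec_loop)
    fix j assume j: "j < va"
    then show "ctest x (fst (S j)) [nz ?p]" by (simp add: S_def ctest_nz)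
    show "exec x (Dec ?p ;; Inc ?q ;; Inc 0) (S j) 3 (S (Suc j))"
      unfolding S_def using j
      by (intro exec_seq[OF exec_dec[OF _ refl] exec_seq[OF exec_inc[OF refl] exec_inc order_refl]])
        (auto simp: fun_eq_iff)
  qed (auto simp: S_def ctest_nz)
  have ct: "ctest x (fst (S va)) [(0, 2, True)] \<longleftrightarrow> va < length x \<and> x ! va"
    by (auto simp: ctest_def scan_def S_def word_tape_def)
  have c: "exec x (Cond [(0, 2, True)] (Inc 1) Skip) (S va) (1 + 1) (S' 0)"
  proof (cases "va < length x \<and> x ! va")
    case True
    then show ?thesis using ct z by (intro exec.CondT)
      (auto simp: S_def S'_def fun_eq_iff intro!: exec_inc_Suc)
  next
    case False
    then have "S va = S' 0" using z by (auto simp: S_def S'_def fun_eq_iff)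
    then show ?thesis using False ct exec.CondF[OF _ exec_Skip] by metis
  qed
  have f: "exec x (Loop [nz ?q] (Dec ?q ;; Dec 0)) (S' 0) (va * (2 + 1) + 1) (S' va)"
  proof (rule exec_loop)
    fix j assume j: "j < va"
    then show "ctest x (fst (S' j)) [nz ?q]" by (simp add: S'_def ctest_nz)
    show "exec x (Dec ?q ;; Dec 0) (S' j) 2 (S' (Suc j))"
      unfolding S'_def using j
      by (intro exec_seq[OF exec_dec[OF _ refl] exec_dec]) (auto simp: fun_eq_iff)
  qed (auto simp: S'_def ctest_nz)
  have e: "S 0 = (h(?p := h ?p + va), w)" "S' va = (h(1 := ?r), w)"
    using z by (auto simp: S_def S'_def fun_eq_iff)
  have "va \<le> poly (tb a B) n"
    using 2 unfolding va_def by (auto intro!: tv_le[of d])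
  then have T: "poly (tc a B) n + (va * (3 + 1) + 1 + (1 + 1 + (va * (2 + 1) + 1))) \<le> poly (fc (Bt a) B) n"
    by simp
  have "exec x (cf d (Bt a)) (h, w) (poly (fc (Bt a) B) n) (h(1 := ?r), w)"
    unfolding cf.simps
    by (rule exec.Le[OF exec.Seq[OF a exec.Seq[OF b[unfolded e(1)] exec.Seq[OF c f[unfolded e(2)]]]] T])
  moreover have f': "fv x (\<lambda>i. h (i + 3)) (Bt a) \<longleftrightarrow> va < length x \<and> x ! va" by (simp add: va_def)
  ultimately show ?case unfolding f' by (elim exec.Le) simp
next
  case (3 d \<phi>)
  have "exec x (cf d \<phi>) (h, w) (poly (fc \<phi> B) n) (h(1 := if fv x (\<lambda>i. h (i + 3)) \<phi> then 1 else 0), w)"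
    using 3 by (intro "3.IH") auto
  moreover have "exec x (Cond [nz 1] (Dec 1) (Inc 1))
      (h(1 := if fv x (\<lambda>i. h (i + 3)) \<phi> then 1 else 0), w) (1 + 1)
      (h(1 := if fv x (\<lambda>i. h (i + 3)) (Ng \<phi>) then 1 else 0), w)"
  proof (cases "fv x (\<lambda>i. h (i + 3)) \<phi>")
    case True
    then show ?thesis by (intro exec.CondT) (auto simp: ctest_nz intro!: exec_dec_Suc)
  next
    case False
    then show ?thesis by (intro exec.CondF) (auto simp: ctest_nz intro!: exec_inc_Suc)
  qed
  ultimately show ?case unfolding cf.simps by (rule exec_seq) simp
next
  case (4 d \<phi> \<psi>)
  have a: "exec x (cf d \<phi>) (h, w) (poly (fc \<phi> B) n) (h(1 := if fv x (\<lambda>i. h (i + 3)) \<phi> then 1 else 0), w)"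
    using 4(3-) by (intro "4.IH") auto
  have b: "exec x (cf d \<psi>) (h, w) (poly (fc \<psi> B) n) (h(1 := if fv x (\<lambda>i. h (i + 3)) \<psi> then 1 else 0), w)"
    using 4(3-) by (intro "4.IH") auto
  have "exec x (Cond [nz 1] (Dec 1 ;; cf d \<psi>) Skip)
      (h(1 := if fv x (\<lambda>i. h (i + 3)) \<phi> then 1 else 0), w) ((1 + poly (fc \<psi> B) n) + 1)
      (h(1 := if fv x (\<lambda>i. h (i + 3)) (An \<phi> \<psi>) then 1 else 0), w)"
  proof (cases "fv x (\<lambda>i. h (i + 3)) \<phi>")
    case True
    have "exec x (Dec 1) (h(1 := 1), w) 1 (h, w)"
      using 4(5) by (intro exec_dec) (auto simp: fun_eq_iff)
    from exec.Seq[OF this b] show ?thesis using True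
      by (intro exec.CondT) (auto simp: ctest_nz)
  next
    case False
    then show ?thesis using exec.Le[OF exec_Skip]
      by (intro exec.CondF) (auto simp: ctest_nz)
  qed
  with a show ?case unfolding cf.simps by (rule exec_seq) simp
next
  case (5 d v b \<phi>)
  define N where "N = tv (\<lambda>i. h (i + 3)) b"
  let ?v = "v + 3"
  define Q where "Q i = fv x ((\<lambda>i. h (i + 3))(v := i)) \<phi>" for i
  define st where "st k q = (h(?v := k, 1 := if q then 1 else 0), w)" for k q
  define L where "L = Loop [nz ?v, (1, 0, False)] (Dec ?v ;; cf (Suc v) \<phi>)"
  have z: "h ?v = 0" "h 0 = 0" "h 1 = 0" using 5 by auto
  have NB: "N \<le> poly (tb b B) n" unfolding N_def using 5 by (intro tv_le[of d]) auto
  have "exec x (ct b ?v (v + 4)) (h, w) (poly (tc b B) n) (h(?v := h ?v + N), w)"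
    unfolding N_def using 5 by (intro exec_ct[of d]) auto
  moreover have "(h(?v := h ?v + N), w) = st N False" using z by (auto simp: st_def fun_eq_iff)
  ultimately have a: "exec x (ct b ?v (v + 4)) (h, w) (poly (tc b B) n) (st N False)" by simp
  define t where "t = poly (fc \<phi> (B + tb b B)) n"
  have body: "exec x (Dec ?v ;; cf (Suc v) \<phi>) (st (Suc i) False) (1 + t) (st i (Q i))" if "Suc i \<le> N" for i
  proof -
    have e: "(\<lambda>j. (h(?v := i)) (j + 3)) = (\<lambda>i. h (i + 3))(v := i)" by (auto simp: fun_eq_iff)
    have "exec x (cf (Suc v) \<phi>) (h(?v := i), w) t
        ((h(?v := i))(1 := if fv x (\<lambda>j. (h(?v := i)) (j + 3)) \<phi> then 1 else 0), w)"
      unfolding t_def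
    proof (rule "5.IH")
      \<comment> \<open>The numbers from \<open>d\<close> up to \<open>v\<close>, skipped by the
        quantifier, belong to registers that still hold 0; variable \<open>v\<close> itself is below
        the value of the bound term.\<close>
      fix j assume "j < Suc v"
      then show "(h(?v := i)) (j + 3) \<le> poly (B + tb b B) n"
        using 5(6)[of j] 5(5)[of "j + 3"] that NB by (cases "j < d") (auto intro: trans_le_add1 trans_le_add2)
    qed (use 5 in auto)
    then have "exec x (cf (Suc v) \<phi>) (h(?v := i), w) t (st i (Q i))"
      unfolding e st_def Q_def .
    moreover have "exec x (Dec ?v) (st (Suc i) False) 1 (h(?v := i), w)"
      unfolding st_def using z by (intro exec_dec) (auto simp: fun_eq_iff)
    ultimately show ?thesis by (intro exec.Seq)
  qed
  have stop: "exec x L (st k q) 1 (st k q)" if "k = 0 \<or> q" for k q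
    unfolding L_def using that z by (intro exec.LoopF) (auto simp: ctest_def scan_def st_def)
  \<comment> \<open>An early exit leaves the witness in the counter, so only
    \<open>i \<le> M\<close> is known about its final value. The clearing loop behind the search
    takes care of it.\<close>
  have loop: "\<exists>i \<le> M. exec x L (st M False) (M * (1 + t + 1) + 1) (st i (\<exists>i < M. Q i))" if "M \<le> N" for M
    using that
  proof (induction M)
    case 0
    then show ?case using stop by simp
  next
    case (Suc M)
    have c: "ctest x (fst (st (Suc M) False)) [nz ?v, (1, 0, False)]"
      using z by (auto simp: ctest_def scan_def st_def)
    show ?case
    proof (cases "Q M")
      case True
      have "exec x (Dec ?v ;; cf (Suc v) \<phi>) (st (Suc M) False) (1 + t) (st M True)"
        using body[of M] Suc.prems True by simp
      from exec.LoopT[OF c this stop[unfolded L_def]]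
      have "exec x L (st (Suc M) False) (1 + t + 1 + 1) (st M True)" unfolding L_def by simp
      moreover have "(\<exists>i < Suc M. Q i) = True" using True by blast
      ultimately show ?thesis by (intro exI[of _ M]) (auto elim!: exec.Le)
    next
      case False
      from Suc obtain i where i: "i \<le> M" "exec x L (st M False) (M * (1 + t + 1) + 1) (st i (\<exists>i < M. Q i))"
        by auto
      have "exec x (Dec ?v ;; cf (Suc v) \<phi>) (st (Suc M) False) (1 + t) (st M False)"
        using body[of M] Suc.prems False by simp
      from exec.LoopT[OF c this i(2)[unfolded L_def]]
      have "exec x L (st (Suc M) False) (Suc M * (1 + t + 1) + 1) (st i (\<exists>i < M. Q i))"
        unfolding L_def by (elim exec.Le) simp
      moreover have "(\<exists>i < Suc M. Q i) \<longleftrightarrow> (\<exists>i < M. Q i)" using False less_Suc_eq by auto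
      ultimately show ?thesis using i(1) by (intro exI[of _ i]) simp
    qed
  qed
  from loop[of N] obtain i where i: "i \<le> N" "exec x L (st N False) (N * (1 + t + 1) + 1) (st i (\<exists>i < N. Q i))"
    by auto
  have q: "fv x (\<lambda>i. h (i + 3)) (Ex v b \<phi>) \<longleftrightarrow> (\<exists>i < N. Q i)" by (simp add: N_def Q_def)
  have "exec x (Loop [nz ?v] (Dec ?v)) (st i (\<exists>i < N. Q i)) (2 * N + 1)
      ((h(?v := i, 1 := if \<exists>i < N. Q i then 1 else 0))(?v := 0), w)"
    unfolding st_def by (rule exec_clear) (use i in auto)
  moreover have "(h(?v := i, 1 := if \<exists>i < N. Q i then 1 else 0))(?v := 0) =
      h(1 := if \<exists>i < N. Q i then 1 else 0)"
    using z by (auto simp: fun_eq_iff)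
  ultimately have e: "exec x (Loop [nz ?v] (Dec ?v)) (st i (\<exists>i < N. Q i)) (2 * N + 1)
      (h(1 := if \<exists>i < N. Q i then 1 else 0), w)" by (simp only:)
  have "N * (t + 4) \<le> poly (tb b B) n * (t + 4)" using NB by (rule mult_le_mono1)
  then have T: "poly (tc b B) n + (N * (1 + t + 1) + 1 + (2 * N + 1)) \<le> poly (fc (Ex v b \<phi>) B) n"
    by (simp add: algebra_simps t_def)
  show ?case unfolding q cf.simps
    by (rule exec.Le[OF exec.Seq[OF a exec.Seq[OF i(2)[unfolded L_def] e]] T])
qed

text \<open>Variable \<open>0\<close> is the length of the input and variable \<open>1\<close> the position in the output.\<close>

abbreviation env2 :: "nat \<Rightarrow> nat \<Rightarrow> nat \<Rightarrow> nat" where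
  "env2 n i \<equiv> (\<lambda>_. 0)(0 := n, 1 := i)"

text \<open>From here on no program has to be written: the reduction and the verifier are each given
  by a formula for one output bit.\<close>

theorem polytime_fo:
  assumes lt: "wft 1 l" and \<phi>: "wff 2 \<phi>"
    and f: "\<And>x. f x = map (\<lambda>i. fv x (env2 (length x) i) \<phi>) [0..<tv (env2 (length x) 0) l]"
  shows "polytime f"
proof (rule polytime_exec)
  \<comment> \<open>Register 3, that is variable 0, counts the length of the input. The second count
    in register 4 brings the input head back and ends at 0, which is the first output position
    (variable 1).\<close>
  define rd where "rd = Loop [(0, 0, False)] (Inc 0 ;; Inc 3 ;; Inc 4) ;; Loop [nz 4] (Dec 4 ;; Dec 0)"
  define body where "body = Dec 2 ;; cf 2 \<phi> ;; Cond [nz 1] (Dec 1 ;; Out True) (Out False) ;; Inc 4"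
  define B where "B = [:0, 1:] + tb l [:0, 1:]"
  define T where "T = [:7:] * [:0, 1:] + [:2:] + tc l [:0, 1:] + tb l [:0, 1:] * (fc \<phi> B + [:6:]) + 1"
  fix x :: "bool list"
  let ?n = "length x"
  define N where "N = tv (env2 ?n 0) l"
  define H :: "nat \<Rightarrow> nat \<Rightarrow> nat \<Rightarrow> nat \<Rightarrow> nat \<Rightarrow> nat"
    where "H a b c e = (\<lambda>_. 0)(0 := a, 2 := b, 3 := c, 4 := e)" for a b c e :: nat
  have r1: "exec x (Loop [(0, 0, False)] (Inc 0 ;; Inc 3 ;; Inc 4)) (H 0 0 0 0, []) (?n * (3 + 1) + 1) (H ?n 0 ?n ?n, [])"
  proof (rule exec_loop[where S = "\<lambda>j. (H j 0 j j, [])"])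
    fix j assume "j < ?n"
    then show "ctest x (fst (H j 0 j j, [])) [(0, 0, False)]"
      by (auto simp: ctest_def scan_def H_def word_tape_def)
    show "exec x (Inc 0 ;; Inc 3 ;; Inc 4) (H j 0 j j, []) 3 (H (Suc j) 0 (Suc j) (Suc j), [])"
      unfolding H_def
      by (intro exec_seq[OF exec_inc[OF refl] exec_seq[OF exec_inc[OF refl] exec_inc order_refl]])
        (auto simp: fun_eq_iff)
  qed (auto simp: ctest_def scan_def H_def word_tape_def)
  have "exec x (Loop [nz 4] (Dec 4 ;; Dec 0)) (H (?n - 0) 0 ?n (?n - 0), []) (?n * (2 + 1) + 1) (H (?n - ?n) 0 ?n (?n - ?n), [])"
  proof (rule exec_loop[where S = "\<lambda>j. (H (?n - j) 0 ?n (?n - j), [])"])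
    fix j assume j: "j < ?n"
    then show "ctest x (fst (H (?n - j) 0 ?n (?n - j), [])) [nz 4]"
      by (auto simp: ctest_def scan_def H_def)
    show "exec x (Dec 4 ;; Dec 0) (H (?n - j) 0 ?n (?n - j), []) 2 (H (?n - Suc j) 0 ?n (?n - Suc j), [])"
      unfolding H_def using j
      by (intro exec_seq[OF exec_dec[OF _ refl] exec_dec]) (auto simp: fun_eq_iff)
  qed (auto simp: ctest_def scan_def H_def)
  then have rd: "exec x rd (H 0 0 0 0, []) (?n * (3 + 1) + 1 + (?n * (2 + 1) + 1)) (H 0 0 ?n 0, [])"
    unfolding rd_def using r1 by (intro exec.Seq) auto
  have "exec x (ct l 2 5) (H 0 0 ?n 0, []) (poly (tc l [:0, 1:]) ?n)
      ((H 0 0 ?n 0)(2 := H 0 0 ?n 0 2 + tv (\<lambda>i. H 0 0 ?n 0 (i + 3)) l), [])"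
    using lt by (intro exec_ct[of 1]) (auto simp: H_def)
  moreover have "tv (\<lambda>i. H 0 0 ?n 0 (i + 3)) l = N"
    unfolding N_def by (rule tv_cong[OF lt]) (auto simp: H_def)
  ultimately have len: "exec x (ct l 2 5) (H 0 0 ?n 0, []) (poly (tc l [:0, 1:]) ?n) (H 0 N ?n 0, [])"
    by (simp add: H_def fun_upd_twist)
  have NB: "N \<le> poly (tb l [:0, 1:]) ?n" unfolding N_def using lt by (intro tv_le[of 1]) auto
  let ?b = "\<lambda>i. fv x (env2 ?n i) \<phi>"
  have main: "exec x (Loop [nz 2] body) (H 0 (N - 0) ?n 0, map ?b [0..<0]) (N * ((1 + (poly (fc \<phi> B) ?n + (3 + 1))) + 1) + 1)
      (H 0 (N - N) ?n N, map ?b [0..<N])"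
  proof (rule exec_loop[where S = "\<lambda>j. (H 0 (N - j) ?n j, map ?b [0..<j])"])
    fix j assume j: "j < N"
    then show "ctest x (fst (H 0 (N - j) ?n j, map ?b [0..<j])) [nz 2]"
      by (auto simp: ctest_def scan_def H_def)
    define h where "h = H 0 (N - Suc j) ?n j"
    let ?w = "map ?b [0..<j]"
    have "(\<lambda>i. h (i + 3)) = env2 ?n j" by (auto simp: h_def H_def fun_eq_iff)
    moreover have "exec x (cf 2 \<phi>) (h, ?w) (poly (fc \<phi> B) ?n) (h(1 := if fv x (\<lambda>i. h (i + 3)) \<phi> then 1 else 0), ?w)"
    proof (rule exec_cf[OF \<phi>])
      fix i :: nat assume "i < 2"
      then show "h (i + 3) \<le> poly B ?n" using NB j by (auto simp: h_def H_def B_def less_2_cases_iff)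
    qed (auto simp: h_def H_def)
    ultimately have b: "exec x (cf 2 \<phi>) (h, ?w) (poly (fc \<phi> B) ?n) (h(1 := if ?b j then 1 else 0), ?w)" by simp
    have a: "exec x (Dec 2) (H 0 (N - j) ?n j, ?w) 1 (h, ?w)"
      using j by (intro exec_dec) (auto simp: h_def H_def fun_eq_iff)
    have h1: "h 1 = 0" by (simp add: h_def H_def)
    have c: "exec x (Cond [nz 1] (Dec 1 ;; Out True) (Out False)) (h(1 := if ?b j then 1 else 0), ?w) 3 (h, ?w @ [?b j])"
    proof (cases "?b j")
      case True
      have "exec x (Dec 1) (h(1 := 1), ?w) 1 (h, ?w)"
        using h1 by (intro exec_dec) (auto simp: fun_eq_iff)
      from exec.CondT[OF _ exec.Seq[OF this exec.Out]] True show ?thesis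
        by (auto simp: ctest_nz numeral_3_eq_3)
    next
      case False
      have "(h(1 := 0), ?w) = (h, ?w)" using h1 by (simp add: fun_upd_idem)
      moreover have "exec x (Cond [nz 1] (Dec 1 ;; Out True) (Out False)) (h, ?w) (1 + 1) (h, ?w @ [False])"
        using h1 by (intro exec.CondF exec.Out) (auto simp: ctest_nz)
      ultimately show ?thesis using False by (auto elim!: exec.Le)
    qed
    have e: "exec x (Inc 4) (h, ?w @ [?b j]) 1 (H 0 (N - Suc j) ?n (Suc j), ?w @ [?b j])"
      by (rule exec_inc) (auto simp: h_def H_def fun_eq_iff)
    from exec.Seq[OF a exec.Seq[OF b exec.Seq[OF c e]]]
    show "exec x body (H 0 (N - j) ?n j, ?w) (1 + (poly (fc \<phi> B) ?n + (3 + 1)))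
        (H 0 (N - Suc j) ?n (Suc j), map ?b [0..<Suc j])"
      by (simp add: body_def)
  qed (auto simp: ctest_def scan_def H_def)
  have "exec x (rd ;; ct l 2 5 ;; Loop [nz 2] body) (H 0 0 0 0, []) (poly T ?n) (H 0 (N - N) ?n N, map ?b [0..<N])"
  proof (rule exec.Le)
    show "exec x (rd ;; ct l 2 5 ;; Loop [nz 2] body) (H 0 0 0 0, [])
        ((?n * (3 + 1) + 1 + (?n * (2 + 1) + 1)) + (poly (tc l [:0, 1:]) ?n + (N * ((1 + (poly (fc \<phi> B) ?n + (3 + 1))) + 1) + 1)))
        (H 0 (N - N) ?n N, map ?b [0..<N])"
      using main by (intro exec.Seq[OF rd] exec.Seq[OF len]) simp
    have "N * (poly (fc \<phi> B) ?n + 6) \<le> poly (tb l [:0, 1:]) ?n * (poly (fc \<phi> B) ?n + 6)"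
      using NB by (rule mult_le_mono1)
    then show "(?n * (3 + 1) + 1 + (?n * (2 + 1) + 1)) + (poly (tc l [:0, 1:]) ?n + (N * ((1 + (poly (fc \<phi> B) ?n + (3 + 1))) + 1) + 1)) \<le> poly T ?n"
      by (simp add: T_def algebra_simps)
  qed
  moreover have "H 0 0 0 0 = (\<lambda>_. 0)" by (auto simp: H_def fun_eq_iff)
  ultimately show "\<exists>h. exec x (rd ;; ct l 2 5 ;; Loop [nz 2] body) (\<lambda>_. 0, []) (poly T ?n) (h, f x)"
    unfolding f N_def[symmetric] by auto
qed

section \<open>Trapezoid and tolerance representations\<close>

text \<open>
  A trapezoid between two horizontal lines is given by its left ends \<open>p, q\<close> and its right ends
  \<open>P, Q\<close> on the upper and the lower line.
\<close>

definition left_of :: "('a \<Rightarrow> real) \<Rightarrow> ('a \<Rightarrow> real) \<Rightarrow> ('a \<Rightarrow> real) \<Rightarrow> ('a \<Rightarrow> real) \<Rightarrow> 'a \<Rightarrow> 'a \<Rightarrow> bool" where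
  "left_of p q P Q u v \<longleftrightarrow> P u < p v \<and> Q u < q v"

abbreviation pt :: "real \<Rightarrow> real \<Rightarrow> real ^ 2" where "pt x y \<equiv> vector [x, y]"

abbreviation trap :: "real \<Rightarrow> real \<Rightarrow> real \<Rightarrow> real \<Rightarrow> (real ^ 2) set" where
  "trap a b c d \<equiv> convex hull {pt a 1, pt b 1, pt c 0, pt d 0}"

text \<open>Two convex combinations: the ends of the horizontal section at height \<open>y\<close>
  lie on the two legs, and the point lies between these ends.\<close>

lemma pt_mem_trap:
  assumes "0 \<le> y" "y \<le> 1" "y * a + (1 - y) * c \<le> x" "x \<le> y * b + (1 - y) * d"
  shows "pt x y \<in> trap a b c d"
proof -
  let ?H = "trap a b c d" and ?l = "y * a + (1 - y) * c" and ?r = "y * b + (1 - y) * d"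
  have cv: "convex ?H" by simp
  have "pt a 1 \<in> ?H" "pt b 1 \<in> ?H" "pt c 0 \<in> ?H" "pt d 0 \<in> ?H"
    by (auto intro: hull_inc)
  then have "y *\<^sub>R pt a 1 + (1 - y) *\<^sub>R pt c 0 \<in> ?H" "y *\<^sub>R pt b 1 + (1 - y) *\<^sub>R pt d 0 \<in> ?H"
    using assms by (auto intro!: convexD[OF cv])
  moreover have "y *\<^sub>R pt a 1 + (1 - y) *\<^sub>R pt c 0 = pt ?l y" "y *\<^sub>R pt b 1 + (1 - y) *\<^sub>R pt d 0 = pt ?r y"
    by (auto simp: Finite_Cartesian_Product.vec_eq_iff forall_2)
  ultimately have lr: "pt ?l y \<in> ?H" "pt ?r y \<in> ?H" by simp_all
  show ?thesis
  proof (cases "?l = ?r")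
    case True
    then show ?thesis using lr assms by (metis order_antisym)
  next
    case False
    define s where "s = (x - ?l) / (?r - ?l)"
    have pos: "?r - ?l > 0" using assms False by linarith
    then have s: "0 \<le> s" "s \<le> 1" using assms by (auto simp: s_def)
    have "x = (1 - s) * ?l + s * ?r"
    proof -
      have "s * (?r - ?l) = x - ?l" using pos by (simp add: s_def)
      then show ?thesis by (simp add: algebra_simps)
    qed
    then have "(1 - s) *\<^sub>R pt ?l y + s *\<^sub>R pt ?r y = pt x y"
      by (auto simp: Finite_Cartesian_Product.vec_eq_iff forall_2 algebra_simps)
    moreover have "(1 - s) *\<^sub>R pt ?l y + s *\<^sub>R pt ?r y \<in> ?H"
      using s lr by (intro convexD[OF cv]) auto
    ultimately show ?thesis by simp
  qed
qed

text \<open>The line through the midpoints of the upper and the lower gap separates the two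
  sets.\<close>

lemma trap_disjoint:
  assumes "a \<le> b" "c \<le> d" "a' \<le> b'" "c' \<le> d'" "b < a'" "d < c'"
  shows "trap a b c d \<inter> trap a' b' c' d' = {}"
proof -
  define m1 where "m1 = (b + a') / 2"
  define m2 where "m2 = (d + c') / 2"
  define n where "n = pt 1 (m2 - m1)"
  have i: "n \<bullet> pt x y = x + (m2 - m1) * y" for x y
    by (simp add: n_def inner_vec_def sum_2)
  have "trap a b c d \<subseteq> {z. n \<bullet> z < m2}"
    using assms by (intro hull_minimal convex_halfspace_lt) (auto simp: i m1_def m2_def field_simps)
  moreover have "trap a' b' c' d' \<subseteq> {z. n \<bullet> z > m2}"
    using assms by (intro hull_minimal convex_halfspace_gt) (auto simp: i m1_def m2_def field_simps)
  ultimately show ?thesis by force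
qed

text \<open>If neither the upper nor the lower sides meet, the two trapezoids have opposite orders
  on the two lines. Their left legs then cross, at the height \<open>y\<close> of
  \<open>cross\<close>.\<close>

lemma trap_meet:
  assumes "a \<le> b" "c \<le> d" "a' \<le> b'" "c' \<le> d'" "\<not> (b < a' \<and> d < c')" "\<not> (b' < a \<and> d' < c)"
  shows "trap a b c d \<inter> trap a' b' c' d' \<noteq> {}"
proof -
  have cross: "trap a b c d \<inter> trap a' b' c' d' \<noteq> {}"
    if "a \<le> b" "c \<le> d" "a' \<le> b'" "c' \<le> d'" "b < a'" "d' < c" for a b c d a' b' c' d' :: real
  proof -
    define w where "w = (c - c') + (a' - a)"
    define y where "y = (c - c') / w"
    have pos: "c - c' > 0" "a' - a > 0" "w > 0" using that by (auto simp: w_def)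
    then have y: "0 \<le> y" "y \<le> 1" by (auto simp: y_def w_def)
    have "y * w = c - c'" using pos by (simp add: y_def)
    then have e: "y * a + (1 - y) * c = y * a' + (1 - y) * c'"
      by (simp add: w_def algebra_simps)
    have "y * a \<le> y * b" "(1 - y) * c \<le> (1 - y) * d" "y * a' \<le> y * b'" "(1 - y) * c' \<le> (1 - y) * d'"
      using y that by (auto intro!: mult_left_mono)
    then have "pt (y * a + (1 - y) * c) y \<in> trap a b c d" "pt (y * a + (1 - y) * c) y \<in> trap a' b' c' d'"
      using e y by (intro pt_mem_trap; linarith)+
    then show ?thesis by blast
  qed
  consider "a \<le> b'" "a' \<le> b" | "c \<le> d'" "c' \<le> d" | "b < a'" "d' < c" | "b' < a" "d < c'"
    using assms not_le by blast
  then show ?thesis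
  proof cases
    case 1
    then have "pt (max a a') 1 \<in> trap a b c d" "pt (max a a') 1 \<in> trap a' b' c' d'"
      using assms by (auto intro!: pt_mem_trap)
    then show ?thesis by blast
  next
    case 2
    then have "pt (max c c') 0 \<in> trap a b c d" "pt (max c c') 0 \<in> trap a' b' c' d'"
      using assms by (auto intro!: pt_mem_trap)
    then show ?thesis by blast
  next
    case 3
    then show ?thesis using cross assms by blast
  next
    case 4
    then show ?thesis using cross[of a' b' c' d' a b c d] assms by blast
  qed
qed

lemma is_line_horizontal: "is_line {z :: real ^ 2. z $ 2 = y}"
proof -
  have e: "{z :: real ^ 2. z $ 2 = y} = {z. axis 2 1 \<bullet> z = y}"
    by (simp add: inner_axis' )
  have "axis 2 1 \<noteq> (0 :: real ^ 2)" by (simp add: axis_eq_0_iff)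
  then show ?thesis unfolding is_line_def e
    by (simp add: affine_hyperplane aff_dim_hyperplane)
qed

lemma trapezoid_graphI:
  assumes G: "pair_graph G"
    and w: "\<And>v. v \<in> pverts G \<Longrightarrow> p v < P v \<and> q v < Q v"
    and adj: "\<And>u v. u \<in> pverts G \<Longrightarrow> v \<in> pverts G \<Longrightarrow> u \<noteq> v \<Longrightarrow>
      (u, v) \<in> parcs G \<longleftrightarrow> \<not> left_of p q P Q u v \<and> \<not> left_of p q P Q v u"
  shows "trapezoid_graph G"
  unfolding trapezoid_graph_def
proof (intro conjI G exI)
  let ?L = "\<lambda>y. {z :: real ^ 2. z $ 2 = y}"
  let ?T = "\<lambda>v. trap (p v) (P v) (q v) (Q v)"
  show "is_line (?L 1)" "is_line (?L 0)" by (rule is_line_horizontal)+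
  have "?L 0 = (+) (pt 0 (-1)) ` ?L 1"
  proof (intro equalityI subsetI)
    fix z :: "real ^ 2" assume "z \<in> ?L 0"
    then show "z \<in> (+) (pt 0 (-1)) ` ?L 1"
      by (intro image_eqI[of _ _ "z + pt 0 1"]) (auto simp: Finite_Cartesian_Product.vec_eq_iff forall_2)
  qed auto
  then show "affine_parallel (?L 1) (?L 0)" unfolding affine_parallel_def by blast
  have "pt 0 1 \<in> ?L 1" "pt 0 1 \<notin> ?L 0" by auto
  then show "?L 1 \<noteq> ?L 0" by blast
  show "\<forall>v \<in> pverts G. trapezoid_between (?L 1) (?L 0) (?T v)"
  proof
    fix v assume "v \<in> pverts G"
    then have "pt (p v) 1 \<noteq> pt (P v) 1" "pt (q v) 0 \<noteq> pt (Q v) 0"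
      using w by (force simp: Finite_Cartesian_Product.vec_eq_iff forall_2)+
    then show "trapezoid_between (?L 1) (?L 0) (?T v)" unfolding trapezoid_between_def
      by (intro exI[of _ "pt (p v) 1"] exI[of _ "pt (P v) 1"] exI[of _ "pt (q v) 0"] exI[of _ "pt (Q v) 0"]) auto
  qed
  show "\<forall>u \<in> pverts G. \<forall>v \<in> pverts G. u \<noteq> v \<longrightarrow> ((u, v) \<in> parcs G) = (?T u \<inter> ?T v \<noteq> {})"
  proof (intro ballI impI)
    fix u v assume uv: "u \<in> pverts G" "v \<in> pverts G" "u \<noteq> v"
    have le: "p u \<le> P u" "q u \<le> Q u" "p v \<le> P v" "q v \<le> Q v" using w uv by force+
    have "?T u \<inter> ?T v \<noteq> {} \<longleftrightarrow> \<not> left_of p q P Q u v \<and> \<not> left_of p q P Q v u"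
      using trap_meet[OF le] trap_disjoint[OF le] trap_disjoint[OF le(3,4,1,2)]
      unfolding left_of_def by blast
    then show "((u, v) \<in> parcs G) = (?T u \<inter> ?T v \<noteq> {})" using adj[OF uv] by blast
  qed
qed

lemma measure_Int_intervals:
  "measure lborel ({a..b} \<inter> {c..d :: real}) = max 0 (min b d - max a c)"
  by (simp add: max_def)

text \<open>The correspondence between bounded tolerance graphs and parallelogram graphs. The
  interval [l, r] with tolerance t becomes the parallelogram with upper side [l, r - t] and lower
  side [l + t, r], of slope t; lying to the left means that the overlap is smaller than both
  tolerances.\<close>

lemma bounded_tolerance_iff:
  fixes l r t :: "'a \<Rightarrow> real"
  assumes "t u > 0" "t v > 0" "t u \<le> r u - l u" "t v \<le> r v - l v"
  defines "S \<equiv> left_of l (\<lambda>v. l v + t v) (\<lambda>v. r v - t v) r"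
  shows "measure lborel ({l u..r u} \<inter> {l v..r v}) \<ge> min (t u) (t v) \<longleftrightarrow> \<not> S u v \<and> \<not> S v u"
  unfolding measure_Int_intervals S_def left_of_def using assms(1-4)
  by (auto simp: min_def max_def split: if_splits)

lemma tolerance_graphI:
  assumes G: "pair_graph G"
    and w: "\<And>v. v \<in> pverts G \<Longrightarrow> p v \<le> P v \<and> P v - p v = Q v - q v \<and> p v < q v"
    and adj: "\<And>u v. u \<in> pverts G \<Longrightarrow> v \<in> pverts G \<Longrightarrow> u \<noteq> v \<Longrightarrow>
      (u, v) \<in> parcs G \<longleftrightarrow> \<not> left_of p q P Q u v \<and> \<not> left_of p q P Q v u"
  shows "tolerance_graph G"
  unfolding tolerance_graph_def
proof (rule conjI[OF G], rule exI[of _ p], rule exI[of _ Q], rule exI[of _ "\<lambda>v. q v - p v"], intro conjI ballI impI)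
  fix v assume v: "v \<in> pverts G"
  show "p v \<le> Q v" "q v - p v > 0" using w[OF v] by auto
next
  fix u v assume uv: "u \<in> pverts G" "v \<in> pverts G" "u \<noteq> v"
  have "measure lborel ({p u..Q u} \<inter> {p v..Q v}) \<ge> min (q u - p u) (q v - p v) \<longleftrightarrow>
      \<not> left_of p (\<lambda>v. p v + (q v - p v)) (\<lambda>v. Q v - (q v - p v)) Q u v \<and>
      \<not> left_of p (\<lambda>v. p v + (q v - p v)) (\<lambda>v. Q v - (q v - p v)) Q v u"
    using w[OF uv(1)] w[OF uv(2)] by (intro bounded_tolerance_iff) auto
  also have "\<dots> \<longleftrightarrow> \<not> left_of p q P Q u v \<and> \<not> left_of p q P Q v u"
    using w[OF uv(1)] w[OF uv(2)] by (auto simp: left_of_def)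
  finally show "((u, v) \<in> parcs G) = (measure lborel ({p u..Q u} \<inter> {p v..Q v}) \<ge> min (q u - p u) (q v - p v))"
    using adj[OF uv] by blast
qed

section \<open>A poset of slots and long elements\<close>

text \<open>
  Left slot \<open>i\<close> consists of two crossing small elements \<open>SL i False\<close>, \<open>SL i True\<close>, and likewise for
  right slots. A long element \<open>LG l a r b\<close> begins in left slot \<open>l\<close> behind \<open>SL l a\<close> and ends in right
  slot \<open>r\<close> before \<open>SR r b\<close>.
\<close>

datatype vtx = SL nat bool | SR nat bool | LG nat bool nat bool

fun vless :: "vtx \<Rightarrow> vtx \<Rightarrow> bool" where
  "vless (SL i _) (SL j _) \<longleftrightarrow> i < j"
| "vless (SL i s) (LG l a r b) \<longleftrightarrow> i < l \<or> (i = l \<and> s = a)"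
| "vless (SL _ _) (SR _ _) \<longleftrightarrow> True"
| "vless (LG l a r b) (SR j t) \<longleftrightarrow> r < j \<or> (r = j \<and> t = b)"
| "vless (SR i _) (SR j _) \<longleftrightarrow> i < j"
| "vless _ _ \<longleftrightarrow> False"

text \<open>One layout serves both kinds of representation: the small elements have width
  \<open>w\<close>, which is 1 for trapezoids and 0 for parallelograms. Slots are 10 apart and all
  left slots precede all right slots, so deviations of at most 3 matter only within a slot. There
  the two small elements cross: the one of type \<open>zL s\<close> is further left on the upper and
  further right on the lower line. The leg of a long element of type \<open>zL s\<close> is steeper
  than the threshold \<open>\<theta>L s\<close>, that of the other type is flatter;
  \<open>zR\<close> and \<open>\<theta>R\<close> do the same on the right.\<close>

lemma left_of_slots:
  fixes p q P Q :: "'a \<Rightarrow> real" and lab :: "'a \<Rightarrow> vtx" and n :: nat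
  defines "XL \<equiv> (\<lambda>s. 10 * real s)" and "XR \<equiv> (\<lambda>s. 10 * (real n + 1 + real s))"
  assumes th: "\<And>s. \<bar>\<theta>L s\<bar> < 1" "\<And>s. \<bar>\<theta>R s\<bar> < 1" and w: "0 \<le> w" "w \<le> 1"
    and SL: "\<And>v s \<sigma>. v \<in> A \<Longrightarrow> lab v = SL s \<sigma> \<Longrightarrow> s \<le> n \<and>
      P v = (if \<sigma> = zL s then XL s - 1 else XL s) \<and> Q v = XL s + \<theta>L s - (if \<sigma> = zL s then 0 else 1) \<and>
      p v = P v - w \<and> q v = Q v - w"
    and SR: "\<And>v s \<tau>. v \<in> A \<Longrightarrow> lab v = SR s \<tau> \<Longrightarrow>
      p v = (if \<tau> = zR s then XR s else XR s + 1) \<and> q v = XR s + \<theta>R s + (if \<tau> = zR s then 1 else 0) \<and>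
      P v = p v + w \<and> Q v = q v + w"
    and LG: "\<And>v l a r b. v \<in> A \<Longrightarrow> lab v = LG l a r b \<Longrightarrow> l \<le> n \<and>
      \<bar>p v - XL l\<bar> < 1 \<and> \<bar>q v - (XL l + \<theta>L l)\<bar> < 1 \<and> \<bar>P v - XR r\<bar> < 1 \<and> \<bar>Q v - (XR r + \<theta>R r)\<bar> < 1 \<and>
      (if a = zL l then p v < XL l \<and> q v > XL l + \<theta>L l else p v > XL l \<and> q v < XL l + \<theta>L l) \<and>
      (if b = zR r then P v < XR r \<and> Q v > XR r + \<theta>R r else P v > XR r \<and> Q v < XR r + \<theta>R r)"
    and uv: "u \<in> A" "v \<in> A"
  shows "left_of p q P Q u v \<longleftrightarrow> vless (lab u) (lab v)"
proof -
  have bL: "P v \<le> XL s \<and> P v \<ge> XL s - 1 \<and> Q v < XL s + 1 \<and> Q v > XL s - 2 \<and> p v \<le> XL s \<and> p v \<ge> XL s - 2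
      \<and> q v < XL s + 1 \<and> q v > XL s - 3 \<and> real s \<le> real n" if "v \<in> A" "lab v = SL s \<sigma>" for v s \<sigma>
    using SL[OF that] th(1)[of s] w by (cases "\<sigma> = zL s") auto
  have bR: "p v \<ge> XR s \<and> p v \<le> XR s + 1 \<and> q v > XR s - 1 \<and> q v < XR s + 2 \<and> P v \<ge> XR s \<and> P v \<le> XR s + 2
      \<and> Q v > XR s - 1 \<and> Q v < XR s + 3" if "v \<in> A" "lab v = SR s \<tau>" for v s \<tau>
    using SR[OF that] th(2)[of s] w by (cases "\<tau> = zR s") auto
  have bG: "p v < XL l + 1 \<and> p v > XL l - 1 \<and> q v < XL l + 2 \<and> q v > XL l - 2 \<and> P v < XR r + 1 \<and> P v > XR r - 1
      \<and> Q v < XR r + 2 \<and> Q v > XR r - 2 \<and> real l \<le> real n" if "v \<in> A" "lab v = LG l a r b" for v l a r b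
    using LG[OF that] th(1)[of l] th(2)[of r] by (auto simp: abs_less_iff)
  have step: "real i + 1 \<le> real j" if "i < j" for i j using that by linarith
  show ?thesis
  proof (cases "lab u")
    case u: (SL s \<sigma>)
    note U = bL[OF uv(1) u]
    show ?thesis
    proof (cases "lab v")
      case v: (SL s' \<sigma>')
      note V = bL[OF uv(2) v]
      consider "s < s'" | "s' < s" | "s = s'" by linarith
      then show ?thesis
      proof cases
        case 1
        then show ?thesis using U V step[OF 1] unfolding u v left_of_def XL_def by simp
      next
        case 2
        then show ?thesis using U V step[OF 2] unfolding u v left_of_def XL_def by simp
      next
        case 3
        then show ?thesis using SL[OF uv(1) u] SL[OF uv(2) v] w unfolding u v left_of_def
          by (cases "\<sigma> = zL s"; cases "\<sigma>' = zL s") auto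
      qed
    next
      case v: (SR s' \<tau>')
      show ?thesis using U bR[OF uv(2) v] unfolding u v left_of_def XL_def XR_def by simp
    next
      case v: (LG l a r b)
      note V = bG[OF uv(2) v]
      consider "s < l" | "l < s" | "s = l" by linarith
      then show ?thesis
      proof cases
        case 1
        then show ?thesis using U V step[OF 1] unfolding u v left_of_def XL_def by simp
      next
        case 2
        then show ?thesis using U V step[OF 2] unfolding u v left_of_def XL_def by simp
      next
        case 3
        then show ?thesis using SL[OF uv(1) u] LG[OF uv(2) v] w unfolding u v left_of_def
          by (cases "\<sigma> = zL s"; cases "a = zL s") (auto simp: abs_less_iff)
      qed
    qed
  next
    case u: (SR s \<tau>)
    note U = bR[OF uv(1) u]
    show ?thesis
    proof (cases "lab v")
      case v: (SL s' \<sigma>')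
      show ?thesis using U bL[OF uv(2) v] unfolding u v left_of_def XL_def XR_def by simp
    next
      case v: (SR s' \<tau>')
      note V = bR[OF uv(2) v]
      consider "s < s'" | "s' < s" | "s = s'" by linarith
      then show ?thesis
      proof cases
        case 1
        then show ?thesis using U V step[OF 1] unfolding u v left_of_def XR_def by simp
      next
        case 2
        then show ?thesis using U V step[OF 2] unfolding u v left_of_def XR_def by simp
      next
        case 3
        then show ?thesis using SR[OF uv(1) u] SR[OF uv(2) v] w unfolding u v left_of_def
          by (cases "\<tau> = zR s"; cases "\<tau>' = zR s") auto
      qed
    next
      case v: (LG l a r b)
      show ?thesis using U bG[OF uv(2) v] unfolding u v left_of_def XL_def XR_def by simp
    qed
  next
    case u: (LG l a r b)
    note U = bG[OF uv(1) u]
    show ?thesis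
    proof (cases "lab v")
      case v: (SL s' \<sigma>')
      show ?thesis using U bL[OF uv(2) v] unfolding u v left_of_def XL_def XR_def by simp
    next
      case v: (SR s' \<tau>')
      note V = bR[OF uv(2) v]
      consider "r < s'" | "s' < r" | "r = s'" by linarith
      then show ?thesis
      proof cases
        case 1
        then show ?thesis using U V step[OF 1] unfolding u v left_of_def XR_def by simp
      next
        case 2
        then show ?thesis using U V step[OF 2] unfolding u v left_of_def XR_def by simp
      next
        case 3
        then show ?thesis using LG[OF uv(1) u] SR[OF uv(2) v] w unfolding u v left_of_def
          by (cases "b = zR r"; cases "\<tau>' = zR r") (auto simp: abs_less_iff)
      qed
    next
      case v: (LG l' a' r' b')
      show ?thesis using U bG[OF uv(2) v] unfolding u v left_of_def XL_def XR_def by simp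
    qed
  qed
qed

section \<open>The join of two copies and its representations\<close>

definition incomp :: "(nat \<Rightarrow> vtx) \<Rightarrow> nat \<Rightarrow> nat \<Rightarrow> bool" where
  "incomp lab i j \<longleftrightarrow> \<not> vless (lab i) (lab j) \<and> \<not> vless (lab j) (lab i)"

definition join_graph :: "nat \<Rightarrow> (nat \<Rightarrow> vtx) \<Rightarrow> nat pair_pre_digraph" where
  "join_graph K lab = \<lparr>pverts = {..<2 * K},
    parcs = {(a, b). a < 2 * K \<and> b < 2 * K \<and> a \<noteq> b \<and> (even a \<noteq> even b \<or> incomp lab (a div 2) (b div 2))}\<rparr>"

lemma pair_graph_join: "pair_graph (join_graph K lab)"
proof
  have "parcs (join_graph K lab) \<subseteq> {..<2 * K} \<times> {..<2 * K}" by (auto simp: join_graph_def)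
  then show "finite (parcs (join_graph K lab))" using finite_subset by blast
  show "symmetric (with_proj (join_graph K lab))"
    unfolding symmetric_def sym_def by (auto simp: join_graph_def incomp_def arcs_ends_def arc_to_ends_def)
qed (auto simp: join_graph_def)

text \<open>The copy of the even vertices is moved to the right of the other one on the upper line
  and to its left on the lower line, so that each element of one copy crosses each element of the
  other. With coordinates of absolute value at most \<open>Z\<close>, shifts by \<open>4 * Z\<close>
  suffice. The base \<open>10 * Z\<close> on the lower line makes all slopes positive, as tolerances
  have to be.\<close>

definition upper :: "real \<Rightarrow> (nat \<Rightarrow> real) \<Rightarrow> nat \<Rightarrow> real" where
  "upper Z f a = f (a div 2) + (if even a then 4 * Z else 0)"

definition lower :: "real \<Rightarrow> (nat \<Rightarrow> real) \<Rightarrow> nat \<Rightarrow> real" where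
  "lower Z f a = f (a div 2) + (if even a then 10 * Z else 14 * Z)"

lemma join_left_of:
  fixes p q P Q :: "nat \<Rightarrow> real"
  assumes Z: "\<And>i. i < K \<Longrightarrow> \<bar>p i\<bar> \<le> Z \<and> \<bar>q i\<bar> \<le> Z \<and> \<bar>P i\<bar> \<le> Z \<and> \<bar>Q i\<bar> \<le> Z" "Z \<ge> 1"
    and l: "\<And>i j. i < K \<Longrightarrow> j < K \<Longrightarrow> left_of p q P Q i j \<longleftrightarrow> vless (lab i) (lab j)"
    and ab: "a < 2 * K" "b < 2 * K"
  shows "left_of (upper Z p) (lower Z q) (upper Z P) (lower Z Q) a b \<longleftrightarrow>
    even a = even b \<and> vless (lab (a div 2)) (lab (b div 2))"
proof -
  have i: "a div 2 < K" "b div 2 < K" using ab by auto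
  show ?thesis unfolding left_of_def upper_def lower_def
    using Z(1)[OF i(1)] Z(1)[OF i(2)] Z(2) l[OF i] unfolding left_of_def
    by (cases "even a"; cases "even b") (auto simp: abs_le_iff)
qed

lemma join_adj:
  fixes p q P Q :: "nat \<Rightarrow> real"
  assumes Z: "\<And>i. i < K \<Longrightarrow> \<bar>p i\<bar> \<le> Z \<and> \<bar>q i\<bar> \<le> Z \<and> \<bar>P i\<bar> \<le> Z \<and> \<bar>Q i\<bar> \<le> Z" "Z \<ge> 1"
    and l: "\<And>i j. i < K \<Longrightarrow> j < K \<Longrightarrow> left_of p q P Q i j \<longleftrightarrow> vless (lab i) (lab j)"
    and ab: "a \<in> pverts (join_graph K lab)" "b \<in> pverts (join_graph K lab)" "a \<noteq> b"
  shows "(a, b) \<in> parcs (join_graph K lab) \<longleftrightarrow>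
    \<not> left_of (upper Z p) (lower Z q) (upper Z P) (lower Z Q) a b \<and>
    \<not> left_of (upper Z p) (lower Z q) (upper Z P) (lower Z Q) b a"
proof -
  have "a < 2 * K" "b < 2 * K" using ab by (auto simp: join_graph_def)
  from join_left_of[OF Z l this] join_left_of[OF Z l this(2,1)]
  show ?thesis using ab by (auto simp: join_graph_def incomp_def)
qed

lemma bounded_coords:
  fixes p q P Q :: "nat \<Rightarrow> real"
  shows "\<exists>Z \<ge> 1. \<forall>i < K. \<bar>p i\<bar> \<le> Z \<and> \<bar>q i\<bar> \<le> Z \<and> \<bar>P i\<bar> \<le> Z \<and> \<bar>Q i\<bar> \<le> Z"
proof (intro exI conjI allI impI)
  let ?Z = "1 + (\<Sum>i<K. \<bar>p i\<bar> + \<bar>q i\<bar> + \<bar>P i\<bar> + \<bar>Q i\<bar>)"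
  show "?Z \<ge> 1" by (auto intro!: sum_nonneg)
  fix i assume "i < K"
  then have "\<bar>p i\<bar> + \<bar>q i\<bar> + \<bar>P i\<bar> + \<bar>Q i\<bar> \<le> (\<Sum>i<K. \<bar>p i\<bar> + \<bar>q i\<bar> + \<bar>P i\<bar> + \<bar>Q i\<bar>)"
    by (intro member_le_sum) auto
  then show "\<bar>p i\<bar> \<le> ?Z" "\<bar>q i\<bar> \<le> ?Z" "\<bar>P i\<bar> \<le> ?Z" "\<bar>Q i\<bar> \<le> ?Z" by auto
qed

fun left_slot_le :: "nat \<Rightarrow> vtx \<Rightarrow> bool" where
  "left_slot_le n (SL s _) \<longleftrightarrow> s \<le> n"
| "left_slot_le n (LG l _ _ _) \<longleftrightarrow> l \<le> n"
| "left_slot_le n (SR _ _) \<longleftrightarrow> True"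

text \<open>The two legs of a trapezoid are independent. Each end of a long element is placed in its
  slot separately, with all thresholds 0 and an offset of 1/2 to the proper side, so slopes in
  different slots never have to be compatible.\<close>

lemma trapezoid_join:
  assumes n: "\<And>i. i < K \<Longrightarrow> left_slot_le n (lab i)"
  shows "trapezoid_graph (join_graph K lab)"
proof -
  define XL where "XL s = 10 * real s" for s
  define XR where "XR s = 10 * (real n + 1 + real s)" for s
  define p where "p i = (case lab i of SL s \<sigma> \<Rightarrow> (if \<sigma> then XL s - 1 else XL s) - 1
    | SR s \<tau> \<Rightarrow> (if \<tau> then XR s else XR s + 1) | LG l a r b \<Rightarrow> (if a then XL l - 1/2 else XL l + 1/2))" for i
  define q where "q i = (case lab i of SL s \<sigma> \<Rightarrow> XL s - (if \<sigma> then 0 else 1) - 1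
    | SR s \<tau> \<Rightarrow> XR s + (if \<tau> then 1 else 0) | LG l a r b \<Rightarrow> (if a then XL l + 1/2 else XL l - 1/2))" for i
  define P where "P i = (case lab i of SL s \<sigma> \<Rightarrow> (if \<sigma> then XL s - 1 else XL s)
    | SR s \<tau> \<Rightarrow> (if \<tau> then XR s else XR s + 1) + 1 | LG l a r b \<Rightarrow> (if b then XR r - 1/2 else XR r + 1/2))" for i
  define Q where "Q i = (case lab i of SL s \<sigma> \<Rightarrow> XL s - (if \<sigma> then 0 else 1)
    | SR s \<tau> \<Rightarrow> XR s + (if \<tau> then 1 else 0) + 1 | LG l a r b \<Rightarrow> (if b then XR r + 1/2 else XR r - 1/2))" for i
  have l: "left_of p q P Q i j \<longleftrightarrow> vless (lab i) (lab j)" if "i < K" "j < K" for i j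
  proof (rule left_of_slots[where \<theta>L = "\<lambda>_. 0" and \<theta>R = "\<lambda>_. 0" and w = 1 and n = n and A = "{..<K}"
        and zL = "\<lambda>_. True" and zR = "\<lambda>_. True"], goal_cases)
    case (5 v s \<sigma>)
    then show ?case using n[of v] by (auto simp: p_def q_def P_def Q_def XL_def)
  next
    case (6 v s \<tau>)
    then show ?case by (auto simp: p_def q_def P_def Q_def XR_def)
  next
    case (7 v l a r b)
    then show ?case using n[of v] by (auto simp: p_def q_def P_def Q_def XR_def XL_def)
  qed (use that in auto)
  have w: "p i < P i \<and> q i < Q i" if "i < K" for i
    using n[OF that] by (auto simp: p_def q_def P_def Q_def XL_def XR_def split: vtx.splits)
  obtain Z where Z: "\<And>i. i < K \<Longrightarrow> \<bar>p i\<bar> \<le> Z \<and> \<bar>q i\<bar> \<le> Z \<and> \<bar>P i\<bar> \<le> Z \<and> \<bar>Q i\<bar> \<le> Z" "Z \<ge> 1"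
    using bounded_coords[of K p q P Q] by blast
  show ?thesis
  proof (rule trapezoid_graphI[OF pair_graph_join _ join_adj[OF Z l]])
    fix v assume "v \<in> pverts (join_graph K lab)"
    then have "v div 2 < K" by (auto simp: join_graph_def)
    then show "upper Z p v < upper Z P v \<and> lower Z q v < lower Z Q v"
      using w by (auto simp: upper_def lower_def)
  qed
qed

text \<open>Element \<open>i\<close> becomes a parallelogram of slope \<open>\<phi> i\<close>. In
  each of its two slots the leg is the threshold segment turned about its midpoint: it deviates by
  half of the difference between slope and threshold, in opposite directions on the two lines. The
  type it shows in the slot thus depends only on whether its slope exceeds the threshold.\<close>

lemma tolerance_join:
  fixes \<phi> :: "nat \<Rightarrow> real"
  assumes n: "\<And>i. i < K \<Longrightarrow> left_slot_le n (lab i)"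
    and \<phi>: "\<And>i. i < K \<Longrightarrow> \<bar>\<phi> i\<bar> < 1" and th: "\<And>s. \<bar>\<theta>L s\<bar> < 1" "\<And>s. \<bar>\<theta>R s\<bar> < 1"
    and L: "\<And>i l a r b. i < K \<Longrightarrow> lab i = LG l a r b \<Longrightarrow>
      (if a = zL l then \<theta>L l < \<phi> i else \<phi> i < \<theta>L l) \<and> (if b = zR r then \<theta>R r < \<phi> i else \<phi> i < \<theta>R r)"
  shows "tolerance_graph (join_graph K lab)"
proof -
  define XL where "XL s = 10 * real s" for s
  define XR where "XR s = 10 * (real n + 1 + real s)" for s
  define p where "p i = (case lab i of SL s \<sigma> \<Rightarrow> (if \<sigma> = zL s then XL s - 1 else XL s)
    | SR s \<tau> \<Rightarrow> (if \<tau> = zR s then XR s else XR s + 1) | LG l a r b \<Rightarrow> XL l - (\<phi> i - \<theta>L l) / 2)" for i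
  define q where "q i = (case lab i of SL s \<sigma> \<Rightarrow> XL s + \<theta>L s - (if \<sigma> = zL s then 0 else 1)
    | SR s \<tau> \<Rightarrow> XR s + \<theta>R s + (if \<tau> = zR s then 1 else 0) | LG l a r b \<Rightarrow> XL l + \<theta>L l + (\<phi> i - \<theta>L l) / 2)" for i
  define P where "P i = (case lab i of LG l a r b \<Rightarrow> XR r - (\<phi> i - \<theta>R r) / 2 | _ \<Rightarrow> p i)" for i
  define Q where "Q i = (case lab i of LG l a r b \<Rightarrow> XR r + \<theta>R r + (\<phi> i - \<theta>R r) / 2 | _ \<Rightarrow> q i)" for i
  have l: "left_of p q P Q i j \<longleftrightarrow> vless (lab i) (lab j)" if "i < K" "j < K" for i j
  proof (rule left_of_slots[where \<theta>L = \<theta>L and \<theta>R = \<theta>R and w = 0 and n = n and A = "{..<K}"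
        and zL = zL and zR = zR], goal_cases)
    case (5 v s \<sigma>)
    then show ?case using n[of v] by (auto simp: p_def q_def P_def Q_def XL_def)
  next
    case (6 v s \<tau>)
    then show ?case by (auto simp: p_def q_def P_def Q_def XR_def)
  next
    case (7 v l a r b)
    then have v: "v < K" by simp
    have "\<bar>(\<phi> v - \<theta>L l) / 2\<bar> < 1" "\<bar>(\<phi> v - \<theta>R r) / 2\<bar> < 1"
      using \<phi>[OF v] th(1)[of l] th(2)[of r] by (auto simp: abs_less_iff)
    then show ?case using 7 n[OF v] L[OF v 7(2)]
      by (cases "a = zL l"; cases "b = zR r") (auto simp: p_def q_def P_def Q_def XR_def XL_def abs_less_iff)
  qed (use that th in auto)
  have w: "p i \<le> P i \<and> P i - p i = Q i - q i" if i: "i < K" for i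
  proof (cases "lab i")
    case (LG l a r b)
    have "real l \<le> real n" using n[OF i] LG by simp
    then show ?thesis using LG \<phi>[OF i] th(1)[of l] th(2)[of r]
      by (auto simp: p_def q_def P_def Q_def XR_def XL_def abs_less_iff field_simps)
  qed (auto simp: P_def Q_def)
  obtain Z where Z: "\<And>i. i < K \<Longrightarrow> \<bar>p i\<bar> \<le> Z \<and> \<bar>q i\<bar> \<le> Z \<and> \<bar>P i\<bar> \<le> Z \<and> \<bar>Q i\<bar> \<le> Z" "Z \<ge> 1"
    using bounded_coords[of K p q P Q] by blast
  show ?thesis
  proof (rule tolerance_graphI[OF pair_graph_join _ join_adj[OF Z l]])
    fix v assume "v \<in> pverts (join_graph K lab)"
    then have v: "v div 2 < K" by (auto simp: join_graph_def)
    show "upper Z p v \<le> upper Z P v \<and> upper Z P v - upper Z p v = lower Z Q v - lower Z q v \<and>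
        upper Z p v < lower Z q v"
      using w[OF v] Z(1)[OF v] Z(2) by (auto simp: upper_def lower_def abs_le_iff)
  qed
qed

text \<open>
  Vertices with unbounded tolerance are pairwise non-adjacent, so at most one of the two copies
  contains some, and the other copy is represented by parallelograms. Their slopes are the
  tolerances.
\<close>

lemma join_bounded_copy:
  assumes "tolerance_graph (join_graph K lab)"
  shows "\<exists>l r t :: nat \<Rightarrow> real. (\<forall>i < K. t i > 0 \<and> t i \<le> r i - l i) \<and>
    (\<forall>i < K. \<forall>j < K. i \<noteq> j \<longrightarrow> incomp lab i j =
      (\<not> left_of l (\<lambda>v. l v + t v) (\<lambda>v. r v - t v) r i j \<and> \<not> left_of l (\<lambda>v. l v + t v) (\<lambda>v. r v - t v) r j i))"
proof -
  let ?G = "join_graph K lab"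
  have V: "v \<in> pverts ?G \<longleftrightarrow> v < 2 * K" for v by (simp add: join_graph_def)
  from assms obtain l r t :: "nat \<Rightarrow> real" where
    *: "\<forall>v \<in> pverts ?G. l v \<le> r v \<and> t v > 0"
      "\<forall>u \<in> pverts ?G. \<forall>v \<in> pverts ?G. u \<noteq> v \<longrightarrow>
        ((u, v) \<in> parcs ?G \<longleftrightarrow> measure lborel ({l u..r u} \<inter> {l v..r v}) \<ge> min (t u) (t v))"
    unfolding tolerance_graph_def by (elim conjE exE)
  have lr: "l v \<le> r v \<and> t v > 0" if "v < 2 * K" for v
    by (rule bspec[OF *(1)]) (simp only: V that)
  have adj: "(u, v) \<in> parcs ?G \<longleftrightarrow> measure lborel ({l u..r u} \<inter> {l v..r v}) \<ge> min (t u) (t v)"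
    if "u < 2 * K" "v < 2 * K" "u \<noteq> v" for u v
    by (rule bspec[OF bspec[OF *(2)], THEN mp]) (simp_all only: V that not_False_eq_True)
  have "\<exists>c. \<forall>v < 2 * K. even v = c \<longrightarrow> t v \<le> r v - l v"
  proof (rule ccontr)
    assume "\<not> ?thesis"
    then have "\<exists>v < 2 * K. even v = c \<and> t v > r v - l v" for c by (meson not_le)
    then obtain u v where u: "u < 2 * K" "even u" "t u > r u - l u" and v: "v < 2 * K" "odd v" "t v > r v - l v"
      by (metis (full_types))
    then have "(u, v) \<in> parcs ?G" by (auto simp: join_graph_def)
    moreover have "u \<noteq> v" using u v by auto
    ultimately have "measure lborel ({l u..r u} \<inter> {l v..r v}) \<ge> min (t u) (t v)" using adj u v by blast
    moreover have "max 0 (min (r u) (r v) - max (l u) (l v)) < t u"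
      "max 0 (min (r u) (r v) - max (l u) (l v)) < t v"
      using u v lr[of u] lr[of v] by (auto simp: min_def max_def)
    ultimately show False unfolding measure_Int_intervals by (auto simp: min_def split: if_splits)
  qed
  then obtain c where c: "\<And>v. v < 2 * K \<Longrightarrow> even v = c \<Longrightarrow> t v \<le> r v - l v" by blast
  define f where "f i = 2 * i + (if c then 0 else 1)" for i :: nat
  have f: "f i < 2 * K" "even (f i) = c" "f i div 2 = i" if "i < K" for i
    using that by (auto simp: f_def)
  show ?thesis
  proof (rule exI[of _ "l \<circ> f"], rule exI[of _ "r \<circ> f"], rule exI[of _ "t \<circ> f"], intro conjI allI impI)
    fix i assume "i < K"
    then show "(t \<circ> f) i > 0" "(t \<circ> f) i \<le> (r \<circ> f) i - (l \<circ> f) i" using f lr c by simp_all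
  next
    fix i j assume ij: "i < K" "j < K" "i \<noteq> j"
    then have "f i \<noteq> f j" using f by metis
    then have "incomp lab i j \<longleftrightarrow> (f i, f j) \<in> parcs ?G"
      using ij f[of i] f[of j] by (auto simp: join_graph_def)
    also have "\<dots> \<longleftrightarrow> measure lborel ({l (f i)..r (f i)} \<inter> {l (f j)..r (f j)}) \<ge> min (t (f i)) (t (f j))"
      using adj f ij \<open>f i \<noteq> f j\<close> by blast
    also have "\<dots> \<longleftrightarrow> \<not> left_of l (\<lambda>v. l v + t v) (\<lambda>v. r v - t v) r (f i) (f j) \<and>
        \<not> left_of l (\<lambda>v. l v + t v) (\<lambda>v. r v - t v) r (f j) (f i)"
      using f ij lr c by (intro bounded_tolerance_iff) auto
    finally show "incomp lab i j =
        (\<not> left_of (l \<circ> f) (\<lambda>v. (l \<circ> f) v + (t \<circ> f) v) (\<lambda>v. (r \<circ> f) v - (t \<circ> f) v) (r \<circ> f) i j \<and>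
        \<not> left_of (l \<circ> f) (\<lambda>v. (l \<circ> f) v + (t \<circ> f) v) (\<lambda>v. (r \<circ> f) v - (t \<circ> f) v) (r \<circ> f) j i)"
      by (simp add: left_of_def)
  qed
qed

text \<open>
  In a slot, the small elements and the long elements of both types form a \<open>2 + 2\<close>. Its two chains
  point in the same direction, as witnessed by an element \<open>e\<close> that is incomparable to the long
  elements, and this forces the sides of the parallelograms to cross.
\<close>

lemma slopes_of_slot:
  fixes l r t :: "nat \<Rightarrow> real"
  defines "S \<equiv> left_of l (\<lambda>v. l v + t v) (\<lambda>v. r v - t v) r"
  assumes b: "\<And>i. i < K \<Longrightarrow> t i > 0 \<and> t i \<le> r i - l i"
    and inc: "\<And>i j. i < K \<Longrightarrow> j < K \<Longrightarrow> i \<noteq> j \<Longrightarrow> incomp lab i j \<longleftrightarrow> \<not> S i j \<and> \<not> S j i"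
    and K: "a < K" "b < K" "c < K" "d < K" "e < K"
    and comp: "\<not> incomp lab a b" "\<not> incomp lab c d" "\<not> incomp lab a e" "\<not> incomp lab c e"
    and incomp: "incomp lab a c" "incomp lab a d" "incomp lab c b" "incomp lab b e" "incomp lab d e"
    and ne: "distinct [a, b, c, d, e]"
  shows "(t a < t c \<and> t b < t d) \<or> (t c < t a \<and> t d < t b)"
proof -
  have tr: "S i k" if "S i j" "S j k" "j < K" for i j k
    using that b[of j] unfolding S_def left_of_def by auto
  have sym: "incomp lab i j = incomp lab j i" for i j by (auto simp: incomp_def)
  have C: "S i j \<or> S j i" if "\<not> incomp lab i j" "i < K" "j < K" "i \<noteq> j" for i j
    using inc[of i j] that by blast
  have I: "\<not> S i j \<and> \<not> S j i" if "incomp lab i j" "i < K" "j < K" "i \<noteq> j" for i j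
    using inc[of i j] that by blast
  have ab: "S a b \<or> S b a" and cd: "S c d \<or> S d c" and ae: "S a e \<or> S e a" and ce: "S c e \<or> S e c"
    using C comp K ne by auto
  have ac: "\<not> S a c" "\<not> S c a" and ad: "\<not> S a d" "\<not> S d a" and cb: "\<not> S c b" "\<not> S b c"
    and be: "\<not> S b e" "\<not> S e b" and de: "\<not> S d e" "\<not> S e d"
    using I[OF incomp(1)] I[OF incomp(2)] I[OF incomp(3)] I[OF incomp(4)] I[OF incomp(5)] K ne by auto
  \<comment> \<open>With opposite directions, say \<open>a\<close> before \<open>b\<close> and
    \<open>d\<close> before \<open>c\<close>, transitivity puts \<open>e\<close> behind
    \<open>a\<close> and before \<open>c\<close>. Then \<open>a\<close> and \<open>c\<close> would
    be comparable.\<close>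
  have "(S a b \<and> S c d) \<or> (S b a \<and> S d c)"
    using ab cd ae ce ac be de tr K by metis
  then show ?thesis
  proof
    \<comment> \<open>On one line \<open>a\<close> does not precede \<open>d\<close>, and on the
      other line \<open>c\<close> does not precede \<open>b\<close>. Hence the right legs of
      \<open>a\<close> and \<open>c\<close> cross, and the left legs of \<open>b\<close> and
      \<open>d\<close> cross in the same sense.\<close>
    assume "S a b \<and> S c d"
    then show ?thesis using ad cb unfolding S_def left_of_def by argo
  next
    assume "S b a \<and> S d c"
    then show ?thesis using ad cb unfolding S_def left_of_def by argo
  qed
qed

section \<open>From satisfiability to tolerance graphs\<close>

text \<open>
  A CNF formula with variables \<open>0, ..., n - 1\<close> and clauses \<open>0, ..., m\<close>. Every slot carries a
  truth value, which says which type of long elements in it is steeper. The clause \<open>c\<close> owns the slots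
  \<open>i = c * (n + 1) + v\<close> for \<open>v \<le> n\<close>, and the slots of the last clause double as the variables,
  with \<open>v = n\<close> as the constant false. In the slots \<open>i\<close> of a clause, the long elements \<open>0\<close> and \<open>1\<close>
  form a cycle whose slopes cannot increase throughout; \<open>2, 3\<close> equate a left slot with the right slot
  of the same number, and \<open>4, 5\<close> equate a slot with its literal. The small elements \<open>10, 11\<close> serve to
  direct the poset.
\<close>

definition slot :: "nat \<Rightarrow> nat \<Rightarrow> nat \<Rightarrow> nat" where
  "slot n c v = c * (n + 1) + v"

definition lit_slot :: "nat \<Rightarrow> nat \<Rightarrow> (nat \<Rightarrow> nat \<Rightarrow> bool) \<Rightarrow> (nat \<Rightarrow> nat \<Rightarrow> bool) \<Rightarrow> nat \<Rightarrow> nat \<Rightarrow> nat" where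
  "lit_slot n m Pos Neg c v = slot n m (if Pos c v \<noteq> Neg c v then v else n)"

text \<open>Element 10 lies in a left slot behind all others and element 11 in the right slot 0
  before all others, which is why right slots are numbered from \<open>Suc i\<close> on. Each of
  them is incomparable to all long elements and comparable to the small elements of the opposite
  side, as required of the element \<open>e\<close> in \<open>slopes_of_slot\<close>. In the cycle,
  elements 0 and 1 of \<open>v\<close> meet in the right slot of \<open>v\<close>; element 1 of
  \<open>v\<close> and element 0 of \<open>v + 1\<close> meet in the left slot of
  \<open>v + 1\<close>.\<close>

definition label :: "nat \<Rightarrow> nat \<Rightarrow> (nat \<Rightarrow> nat \<Rightarrow> bool) \<Rightarrow> (nat \<Rightarrow> nat \<Rightarrow> bool) \<Rightarrow> nat \<Rightarrow> nat \<Rightarrow> nat \<Rightarrow> vtx" where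
  "label n m Pos Neg c v k = (let i = slot n c v; j = lit_slot n m Pos Neg c v in
    if k = 0 then LG i True (Suc i) False
    else if k = 1 then LG (slot n c (if v = n then 0 else Suc v)) False (Suc i) True
    else if k = 2 then LG i False (Suc i) False
    else if k = 3 then LG i True (Suc i) True
    else if k = 4 then LG i False (Suc j) (Neg c v)
    else if k = 5 then LG i True (Suc j) (\<not> Neg c v)
    else if k = 6 then SL i False
    else if k = 7 then SL i True
    else if k = 8 then SR (Suc i) False
    else if k = 9 then SR (Suc i) True
    else if k = 10 then SL (slot n (Suc m) 0) False
    else SR 0 False)"

definition cnf_label :: "nat \<Rightarrow> nat \<Rightarrow> (nat \<Rightarrow> nat \<Rightarrow> bool) \<Rightarrow> (nat \<Rightarrow> nat \<Rightarrow> bool) \<Rightarrow> nat \<Rightarrow> vtx" where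
  "cnf_label n m Pos Neg a =
    label n m Pos Neg (a div 12 div (n + 1)) (a div 12 mod (n + 1)) (a mod 12)"

definition cnf_graph :: "nat \<Rightarrow> nat \<Rightarrow> (nat \<Rightarrow> nat \<Rightarrow> bool) \<Rightarrow> (nat \<Rightarrow> nat \<Rightarrow> bool) \<Rightarrow> nat pair_pre_digraph" where
  "cnf_graph n m Pos Neg = join_graph (12 * ((m + 1) * (n + 1))) (cnf_label n m Pos Neg)"

definition cnf_sat :: "nat \<Rightarrow> nat \<Rightarrow> (nat \<Rightarrow> nat \<Rightarrow> bool) \<Rightarrow> (nat \<Rightarrow> nat \<Rightarrow> bool) \<Rightarrow> bool" where
  "cnf_sat n m Pos Neg \<longleftrightarrow> (\<exists>z. \<forall>c \<le> m. \<exists>v < n. (Pos c v \<and> z v) \<or> (Neg c v \<and> \<not> z v))"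

text \<open>Since the last clause contains every variable positively, \<open>lit_slot\<close> maps
  each of its slots to itself, and so these slots are free to represent the variables. The slot
  \<open>n\<close> of a clause never carries a literal and always copies the constant.\<close>

locale cnf =
  fixes n m :: nat and Pos Neg :: "nat \<Rightarrow> nat \<Rightarrow> bool"
  assumes const: "\<And>c. \<not> Pos c n" "\<And>c. \<not> Neg c n"
    and last_clause: "\<And>v. v < n \<Longrightarrow> Pos m v" "\<And>v. \<not> Neg m v"
begin

abbreviation "lab \<equiv> cnf_label n m Pos Neg"

definition N :: nat where "N = (m + 1) * (n + 1)"
definition K :: nat where "K = 12 * N"

definition vx :: "nat \<Rightarrow> nat \<Rightarrow> nat \<Rightarrow> nat" where
  "vx c v k = slot n c v * 12 + k"

lemma slot_N: "slot n (Suc m) 0 = N"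
  by (simp add: slot_def N_def)

lemma slot_less: "c \<le> m \<Longrightarrow> v \<le> n \<Longrightarrow> slot n c v < N"
proof -
  assume "c \<le> m" "v \<le> n"
  then have "c * (n + 1) \<le> m * (n + 1)" by (intro mult_le_mono1)
  then show ?thesis using \<open>v \<le> n\<close> by (simp add: N_def slot_def)
qed

lemma slot_divmod: "v \<le> n \<Longrightarrow> slot n c v div (n + 1) = c" "v \<le> n \<Longrightarrow> slot n c v mod (n + 1) = v"
  unfolding slot_def using div_mult_self3[of "n + 1" v c] mod_mult_self3[of c "n + 1" v]
  by (simp_all del: mult_Suc_right)

lemma vx_divmod: "k < 12 \<Longrightarrow> vx c v k div 12 = slot n c v" "k < 12 \<Longrightarrow> vx c v k mod 12 = k"
  unfolding vx_def by simp_all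

lemma vx_less [simp]: "c \<le> m \<Longrightarrow> v \<le> n \<Longrightarrow> k < 12 \<Longrightarrow> vx c v k < K"
  using slot_less[of c v] by (simp add: vx_def K_def)

lemma lab_vx [simp]: "v \<le> n \<Longrightarrow> k < 12 \<Longrightarrow> lab (vx c v k) = label n m Pos Neg c v k"
  by (simp only: cnf_label_def vx_divmod slot_divmod)

lemma vx_surj:
  assumes "a < K"
  shows "\<exists>c v k. c \<le> m \<and> v \<le> n \<and> k < 12 \<and> a = vx c v k"
proof (intro exI conjI)
  let ?i = "a div 12"
  have "?i < (m + 1) * (n + 1)" using assms by (auto simp: K_def N_def)
  then have "?i div (n + 1) < m + 1" by (simp only: less_mult_imp_div_less)
  then show "?i div (n + 1) \<le> m" by simp
  show "?i mod (n + 1) \<le> n" using mod_less_divisor[of "n + 1" ?i] by simp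
  show "a mod 12 < 12" by simp
  show "a = vx (?i div (n + 1)) (?i mod (n + 1)) (a mod 12)" unfolding vx_def slot_def
    by (simp only: div_mult_mod_eq)
qed

lemma cnf_graph_eq: "cnf_graph n m Pos Neg = join_graph K lab"
  by (simp add: cnf_graph_def K_def N_def)

lemma left_slots: "a < K \<Longrightarrow> left_slot_le N (lab a)"
proof -
  assume "a < K"
  then obtain c v k where a: "c \<le> m" "v \<le> n" "k < 12" "a = vx c v k" using vx_surj by blast
  then show ?thesis using slot_less[of c v] slot_less[of c 0] slot_less[of c "Suc v"]
    by (auto simp: label_def Let_def slot_N)
qed

lemma trapezoid_cnf: "trapezoid_graph (cnf_graph n m Pos Neg)"
  unfolding cnf_graph_eq by (rule trapezoid_join[OF left_slots])

lemma tolerance_imp_sat: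
  assumes "tolerance_graph (cnf_graph n m Pos Neg)"
  shows "cnf_sat n m Pos Neg"
proof -
  from join_bounded_copy[OF assms[unfolded cnf_graph_eq]] obtain l r t :: "nat \<Rightarrow> real" where
    *: "\<forall>i < K. t i > 0 \<and> t i \<le> r i - l i" "\<forall>i < K. \<forall>j < K. i \<noteq> j \<longrightarrow> incomp lab i j =
      (\<not> left_of l (\<lambda>v. l v + t v) (\<lambda>v. r v - t v) r i j \<and> \<not> left_of l (\<lambda>v. l v + t v) (\<lambda>v. r v - t v) r j i)"
    by (elim exE conjE)
  note b = *(1)[rule_format] and inc = *(2)[rule_format]
  define y where "y c v \<longleftrightarrow> t (vx c v 6) < t (vx c v 7)" for c v
  define yR where "yR c v \<longleftrightarrow> t (vx c v 8) < t (vx c v 9)" for c v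
  \<comment> \<open>All pairs of long elements of opposite types in a slot form a
    \<open>2 + 2\<close> with the same two small elements 6 and 7, so the direction of the
    comparison depends on the slot alone.\<close>
  have L: "if y c v then t i < t j else t j < t i"
    if "c \<le> m" "v \<le> n" "i < K" "j < K" "lab i = LG (slot n c v) False (Suc r1) b1"
      "lab j = LG (slot n c v) True (Suc r2) b2" for c v i j r1 r2 b1 b2
  proof -
    have labs: "lab (vx c v 6) = SL (slot n c v) False" "lab (vx c v 7) = SL (slot n c v) True"
      "lab (vx c v 11) = SR 0 False"
      using that by (simp_all add: label_def Let_def)
    have "distinct [lab (vx c v 6), lab i, lab (vx c v 7), lab j, lab (vx c v 11)]"
      unfolding labs that by simp
    then have d: "distinct [vx c v 6, i, vx c v 7, j, vx c v 11]" by auto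
    have e: "vx c v 11 < K" using that by (intro vx_less) auto
    have "(t (vx c v 6) < t (vx c v 7) \<and> t i < t j) \<or> (t (vx c v 7) < t (vx c v 6) \<and> t j < t i)"
      by (rule slopes_of_slot[OF b inc _ _ _ _ e _ _ _ _ _ _ _ _ _ d])
        (use that in \<open>simp_all add: labs incomp_def\<close>)
    then show ?thesis by (auto simp: y_def)
  qed
  have R: "if yR c v then t i < t j else t j < t i"
    if "c \<le> m" "v \<le> n" "i < K" "j < K" "lab i = LG l1 a1 (Suc (slot n c v)) False"
      "lab j = LG l2 a2 (Suc (slot n c v)) True" "l1 < N" "l2 < N" for c v i j l1 l2 a1 a2
  proof -
    have labs: "lab (vx c v 8) = SR (Suc (slot n c v)) False" "lab (vx c v 9) = SR (Suc (slot n c v)) True"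
      "lab (vx c v 10) = SL N False"
      using that by (simp_all add: label_def Let_def slot_N)
    have "distinct [lab (vx c v 8), lab i, lab (vx c v 9), lab j, lab (vx c v 10)]"
      unfolding labs that by simp
    then have d: "distinct [vx c v 8, i, vx c v 9, j, vx c v 10]" by auto
    have e: "vx c v 10 < K" using that by (intro vx_less) auto
    have "(t (vx c v 8) < t (vx c v 9) \<and> t i < t j) \<or> (t (vx c v 9) < t (vx c v 8) \<and> t j < t i)"
      by (rule slopes_of_slot[OF b inc _ _ _ _ e _ _ _ _ _ _ _ _ _ d])
        (use that in \<open>simp_all add: labs incomp_def\<close>)
    then show ?thesis by (auto simp: yR_def)
  qed
  have yR: "yR c v = y c v" if "c \<le> m" "v \<le> n" for c v
    using L[OF that, of "vx c v 2" "vx c v 3" "slot n c v" False "slot n c v" True]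
      R[OF that, of "vx c v 2" "vx c v 3" "slot n c v" False "slot n c v" True] that slot_less[OF that]
    by (auto simp: label_def Let_def split: if_splits)
  \<comment> \<open>\<open>EF\<close> and \<open>FE\<close> are the two kinds of consecutive
    comparisons along the cycle: in a right slot from element 0 to element 1, and in the next left
    slot from element 1 to the next element 0.\<close>
  have EF: "if y c v then t (vx c v 0) < t (vx c v 1) else t (vx c v 1) < t (vx c v 0)"
    if "c \<le> m" "v \<le> n" for c v
    using R[OF that, of "vx c v 0" "vx c v 1" "slot n c v" True "slot n c (if v = n then 0 else Suc v)" False] that slot_less[OF that] slot_less[of c "Suc v"] slot_less[of c 0] yR[OF that]
    by (cases "v = n") (simp_all add: label_def Let_def)
  have FE: "if y c v' then t (vx c v 1) < t (vx c v' 0) else t (vx c v' 0) < t (vx c v 1)"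
    if "c \<le> m" "v \<le> n" "v' = (if v = n then 0 else Suc v)" for c v v'
    using L[of c v' "vx c v 1" "vx c v' 0" "slot n c v" True "slot n c v'" False] that slot_less[of c v] slot_less[of c v']
    by (cases "v = n") (simp_all add: label_def Let_def)
  \<comment> \<open>A variable that does not occur in the clause copies the constant and never
    helps. One occurring with both signs copies its complement, as befits a tautological
    clause.\<close>
  have H: "y c v = (y m (if Pos c v \<noteq> Neg c v then v else n) \<noteq> Neg c v)" if "c \<le> m" "v \<le> n" for c v
  proof -
    let ?v = "if Pos c v \<noteq> Neg c v then v else n"
    have v: "?v \<le> n" using that by simp
    have l: "if y c v then t (vx c v 4) < t (vx c v 5) else t (vx c v 5) < t (vx c v 4)"
      using L[OF that, of "vx c v 4" "vx c v 5"] that slot_less[OF that]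
      by (simp add: label_def Let_def)
    show ?thesis
    proof (cases "Neg c v")
      case True
      have "if yR m ?v then t (vx c v 5) < t (vx c v 4) else t (vx c v 4) < t (vx c v 5)"
        using R[OF order_refl v, of "vx c v 5" "vx c v 4" "slot n c v" True "slot n c v" False] that slot_less[OF that] True
        by (simp add: label_def Let_def lit_slot_def)
      then show ?thesis using l yR[OF order_refl v] True by (auto split: if_splits)
    next
      case False
      have "if yR m ?v then t (vx c v 4) < t (vx c v 5) else t (vx c v 5) < t (vx c v 4)"
        using R[OF order_refl v, of "vx c v 4" "vx c v 5" "slot n c v" False "slot n c v" True] that slot_less[OF that] False
        by (simp add: label_def Let_def lit_slot_def)
      then show ?thesis using l yR[OF order_refl v] False by (auto split: if_splits)
    qed
  qed
  define F where "F = y m n"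
  \<comment> \<open>Truth is deviation from the constant slot; a representation and its mirror image
    therefore give the same assignment.\<close>
  define z where "z v \<longleftrightarrow> y m v \<noteq> F" for v
  have "\<exists>v < n. (Pos c v \<and> z v) \<or> (Neg c v \<and> \<not> z v)" if c: "c \<le> m" for c
  proof (rule ccontr)
    assume no: "\<not> ?thesis"
    have yF: "y c v = F" if "v \<le> n" for v
    proof (cases "v = n")
      case True
      then show ?thesis using H[OF c, of n] const by (simp add: F_def)
    next
      case False
      then have "v < n" using that by simp
      then show ?thesis using H[OF c that] no unfolding z_def F_def by (auto split: if_splits)
    qed
    have up: "t (vx c 0 0) < t (vx c v 1)" if "v \<le> n" F for v
      using that(1)
    proof (induction v)
      case 0
      then show ?case using EF[OF c, of 0] yF[of 0] that by simp
    next
      case (Suc v)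
      then show ?case using EF[OF c, of "Suc v"] FE[OF c, of v "Suc v"] yF[of "Suc v"] that by simp
    qed
    have down: "t (vx c v 1) < t (vx c 0 0)" if "v \<le> n" "\<not> F" for v
      using that(1)
    proof (induction v)
      case 0
      then show ?case using EF[OF c, of 0] yF[of 0] that by simp
    next
      case (Suc v)
      then show ?case using EF[OF c, of "Suc v"] FE[OF c, of v "Suc v"] yF[of "Suc v"] that by simp
    qed
    show False using up[of n] down[of n] FE[OF c, of n 0] yF[of 0] by (cases F) auto
  qed
  then show ?thesis unfolding cnf_sat_def by blast
qed

lemma sat_imp_tolerance:
  assumes "cnf_sat n m Pos Neg"
  shows "tolerance_graph (cnf_graph n m Pos Neg)"
proof -
  from assms obtain z where z: "\<And>c. c \<le> m \<Longrightarrow> \<exists>v < n. (Pos c v \<and> z v) \<or> (Neg c v \<and> \<not> z v)"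
    unfolding cnf_sat_def by blast
  \<comment> \<open>The constant false is realised by the value \<open>True\<close>, so
    \<open>y c v\<close> fails exactly at the satisfied literals.\<close>
  define y where "y c v \<longleftrightarrow> \<not> ((Pos c v \<and> z v) \<or> (Neg c v \<and> \<not> z v))" for c v
  have yn: "y c n" for c using const by (simp add: y_def)
  have ym: "y m v \<longleftrightarrow> \<not> z v" if "v < n" for v using last_clause that by (simp add: y_def)
  have H: "y c v = (y m (if Pos c v \<noteq> Neg c v then v else n) \<noteq> Neg c v)" if "v \<le> n" for c v
    using yn ym[of v] const[of c] that by (cases "v = n") (auto simp: y_def)
  \<comment> \<open>The \<open>U\<close> slots with value \<open>True\<close> get weight
    \<open>D\<close> and the \<open>D\<close> others get weight \<open>- U\<close>. The total is 0,
    so the partial sums \<open>S\<close> close up around the cycle. Both numbers are positive: the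
    constant slot is counted by \<open>U\<close>, and a satisfied literal by \<open>D\<close>; so no
    weight vanishes.\<close>
  define U where "U c = real (card {v \<in> {..n}. y c v})" for c
  define D where "D c = real (card {v \<in> {..n}. \<not> y c v})" for c
  define w where "w c v = (if y c v then D c else - U c)" for c v
  define S where "S c v = (\<Sum>u<v. w c u)" for c v
  have S_Suc: "S c (Suc v) = S c v + w c v" for c v by (simp add: S_def)
  have S0: "S c 0 = 0" for c by (simp add: S_def)
  have Sn: "S c (Suc n) = 0" for c
  proof -
    have "S c (Suc n) = (\<Sum>u\<in>{..n}. w c u)" by (simp add: S_def lessThan_Suc_atMost)
    also have "\<dots> = (\<Sum>u\<in>{v \<in> {..n}. y c v}. D c) + (\<Sum>u\<in>{v \<in> {..n}. \<not> y c v}. - U c)"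
      unfolding w_def by (subst sum.If_cases) (auto simp: Int_def Collect_neg_eq intro!: arg_cong2[where f = "(+)"] sum.cong)
    also have "\<dots> = 0" by (simp add: U_def D_def)
    finally show ?thesis .
  qed
  have U: "U c > 0" for c
    using yn[of c] by (auto simp: U_def card_gt_0_iff)
  have D: "D c > 0" if "c \<le> m" for c
  proof -
    from z[OF that] obtain v where "v < n" "\<not> y c v" by (auto simp: y_def)
    then have "v \<in> {v \<in> {..n}. \<not> y c v}" by simp
    then have "card {v \<in> {..n}. \<not> y c v} > 0" by (intro card_gt_0_iff[THEN iffD2]) auto
    then show ?thesis by (simp add: D_def)
  qed
  have w: "if y c v then w c v > 0 else w c v < 0" if "c \<le> m" for c v
    using U[of c] D[OF that] by (simp add: w_def)
  have card: "card {v \<in> {..n}. Q v} \<le> n + 1" for Q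
    by (rule order_trans[OF card_mono[of "{..n}"]]) auto
  have wb: "\<bar>w c v\<bar> \<le> real (n + 1)" for c v
    using card[of "y c"] card[of "\<lambda>v. \<not> y c v"] unfolding w_def U_def D_def of_nat_le_iff[symmetric, where 'a = real] by auto
  have Sb: "\<bar>S c v\<bar> \<le> real (n + 1) * real (n + 1)" if "v \<le> Suc n" for c v
  proof -
    have "\<bar>S c v\<bar> \<le> (\<Sum>u<v. \<bar>w c u\<bar>)" unfolding S_def by (rule sum_abs)
    also have "\<dots> \<le> real (card {..<v}) * real (n + 1)" by (rule sum_bounded_above) (rule wb)
    also have "\<dots> \<le> real (n + 1) * real (n + 1)" using that by (intro mult_right_mono) auto
    finally show ?thesis .
  qed
  \<comment> \<open>A strict bound for everything that is placed on a cycle, including the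
    thresholds.\<close>
  define B where "B = 2 * (real (n + 1) * real (n + 1)) + 2 * real (n + 1) + 1"
  have Bb: "\<bar>2 * S c v + k * w c v\<bar> < B" if "v \<le> Suc n" "0 \<le> k" "k \<le> 2" for c v k
  proof -
    have "\<bar>k * w c v\<bar> \<le> 2 * real (n + 1)" unfolding abs_mult using wb[of c v] that by (intro mult_mono) auto
    moreover have "\<bar>2 * S c v\<bar> \<le> 2 * (real (n + 1) * real (n + 1))" using Sb[OF that(1), of c] by simp
    ultimately show ?thesis unfolding B_def by linarith
  qed
  have B: "B > 0" unfolding B_def by (intro add_nonneg_pos add_nonneg_nonneg mult_nonneg_nonneg) auto
  \<comment> \<open>In slot \<open>v\<close> the left threshold, element 0, the right threshold and
    element 1 sit at \<open>2 * S c v\<close> plus 1/2, 1, 3/2 and 2 times \<open>w c v\<close>.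
    They are thus monotone in the direction given by the sign of the weight, and element 1 arrives
    at the base value of the next slot. Elements 2 to 5 lie beyond all thresholds, on the side that
    \<open>y\<close> prescribes. The divisor \<open>B + 1\<close> makes all slopes less than 1 in
    absolute value.\<close>
  define f where "f c v k = (if k = 0 then 2 * S c v + w c v else if k = 1 then 2 * S c (Suc v)
    else if (k = 2 \<or> k = 4) = y c v then - B else B)" for c v and k :: nat
  define \<phi> where "\<phi> a = f (a div 12 div (n + 1)) (a div 12 mod (n + 1)) (a mod 12) / (B + 1)" for a
  define \<theta>L where "\<theta>L s = (2 * S (s div (n + 1)) (s mod (n + 1)) + 1/2 * w (s div (n + 1)) (s mod (n + 1))) / (B + 1)" for s
  define \<theta>R where "\<theta>R s = (2 * S ((s - 1) div (n + 1)) ((s - 1) mod (n + 1)) + 3/2 * w ((s - 1) div (n + 1)) ((s - 1) mod (n + 1))) / (B + 1)" for s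
  define zL where "zL s = y (s div (n + 1)) (s mod (n + 1))" for s
  define zR where "zR s = y ((s - 1) div (n + 1)) ((s - 1) mod (n + 1))" for s
  have md: "s mod (n + 1) \<le> Suc n" for s using mod_less_divisor[of "n + 1" s] by simp
  have \<phi>v: "\<phi> (vx c v k) = f c v k / (B + 1)" if "v \<le> n" "k < 12" for c v k
    unfolding \<phi>_def using that by (simp only: vx_divmod slot_divmod)
  have Lv: "\<theta>L (slot n c v) = (2 * S c v + 1/2 * w c v) / (B + 1)" "zL (slot n c v) = y c v"
    if "v \<le> n" for c v
    unfolding \<theta>L_def zL_def using that by (simp_all only: slot_divmod)
  have Rv: "\<theta>R (Suc (slot n c v)) = (2 * S c v + 3/2 * w c v) / (B + 1)" "zR (Suc (slot n c v)) = y c v"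
    if "v \<le> n" for c v
    unfolding \<theta>R_def zR_def using that by (simp_all only: slot_divmod diff_Suc_1)
  have small: "\<bar>x / (B + 1)\<bar> < 1" if "\<bar>x\<bar> < B + 1" for x using that B by simp
  show ?thesis unfolding cnf_graph_eq
  proof (rule tolerance_join[OF left_slots, where \<phi> = \<phi> and \<theta>L = \<theta>L and \<theta>R = \<theta>R and zL = zL and zR = zR])
    fix s
    show "\<bar>\<theta>L s\<bar> < 1" unfolding \<theta>L_def using Bb[of "s mod (n + 1)" "1/2" "s div (n + 1)"] md[of s] by (intro small) simp
    show "\<bar>\<theta>R s\<bar> < 1" unfolding \<theta>R_def using Bb[of "(s - 1) mod (n + 1)" "3/2" "(s - 1) div (n + 1)"] md[of "s - 1"] by (intro small) simp
  next
    fix a assume "a < K"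
    then obtain c v k where a: "c \<le> m" "v \<le> n" "k < 12" "a = vx c v k" using vx_surj by blast
    have "\<bar>f c v k\<bar> < B + 1" using Bb[of v 1 c] Bb[of v 2 c] a B by (auto simp: f_def S_Suc)
    then show "\<bar>\<phi> a\<bar> < 1" using small a \<phi>v by simp
  next
    fix a l' a' r' b' assume "a < K" and lab: "lab a = LG l' a' r' b'"
    then obtain c v k where a: "c \<le> m" "v \<le> n" "k < 12" "a = vx c v k" using vx_surj by blast
    have lab': "label n m Pos Neg c v k = LG l' a' r' b'" using lab a by simp
    have k: "k < 6" using lab' by (simp add: label_def Let_def split: if_splits)
    have div: "(x / (B + 1) < x' / (B + 1)) = (x < x')" "(- (x / (B + 1)) < x' / (B + 1)) = (- x < x')"
      "(x / (B + 1) < - (x' / (B + 1))) = (x < - x')" for x x'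
      unfolding minus_divide_left divide_less_cancel using B by auto
    have low: "- B < 2 * S c v + k * w c v" "2 * S c v + k * w c v < B" if "v \<le> n" "0 \<le> k" "k \<le> 2" for c v k
      using Bb[of v k c] that by auto
    let ?u = "if Pos c v \<noteq> Neg c v then v else n"
    have u: "?u \<le> n" using a by simp
    note facts = w[OF a(1), of v] \<phi>v[OF a(2,3)] Lv[OF a(2), of c] Rv[OF a(2), of c] low[OF a(2), of "1/2" c] low[OF a(2), of "3/2" c]
    consider "k = 0" | "k = 1" "v = n" | "k = 1" "v < n" | "k = 2" | "k = 3" | "k = 4" | "k = 5" using k a(2) by linarith
    then show "(if a' = zL l' then \<theta>L l' < \<phi> a else \<phi> a < \<theta>L l') \<and> (if b' = zR r' then \<theta>R r' < \<phi> a else \<phi> a < \<theta>R r')"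
    proof cases
      case 1
      then have "l' = slot n c v" "a'" "r' = Suc (slot n c v)" "\<not> b'" using lab' by (auto simp: label_def Let_def)
      then show ?thesis using facts 1 a(4) by (auto simp: div f_def split: if_splits)
    next
      case 2
      then have "l' = slot n c 0" "\<not> a'" "r' = Suc (slot n c v)" "b'" using lab' by (auto simp: label_def Let_def)
      moreover have "f c v k = 0" using 2 Sn by (simp add: f_def)
      moreover have "2 * S c v + 3/2 * w c v = - 1/2 * w c v" using Sn[of c] S_Suc[of c n] 2 by simp
      ultimately show ?thesis using facts Lv[of 0 c] w[OF a(1), of 0] 2 a(4) B S0
        by (auto simp: div zero_less_divide_iff divide_less_0_iff split: if_splits)
    next
      case 3
      then have "l' = slot n c (Suc v)" "\<not> a'" "r' = Suc (slot n c v)" "b'" using lab' by (auto simp: label_def Let_def)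
      then show ?thesis using facts Lv[of "Suc v" c] w[OF a(1), of "Suc v"] 3 a(4)
        by (auto simp: div f_def S_Suc split: if_splits)
    next
      case 4
      then have "l' = slot n c v" "\<not> a'" "r' = Suc (slot n c v)" "\<not> b'" using lab' by (auto simp: label_def Let_def)
      then show ?thesis using facts 4 a(4) by (auto simp: div f_def split: if_splits)
    next
      case 5
      then have "l' = slot n c v" "a'" "r' = Suc (slot n c v)" "b'" using lab' by (auto simp: label_def Let_def)
      then show ?thesis using facts 5 a(4) by (auto simp: div f_def split: if_splits)
    next
      case 6
      then have "l' = slot n c v" "\<not> a'" "r' = Suc (slot n m ?u)" "b' = Neg c v" using lab' by (auto simp: label_def Let_def lit_slot_def)
      then show ?thesis using facts 6 a(4) H[OF a(2), of c] Rv[OF u, of m] low[OF u, of "3/2" m]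
        by (auto simp: div f_def split: if_splits)
    next
      case 7
      then have "l' = slot n c v" "a'" "r' = Suc (slot n m ?u)" "b' = (\<not> Neg c v)" using lab' by (auto simp: label_def Let_def lit_slot_def)
      then show ?thesis using facts 7 a(4) H[OF a(2), of c] Rv[OF u, of m] low[OF u, of "3/2" m]
        by (auto simp: div f_def split: if_splits)
    qed
  qed
qed

end

section \<open>Formulas for graphs\<close>

definition Tr :: fm where "Tr = Ls (Cn 0) (Cn 1)"
definition Or :: "fm \<Rightarrow> fm \<Rightarrow> fm" where "Or \<phi> \<psi> = Ng (An (Ng \<phi>) (Ng \<psi>))"
definition Eq :: "trm \<Rightarrow> trm \<Rightarrow> fm" where "Eq a b = An (Ng (Ls a b)) (Ng (Ls b a))"
definition Iff :: "fm \<Rightarrow> fm \<Rightarrow> fm" where "Iff \<phi> \<psi> = Or (An \<phi> \<psi>) (An (Ng \<phi>) (Ng \<psi>))"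
definition Ite :: "fm \<Rightarrow> fm \<Rightarrow> fm \<Rightarrow> fm" where "Ite c \<phi> \<psi> = Or (An c \<phi>) (An (Ng c) \<psi>)"
definition All :: "nat \<Rightarrow> trm \<Rightarrow> fm \<Rightarrow> fm" where "All v b \<phi> = Ng (Ex v b (Ng \<phi>))"

lemma fv_derived [simp]:
  "fv x e Tr" "fv x e (Or \<phi> \<psi>) \<longleftrightarrow> fv x e \<phi> \<or> fv x e \<psi>" "fv x e (Eq a b) \<longleftrightarrow> tv e a = tv e b"
  "fv x e (Iff \<phi> \<psi>) \<longleftrightarrow> (fv x e \<phi> \<longleftrightarrow> fv x e \<psi>)"
  "fv x e (Ite c \<phi> \<psi>) \<longleftrightarrow> (if fv x e c then fv x e \<phi> else fv x e \<psi>)"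
  "fv x e (All v b \<phi>) \<longleftrightarrow> (\<forall>i < tv e b. fv x (e(v := i)) \<phi>)"
  by (auto simp: Tr_def Or_def Eq_def Iff_def Ite_def All_def)

lemma wff_derived [simp]:
  "wff d Tr" "wff d (Or \<phi> \<psi>) \<longleftrightarrow> wff d \<phi> \<and> wff d \<psi>" "wff d (Eq a b) \<longleftrightarrow> wft d a \<and> wft d b"
  "wff d (Iff \<phi> \<psi>) \<longleftrightarrow> wff d \<phi> \<and> wff d \<psi>" "wff d (Ite c \<phi> \<psi>) \<longleftrightarrow> wff d c \<and> wff d \<phi> \<and> wff d \<psi>"
  "wff d (All v b \<phi>) \<longleftrightarrow> d \<le> v \<and> wft d b \<and> wff (Suc v) \<phi>"
  by (auto simp: Tr_def Or_def Eq_def Iff_def Ite_def All_def)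

fun exs :: "(nat \<times> trm) list \<Rightarrow> fm \<Rightarrow> fm" where
  "exs [] \<phi> = \<phi>"
| "exs ((v, b) # vs) \<phi> = Ex v b (exs vs \<phi>)"

fun ands :: "fm list \<Rightarrow> fm" where
  "ands [] = Tr"
| "ands (\<phi> # \<phi>s) = An \<phi> (ands \<phi>s)"

definition Disj :: "fm list \<Rightarrow> fm" where
  "Disj \<phi>s = foldr Or \<phi>s (Ng Tr)"

lemma fv_Disj [simp]: "fv x e (Disj \<phi>s) \<longleftrightarrow> (\<exists>\<phi> \<in> set \<phi>s. fv x e \<phi>)"
  by (induction \<phi>s) (auto simp: Disj_def)

lemma wff_Disj [simp]: "wff d (Disj \<phi>s) \<longleftrightarrow> (\<forall>\<phi> \<in> set \<phi>s. wff d \<phi>)"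
  by (induction \<phi>s) (auto simp: Disj_def)

fun tvs :: "trm \<Rightarrow> nat set" where
  "tvs (V i) = {i}"
| "tvs (Cn c) = {}"
| "tvs (Pl a b) = tvs a \<union> tvs b"
| "tvs (Ti a b) = tvs a \<union> tvs b"

fun fvs :: "fm \<Rightarrow> nat set" where
  "fvs (Ls a b) = tvs a \<union> tvs b"
| "fvs (Bt a) = tvs a"
| "fvs (Ng \<phi>) = fvs \<phi>"
| "fvs (An \<phi> \<psi>) = fvs \<phi> \<union> fvs \<psi>"
| "fvs (Ex v b \<phi>) = tvs b \<union> (fvs \<phi> - {v})"

lemma fvs_derived [simp]:
  "fvs Tr = {}" "fvs (Or \<phi> \<psi>) = fvs \<phi> \<union> fvs \<psi>" "fvs (Eq a b) = tvs a \<union> tvs b"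
  "fvs (Iff \<phi> \<psi>) = fvs \<phi> \<union> fvs \<psi>" "fvs (Ite c \<phi> \<psi>) = fvs c \<union> fvs \<phi> \<union> fvs \<psi>"
  "fvs (All v b \<phi>) = tvs b \<union> (fvs \<phi> - {v})"
  by (auto simp: Tr_def Or_def Eq_def Iff_def Ite_def All_def)

lemma fvs_Disj [simp]: "fvs (Disj \<phi>s) = (\<Union>\<phi> \<in> set \<phi>s. fvs \<phi>)"
  by (induction \<phi>s) (auto simp: Disj_def)

lemma tv_eq: "(\<And>i. i \<in> tvs t \<Longrightarrow> e i = e' i) \<Longrightarrow> tv e t = tv e' t"
  by (induction t) auto

lemma fv_eq: "(\<And>i. i \<in> fvs \<phi> \<Longrightarrow> e i = e' i) \<Longrightarrow> fv x e \<phi> = fv x e' \<phi>"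
proof (induction \<phi> arbitrary: e e')
  case (Ls a b)
  then show ?case using tv_eq[of a e e'] tv_eq[of b e e'] by simp
next
  case (Bt a)
  then show ?case using tv_eq[of a e e'] by simp
next
  case (Ng \<phi>)
  have "fv x e \<phi> = fv x e' \<phi>" using Ng.prems by (intro Ng.IH) simp
  then show ?case by simp
next
  case (An \<phi> \<psi>)
  have "fv x e \<phi> = fv x e' \<phi>" using An.prems by (intro An.IH(1)) simp
  moreover have "fv x e \<psi> = fv x e' \<psi>" using An.prems by (intro An.IH(2)) simp
  ultimately show ?case by simp
next
  case (Ex v b \<phi>)
  have "tv e b = tv e' b" using Ex.prems by (intro tv_eq) auto
  moreover have "fv x (e(v := i)) \<phi> = fv x (e'(v := i)) \<phi>" for i
    using Ex.prems by (intro Ex.IH) auto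
  ultimately show ?case by simp
qed

lemma wft_iff: "wft d t \<longleftrightarrow> tvs t \<subseteq> {..<d}"
  by (induction t) auto

text \<open>Horner's scheme as a term.\<close>

definition ptrm :: "nat poly \<Rightarrow> trm \<Rightarrow> trm" where
  "ptrm p a = fold_coeffs (\<lambda>c r. Pl (Cn c) (Ti a r)) p (Cn 0)"

lemma ptrm_pCons: "ptrm (pCons c p) a = (if c = 0 \<and> p = 0 then Cn 0 else Pl (Cn c) (Ti a (ptrm p a)))"
  by (simp add: ptrm_def)

lemma ptrm_0 [simp]: "ptrm 0 a = Cn 0"
  by (simp add: ptrm_def)

lemma tv_ptrm [simp]: "tv e (ptrm p a) = poly p (tv e a)"
  by (induction p) (auto simp: ptrm_pCons)

lemma tvs_ptrm: "tvs (ptrm p a) \<subseteq> tvs a"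
  by (induction p) (auto simp: ptrm_pCons)

text \<open>Labels as five numbers, so that a formula can guess a label with five bounded
  quantifiers; absent components are 0.\<close>

fun code :: "vtx \<Rightarrow> nat \<times> nat \<times> nat \<times> nat \<times> nat" where
  "code (SL s \<sigma>) = (0, s, of_bool \<sigma>, 0, 0)"
| "code (SR s \<tau>) = (1, 0, 0, s, of_bool \<tau>)"
| "code (LG l a r b) = (2, l, of_bool a, r, of_bool b)"

definition code_less :: "nat \<times> nat \<times> nat \<times> nat \<times> nat \<Rightarrow> nat \<times> nat \<times> nat \<times> nat \<times> nat \<Rightarrow> bool" where
  "code_less = (\<lambda>(y, l, a, r, b) (y', l', a', r', b').
    (y = 0 \<and> y' = 0 \<and> l < l') \<or> (y = 0 \<and> y' = 2 \<and> (l < l' \<or> (l = l' \<and> a = a'))) \<or> (y = 0 \<and> y' = 1) \<or>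
    (y = 2 \<and> y' = 1 \<and> (r < r' \<or> (r = r' \<and> b = b'))) \<or> (y = 1 \<and> y' = 1 \<and> r < r'))"

lemma vless_code: "vless u w \<longleftrightarrow> code_less (code u) (code w)"
  by (cases u; cases w) (auto simp: code_less_def)

definition lessF :: "trm \<times> trm \<times> trm \<times> trm \<times> trm \<Rightarrow> trm \<times> trm \<times> trm \<times> trm \<times> trm \<Rightarrow> fm" where
  "lessF = (\<lambda>(y, l, a, r, b) (y', l', a', r', b').
    Or (An (Eq y (Cn 0)) (An (Eq y' (Cn 0)) (Ls l l')))
   (Or (An (Eq y (Cn 0)) (An (Eq y' (Cn 2)) (Or (Ls l l') (An (Eq l l') (Eq a a')))))
   (Or (An (Eq y (Cn 0)) (Eq y' (Cn 1)))
   (Or (An (Eq y (Cn 2)) (An (Eq y' (Cn 1)) (Or (Ls r r') (An (Eq r r') (Eq b b')))))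
       (An (Eq y (Cn 1)) (An (Eq y' (Cn 1)) (Ls r r')))))))"

lemma less_12_cases: "k < 12 \<Longrightarrow> k \<in> {0, 1, 2, 3, 4, 5, 6, 7, 8, 9, 10, 11 :: nat}"
  unfolding insert_iff empty_iff by presburger

text \<open>The parameters describe a CNF formula that depends on the input word: variable 0 is its
  length, variable 30 a clause and variable 31 a propositional variable. The numbers 30 and 31 are
  that large because \<open>wff\<close> requires numbers to increase inwards and
  \<open>edgeF\<close> quantifies over many variables outside.\<close>

locale graph_formula =
  fixes nT mT :: trm and posF negF :: fm
  assumes nT: "tvs nT \<subseteq> {0}" and mT: "tvs mT \<subseteq> {0}"
    and posF: "fvs posF \<subseteq> {0, 30, 31}" "wff 32 posF" and negF: "fvs negF \<subseteq> {0, 30, 31}" "wff 32 negF"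
begin

abbreviation env :: "nat \<Rightarrow> nat \<Rightarrow> nat \<Rightarrow> nat \<Rightarrow> nat" where
  "env k c v \<equiv> (\<lambda>_. 0)(0 := k, 30 := c, 31 := v)"

definition n :: "bool list \<Rightarrow> nat" where "n x = tv (env (length x) 0 0) nT"
definition m :: "bool list \<Rightarrow> nat" where "m x = tv (env (length x) 0 0) mT"
definition Pos :: "bool list \<Rightarrow> nat \<Rightarrow> nat \<Rightarrow> bool" where "Pos x c v = fv x (env (length x) c v) posF"
definition Neg :: "bool list \<Rightarrow> nat \<Rightarrow> nat \<Rightarrow> bool" where "Neg x c v = fv x (env (length x) c v) negF"

lemma tv_nT [simp]: "e 0 = length x \<Longrightarrow> tv e nT = n x"
  unfolding n_def using nT by (intro tv_eq) auto

lemma tv_mT [simp]: "e 0 = length x \<Longrightarrow> tv e mT = m x"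
  unfolding m_def using mT by (intro tv_eq) auto

lemma fv_posF [simp]: "e 0 = length x \<Longrightarrow> fv x e posF = Pos x (e 30) (e 31)"
  unfolding Pos_def using posF by (intro fv_eq) auto

lemma fv_negF [simp]: "e 0 = length x \<Longrightarrow> fv x e negF = Neg x (e 30) (e 31)"
  unfolding Neg_def using negF by (intro fv_eq) auto

definition slotT :: "trm \<Rightarrow> trm \<Rightarrow> trm" where
  "slotT c v = Pl (Ti c (Pl nT (Cn 1))) v"

lemma tv_slotT [simp]: "e 0 = length x \<Longrightarrow> tv e (slotT c v) = slot (n x) (tv e c) (tv e v)"
  by (simp add: slotT_def slot_def)

definition tupF :: "trm \<times> trm \<times> trm \<times> trm \<times> trm \<Rightarrow> trm \<times> trm \<times> trm \<times> trm \<times> trm \<Rightarrow> fm" where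
  "tupF = (\<lambda>(y, l, a, r, b) (y', l', a', r', b').
    An (Eq y y') (An (Eq l l') (An (Eq a a') (An (Eq r r') (Eq b b')))))"

text \<open>The kind \<open>k\<close> element of the slot given by the variables \<open>30, 31\<close> has label \<open>t\<close>.\<close>

definition labelF :: "trm \<Rightarrow> trm \<times> trm \<times> trm \<times> trm \<times> trm \<Rightarrow> fm" where
  "labelF k t = (let c = V 30; v = V 31; i = slotT c v; i' = Pl i (Cn 1); z = Cn 0; w1 = Cn 1;
      u = slotT mT v; w = slotT mT nT; odd = Iff posF negF in
    Disj [
      An (Eq k (Cn 0)) (tupF t (Cn 2, i, w1, i', z)),
      An (Eq k (Cn 1)) (Ite (Eq v nT) (tupF t (Cn 2, slotT c z, z, i', w1)) (tupF t (Cn 2, slotT c (Pl v w1), z, i', w1))),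
      An (Eq k (Cn 2)) (tupF t (Cn 2, i, z, i', z)),
      An (Eq k (Cn 3)) (tupF t (Cn 2, i, w1, i', w1)),
      An (Eq k (Cn 4)) (Ite odd (Ite negF (tupF t (Cn 2, i, z, Pl w w1, w1)) (tupF t (Cn 2, i, z, Pl w w1, z)))
        (Ite negF (tupF t (Cn 2, i, z, Pl u w1, w1)) (tupF t (Cn 2, i, z, Pl u w1, z)))),
      An (Eq k (Cn 5)) (Ite odd (Ite negF (tupF t (Cn 2, i, w1, Pl w w1, z)) (tupF t (Cn 2, i, w1, Pl w w1, w1)))
        (Ite negF (tupF t (Cn 2, i, w1, Pl u w1, z)) (tupF t (Cn 2, i, w1, Pl u w1, w1)))),
      An (Eq k (Cn 6)) (tupF t (z, i, z, z, z)),
      An (Eq k (Cn 7)) (tupF t (z, i, w1, z, z)),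
      An (Eq k (Cn 8)) (tupF t (w1, z, z, i', z)),
      An (Eq k (Cn 9)) (tupF t (w1, z, z, i', w1)),
      An (Eq k (Cn 10)) (tupF t (z, slotT (Pl mT w1) z, z, z, z)),
      An (Eq k (Cn 11)) (tupF t (w1, z, z, z, z))])"

definition tupv :: "(nat \<Rightarrow> nat) \<Rightarrow> trm \<times> trm \<times> trm \<times> trm \<times> trm \<Rightarrow> nat \<times> nat \<times> nat \<times> nat \<times> nat" where
  "tupv e = (\<lambda>(y, l, a, r, b). (tv e y, tv e l, tv e a, tv e r, tv e b))"

lemma fv_tupF: "fv x e (tupF t t') \<longleftrightarrow> tupv e t = tupv e t'"
  by (auto simp: tupF_def tupv_def split: prod.splits)

lemma fv_lessF: "fv x e (lessF t t') \<longleftrightarrow> code_less (tupv e t) (tupv e t')"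
  by (auto simp: lessF_def tupv_def code_less_def split: prod.splits)

lemma fv_labelF:
  assumes "e 0 = length x" "tv e k < 12"
  shows "fv x e (labelF k t) \<longleftrightarrow> tupv e t = code (label (n x) (m x) (Pos x) (Neg x) (e 30) (e 31) (tv e k))"
proof -
  have k: "tv e k \<in> {0, 1, 2, 3, 4, 5, 6, 7, 8, 9, 10, 11}" using less_12_cases[OF assms(2)] .
  show ?thesis
    unfolding labelF_def Let_def fv_Disj set_simps bex_simps
    using k assms(1) by (elim insertE emptyE)
      (simp_all add: fv_tupF, simp_all add: tupv_def label_def lit_slot_def Let_def)
qed

definition NT :: trm where "NT = Ti (Pl mT (Cn 1)) (Pl nT (Cn 1))"
definition mb :: trm where "mb = Pl mT (Cn 1)"
definition nb :: trm where "nb = Pl nT (Cn 1)"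

text \<open>The formulas \<open>posF\<close> and \<open>negF\<close> speak about the fixed variables
  30 and 31, but are needed at both ends of an edge. Binding these variables anew and equating them
  with \<open>c\<close> and \<open>v\<close> replaces a substitution.\<close>

definition labAt :: "nat \<Rightarrow> nat \<Rightarrow> nat \<Rightarrow> nat \<Rightarrow> fm" where
  "labAt c v k y = exs [(30, mb), (31, nb)] (ands [Eq (V 30) (V c), Eq (V 31) (V v),
    labelF (V k) (V y, V (y + 1), V (y + 2), V (y + 3), V (y + 4))])"

text \<open>Slot numbers reach \<open>NT\<close> itself, on the left through element 10 and on the
  right through the shift by 1; the bound \<open>Pl NT (Cn 3)\<close> includes them.\<close>

definition incF :: fm where
  "incF = (let bd = Pl NT (Cn 3); t = (\<lambda>y. (V y, V (y + 1), V (y + 2), V (y + 3), V (y + 4))) in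
    exs [(14, Cn 3), (15, bd), (16, Cn 2), (17, bd), (18, Cn 2), (19, Cn 3), (20, bd), (21, Cn 2), (22, bd), (23, Cn 2)]
     (ands [labAt 8 9 10 14, labAt 11 12 13 19, Ng (lessF (t 14) (t 19)), Ng (lessF (t 19) (t 14))]))"

text \<open>Terms have no division. Row, column and their mixed-radix digits (clause, slot, kind of
  element, copy) are guessed and checked by multiplication; uniqueness of the digits makes the
  guesses deterministic.\<close>

definition edgeF :: fm where
  "edgeF = (let sz = Ti (Cn 24) NT in
    exs [(2, sz), (3, sz)] (An (Eq (V 1) (Pl (Ti (V 2) sz) (V 3)))
     (exs [(4, Cn 2), (5, Cn 2), (8, mb), (9, nb), (10, Cn 12), (11, mb), (12, nb), (13, Cn 12)]
     (ands [Ng (Eq (V 2) (V 3)),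
       Eq (V 2) (Pl (Ti (Cn 2) (Pl (Ti (slotT (V 8) (V 9)) (Cn 12)) (V 10))) (V 4)),
       Eq (V 3) (Pl (Ti (Cn 2) (Pl (Ti (slotT (V 11) (V 12)) (Cn 12)) (V 13))) (V 5)),
       Or (Ng (Eq (V 4) (V 5))) incF]))))"

lemma wft_simps [simp]: "d > 0 \<Longrightarrow> wft d nT" "d > 0 \<Longrightarrow> wft d mT"
  using nT mT by (auto simp: wft_iff)

lemma wff_edgeF: "wff 2 edgeF"
proof -
  have "wff 32 (labelF (V k) (V y, V (y + 1), V (y + 2), V (y + 3), V (y + 4)))" if "k < 28" "y < 28" for k y
    using that posF negF by (simp add: labelF_def Let_def tupF_def slotT_def)
  then have "wff 24 (labAt c v k y)" if "c < 24" "v < 24" "k < 24" "y < 20" for c v k y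
    using that by (simp add: labAt_def mb_def nb_def)
  then have "wff 14 incF" by (simp add: incF_def Let_def lessF_def NT_def)
  then show ?thesis
    by (simp add: edgeF_def Let_def slotT_def NT_def mb_def nb_def)
qed

abbreviation lbl :: "bool list \<Rightarrow> nat \<Rightarrow> nat \<Rightarrow> nat \<Rightarrow> vtx" where
  "lbl x \<equiv> label (n x) (m x) (Pos x) (Neg x)"

definition Nx :: "bool list \<Rightarrow> nat" where "Nx x = (m x + 1) * (n x + 1)"

lemma tv_bounds [simp]: "e 0 = length x \<Longrightarrow> tv e NT = Nx x" "e 0 = length x \<Longrightarrow> tv e mb = Suc (m x)"
  "e 0 = length x \<Longrightarrow> tv e nb = Suc (n x)"
  by (simp_all add: NT_def mb_def nb_def Nx_def)

lemma fv_labAt: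
  assumes "e 0 = length x" "e c \<le> m x" "e v \<le> n x" "e k < 12" "c < 30" "v < 30" "k < 30" "y < 25"
  shows "fv x e (labAt c v k y) \<longleftrightarrow> (e y, e (y + 1), e (y + 2), e (y + 3), e (y + 4)) = code (lbl x (e c) (e v) (e k))"
proof -
  have "fv x e (labAt c v k y) \<longleftrightarrow> fv x (e(30 := e c, 31 := e v)) (labelF (V k) (V y, V (y + 1), V (y + 2), V (y + 3), V (y + 4)))"
    unfolding labAt_def using assms by (auto simp: less_Suc_eq_le)
  also have "\<dots> \<longleftrightarrow> (e y, e (y + 1), e (y + 2), e (y + 3), e (y + 4)) = code (lbl x (e c) (e v) (e k))"
    using assms by (subst fv_labelF) (simp_all add: tupv_def)
  finally show ?thesis .
qed

lemma slot_le: "c \<le> m x \<Longrightarrow> v \<le> n x \<Longrightarrow> slot (n x) c v < Nx x"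
proof -
  assume "c \<le> m x" "v \<le> n x"
  then have "c * (n x + 1) \<le> m x * (n x + 1)" by (intro mult_le_mono1)
  then show ?thesis using \<open>v \<le> n x\<close> by (simp add: Nx_def slot_def)
qed

lemma code_bounds:
  assumes "c \<le> m x" "v \<le> n x" "code (lbl x c v k) = (y, l, a, r, b)"
  shows "y < 3 \<and> l < Nx x + 3 \<and> a < 2 \<and> r < Nx x + 3 \<and> b < 2"
proof -
  have "slot (n x) (Suc (m x)) 0 = Nx x" by (simp add: slot_def Nx_def)
  then show ?thesis
    using assms slot_le[of c x v] slot_le[of c x 0] slot_le[of c x "Suc v"] slot_le[of "m x" x v] slot_le[of "m x" x "n x"]
    unfolding label_def lit_slot_def Let_def by (simp split: if_splits) auto
qed

lemma fv_incF:
  assumes "e 0 = length x" "e 8 \<le> m x" "e 9 \<le> n x" "e 10 < 12" "e 11 \<le> m x" "e 12 \<le> n x" "e 13 < 12"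
  shows "fv x e incF \<longleftrightarrow> \<not> vless (lbl x (e 8) (e 9) (e 10)) (lbl x (e 11) (e 12) (e 13)) \<and>
    \<not> vless (lbl x (e 11) (e 12) (e 13)) (lbl x (e 8) (e 9) (e 10))" (is "_ \<longleftrightarrow> ?R")
proof -
  obtain y l a r b where A: "code (lbl x (e 8) (e 9) (e 10)) = (y, l, a, r, b)" by (metis prod_cases5)
  obtain y' l' a' r' b' where B: "code (lbl x (e 11) (e 12) (e 13)) = (y', l', a', r', b')" by (metis prod_cases5)
  note bd = code_bounds[OF assms(2,3) A] code_bounds[OF assms(5,6) B]
  have "fv x e incF \<longleftrightarrow> (\<exists>y1<3. \<exists>l1<Nx x + 3. \<exists>a1<2. \<exists>r1<Nx x + 3. \<exists>b1<2. \<exists>y2<3. \<exists>l2<Nx x + 3. \<exists>a2<2. \<exists>r2<Nx x + 3. \<exists>b2<2.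
      (y1, l1, a1, r1, b1) = (y, l, a, r, b) \<and> (y2, l2, a2, r2, b2) = (y', l', a', r', b') \<and>
      \<not> code_less (y1, l1, a1, r1, b1) (y2, l2, a2, r2, b2) \<and> \<not> code_less (y2, l2, a2, r2, b2) (y1, l1, a1, r1, b1))"
    unfolding incF_def Let_def exs.simps ands.simps fv.simps fv_lessF using assms A B
    by (simp add: fv_labAt tupv_def)
  also have "\<dots> \<longleftrightarrow> \<not> code_less (y, l, a, r, b) (y', l', a', r', b') \<and> \<not> code_less (y', l', a', r', b') (y, l, a, r, b)"
    using bd by auto
  also have "\<dots> \<longleftrightarrow> ?R" unfolding vless_code A B ..
  finally show ?thesis .
qed

abbreviation G :: "bool list \<Rightarrow> nat pair_pre_digraph" where
  "G x \<equiv> cnf_graph (n x) (m x) (Pos x) (Neg x)"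

lemma fv_edgeF:
  assumes i: "i < 24 * Nx x" "j < 24 * Nx x"
  shows "fv x (env2 (length x) (i * (24 * Nx x) + j)) edgeF \<longleftrightarrow> (i, j) \<in> parcs (G x)" (is "?F \<longleftrightarrow> _")
proof -
  define e where "e = env2 (length x) (i * (24 * Nx x) + j)"
  define sz where "sz = 24 * Nx x"
  have eq: "i * sz + j = a * sz + b \<longleftrightarrow> a = i \<and> b = j" if "b < sz" for a b
  proof
    assume e: "i * sz + j = a * sz + b"
    have "(i * sz + j) div sz = i" "(i * sz + j) mod sz = j" "(a * sz + b) div sz = a" "(a * sz + b) mod sz = b"
      using i that by (simp_all add: sz_def)
    then show "a = i \<and> b = j" using e by metis
  qed simp
  have dec: "cnf_label (n x) (m x) (Pos x) (Neg x) (a div 2) = lbl x c v k" "even a \<longleftrightarrow> p = 0"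
    if "a = 2 * (slot (n x) c v * 12 + k) + p" "v \<le> n x" "k < 12" "p < 2" for a c v k p
  proof -
    have "a div 2 = slot (n x) c v * 12 + k" using that by simp
    then have "a div 2 div 12 = slot (n x) c v" "a div 2 mod 12 = k" using that(3) by simp_all
    moreover have "slot (n x) c v div (n x + 1) = c" "slot (n x) c v mod (n x + 1) = v"
      unfolding slot_def using that(2) div_mult_self3[of "n x + 1" v c] mod_mult_self3[of c "n x + 1" v]
      by (simp_all del: mult_Suc_right)
    ultimately show "cnf_label (n x) (m x) (Pos x) (Neg x) (a div 2) = lbl x c v k"
      by (simp only: cnf_label_def)
    show "even a \<longleftrightarrow> p = 0" using that(1,4) by (auto simp: less_2_cases_iff)
  qed
  have ex: "\<exists>c\<le>m x. \<exists>v\<le>n x. \<exists>k<12. \<exists>p<2. a = 2 * (slot (n x) c v * 12 + k) + p" if "a < sz" for a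
  proof (intro exI conjI)
    let ?i = "a div 2 div 12"
    have "?i < (m x + 1) * (n x + 1)" using that unfolding sz_def Nx_def by linarith
    then have "?i div (n x + 1) < m x + 1" by (simp only: less_mult_imp_div_less)
    then show "?i div (n x + 1) \<le> m x" by simp
    show "?i mod (n x + 1) \<le> n x" using mod_less_divisor[of "n x + 1" ?i] by simp
    show "a div 2 mod 12 < 12" "a mod 2 < 2" by simp_all
    show "a = 2 * (slot (n x) (?i div (n x + 1)) (?i mod (n x + 1)) * 12 + a div 2 mod 12) + a mod 2"
      unfolding slot_def by (simp only: div_mult_mod_eq mult_div_mod_eq)
  qed
  have parcs: "(i, j) \<in> parcs (G x) \<longleftrightarrow> i \<noteq> j \<and> (p \<noteq> p' \<or> (\<not> vless (lbl x c v k) (lbl x c' v' k') \<and> \<not> vless (lbl x c' v' k') (lbl x c v k)))"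
    if "i = 2 * (slot (n x) c v * 12 + k) + p" "v \<le> n x" "k < 12" "p < 2"
      "j = 2 * (slot (n x) c' v' * 12 + k') + p'" "v' \<le> n x" "k' < 12" "p' < 2" for c v k p c' v' k' p'
  proof -
    have "24 * Nx x = 2 * (12 * ((m x + 1) * (n x + 1)))" by (simp only: Nx_def)
    then have ij: "i < 2 * (12 * ((m x + 1) * (n x + 1)))" "j < 2 * (12 * ((m x + 1) * (n x + 1)))" using i by metis+
    have "p = p' \<longleftrightarrow> even i = even j" unfolding dec(2)[OF that(1-4)] dec(2)[OF that(5-8)] using that(4,8) by auto
    then show ?thesis unfolding cnf_graph_def join_graph_def incomp_def
      using ij dec(1)[OF that(1-4)] dec(1)[OF that(5-8)]
      by (simp only: pair_pre_digraph.simps mem_Collect_eq prod.case) blast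
  qed
  define X where "X a b \<longleftrightarrow> (\<exists>p<2. \<exists>p'<2. \<exists>c<Suc (m x). \<exists>v<Suc (n x). \<exists>k<12. \<exists>c'<Suc (m x). \<exists>v'<Suc (n x). \<exists>k'<12.
      a \<noteq> b \<and> a = 2 * (slot (n x) c v * 12 + k) + p \<and> b = 2 * (slot (n x) c' v' * 12 + k') + p' \<and>
      (p \<noteq> p' \<or> (\<not> vless (lbl x c v k) (lbl x c' v' k') \<and> \<not> vless (lbl x c' v' k') (lbl x c v k))))" for a b
  have "?F \<longleftrightarrow> (\<exists>a<sz. \<exists>b<sz. i * sz + j = a * sz + b \<and> X a b)"
    unfolding edgeF_def Let_def exs.simps ands.simps fv.simps fv_derived X_def
    by (simp add: fv_incF sz_def[symmetric] less_Suc_eq_le[of _ "m x"] less_Suc_eq_le[of _ "n x"] cong: conj_cong)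
  also have "\<dots> \<longleftrightarrow> X i j"
  proof
    assume "\<exists>a<sz. \<exists>b<sz. i * sz + j = a * sz + b \<and> X a b"
    then obtain a b where "b < sz" "i * sz + j = a * sz + b" "X a b" by blast
    then show "X i j" using eq by simp
  next
    assume "X i j"
    then show "\<exists>a<sz. \<exists>b<sz. i * sz + j = a * sz + b \<and> X a b" using i unfolding sz_def by blast
  qed
  also have "\<dots> \<longleftrightarrow> (i, j) \<in> parcs (G x)"
  proof
    assume e: "(i, j) \<in> parcs (G x)"
    obtain c v k p where a: "c \<le> m x" "v \<le> n x" "k < 12" "p < 2" "i = 2 * (slot (n x) c v * 12 + k) + p"
      using ex[of i] i unfolding sz_def by blast
    obtain c' v' k' p' where b: "c' \<le> m x" "v' \<le> n x" "k' < 12" "p' < 2" "j = 2 * (slot (n x) c' v' * 12 + k') + p'"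
      using ex[of j] i unfolding sz_def by blast
    note R = parcs[OF a(5,2,3,4) b(5,2,3,4), THEN iffD1, OF e]
    show "X i j" unfolding X_def less_Suc_eq_le
      by (rule exI[of _ p], rule conjI[OF a(4)], rule exI[of _ p'], rule conjI[OF b(4)],
          rule exI[of _ c], rule conjI[OF a(1)], rule exI[of _ v], rule conjI[OF a(2)], rule exI[of _ k], rule conjI[OF a(3)],
          rule exI[of _ c'], rule conjI[OF b(1)], rule exI[of _ v'], rule conjI[OF b(2)], rule exI[of _ k'], rule conjI[OF b(3)],
          intro conjI R[THEN conjunct1] R[THEN conjunct2] a(5) b(5))
  next
    assume "X i j"
    then obtain p p' c v k c' v' k' where *: "p < 2" "p' < 2" "v \<le> n x" "k < 12" "v' \<le> n x" "k' < 12" "i \<noteq> j"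
      "i = 2 * (slot (n x) c v * 12 + k) + p" "j = 2 * (slot (n x) c' v' * 12 + k') + p'"
      "p \<noteq> p' \<or> (\<not> vless (lbl x c v k) (lbl x c' v' k') \<and> \<not> vless (lbl x c' v' k') (lbl x c v k))"
      unfolding X_def less_Suc_eq_le by (elim exE conjE)
    then show "(i, j) \<in> parcs (G x)" using parcs[OF *(8,3,4,1) *(9,5,6,2)] by blast
  qed
  finally show ?thesis .
qed

lemma graph_code_eq:
  "graph_code (G x) = map (\<lambda>i. fv x (env2 (length x) i) edgeF) [0..<tv (env2 (length x) 0) (Ti (Ti (Cn 24) NT) (Ti (Cn 24) NT))]"
proof -
  define sz where "sz = 24 * Nx x"
  have "pverts (G x) = {..<sz}" unfolding cnf_graph_def join_graph_def by (simp add: sz_def Nx_def)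
  then have c: "graph_code (G x) = concat (map (\<lambda>i. map (\<lambda>j. (i, j) \<in> parcs (G x)) [0..<sz]) [0..<sz])"
    unfolding graph_code_def Let_def by simp
  have "graph_code (G x) = map (\<lambda>i. fv x (env2 (length x) i) edgeF) [0..<sz * sz]"
  proof (rule nth_equalityI)
    show "length (graph_code (G x)) = length (map (\<lambda>i. fv x (env2 (length x) i) edgeF) [0..<sz * sz])"
      unfolding c length_concat_rows by simp
    fix l assume "l < length (graph_code (G x))"
    then have l: "l < sz * sz" unfolding c length_concat_rows .
    then have ij: "l div sz < sz" "l mod sz < sz" "l = l div sz * sz + l mod sz"
      by (auto simp: less_mult_imp_div_less) (cases "sz = 0", auto)
    have "graph_code (G x) ! l = ((l div sz, l mod sz) \<in> parcs (G x))"
      unfolding c using nth_concat_rows[OF ij(1,2), of "\<lambda>i j. (i, j) \<in> parcs (G x)"] ij(3) by metis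
    also have "\<dots> = fv x (env2 (length x) l) edgeF"
      using fv_edgeF[of "l div sz" x "l mod sz"] ij unfolding sz_def by metis
    finally show "graph_code (G x) ! l = map (\<lambda>i. fv x (env2 (length x) i) edgeF) [0..<sz * sz] ! l" using l by simp
  qed
  then show ?thesis by (simp add: sz_def)
qed

lemma polytime_graph: "polytime (\<lambda>x. graph_code (G x))"
  by (rule polytime_fo[OF _ wff_edgeF graph_code_eq]) (simp add: NT_def)

end

section \<open>Clause schemata\<close>

lemma radix_eq:
  assumes "a * b + c = a' * b + (c' :: nat)" "c < b" "c' < b"
  shows "a = a' \<and> c = c'"
proof -
  have "(a * b + c) div b = a" "(a * b + c) mod b = c" "(a' * b + c') div b = a'" "(a' * b + c') mod b = c'"
    using assms(2,3) by simp_all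
  then show ?thesis using assms(1) by metis
qed

lemma radix_ex:
  assumes "c < X * (Y :: nat)"
  shows "\<exists>a < X. \<exists>r < Y. c = a * Y + r"
proof (intro exI conjI)
  show "c div Y < X" using assms by (simp add: less_mult_imp_div_less)
  show "c mod Y < Y" using assms by (cases "Y = 0") auto
  show "c = c div Y * Y + c mod Y" by simp
qed

lemma radix_less:
  assumes "a < X" "r < Y"
  shows "a * Y + r < X * (Y :: nat)"
proof -
  have "a * Y + r < Suc a * Y" using assms by simp
  also have "\<dots> \<le> X * Y" using assms by (intro mult_le_mono1) simp
  finally show ?thesis .
qed

text \<open>
  A schema is a condition together with a list of literals, each of which consists of its sign, its
  kind and two numbers. It stands for one clause for each choice of the numbers \<open>V 32\<close>, \<open>V 33\<close>,
  \<open>V 34\<close> that satisfies the condition.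
\<close>

type_synonym 'k schema = "fm \<times> (bool \<times> 'k \<times> trm \<times> trm) list"

definition kinds :: "'k schema list \<Rightarrow> 'k set" where
  "kinds scs = (\<Union>sc \<in> set scs. (\<lambda>l. fst (snd l)) ` set (snd sc))"

definition env3 :: "bool list \<Rightarrow> nat \<Rightarrow> nat \<Rightarrow> nat \<Rightarrow> nat \<Rightarrow> nat" where
  "env3 x t i j = (\<lambda>_. 0)(0 := length x, 32 := t, 33 := i, 34 := j)"

definition csat :: "bool list \<Rightarrow> nat \<Rightarrow> ('k \<Rightarrow> nat \<Rightarrow> nat \<Rightarrow> bool) \<Rightarrow> nat \<Rightarrow> nat \<Rightarrow> nat \<Rightarrow> 'k schema \<Rightarrow> bool" where
  "csat x B val t i j sc \<longleftrightarrow> (fv x (env3 x t i j) (fst sc) \<longrightarrow> (\<exists>(s, \<kappa>, tt, ii) \<in> set (snd sc).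
    tv (env3 x t i j) tt < B \<and> tv (env3 x t i j) ii < B \<and>
    val \<kappa> (tv (env3 x t i j) tt) (tv (env3 x t i j) ii) = s))"

definition wf_schema :: "'k schema \<Rightarrow> bool" where
  "wf_schema sc \<longleftrightarrow> fvs (fst sc) \<subseteq> {0, 32, 33, 34} \<and> wff 35 (fst sc) \<and>
    (\<forall>(s, \<kappa>, tt, ii) \<in> set (snd sc). tvs tt \<subseteq> {0, 32, 33, 34} \<and> tvs ii \<subseteq> {0, 32, 33, 34})"

text \<open>The unit schema yields a variable that is true in every model. It satisfies the
  all-positive last clause demanded by the locale \<open>cnf\<close>, and also the clauses whose
  condition fails, which are turned into all-positive ones because every number below
  \<open>mT\<close> has to be a clause.\<close>

locale schemata =
  fixes scs :: "'k schema list" and bT :: trm and idx :: "'k \<Rightarrow> nat" and g :: nat and \<kappa>0 :: 'k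
  assumes bT: "tvs bT \<subseteq> {0}"
    and wf: "\<And>sc. sc \<in> set scs \<Longrightarrow> wf_schema sc"
    and unit: "(Tr, [(True, \<kappa>0, Cn 0, Cn 0)]) \<in> set scs"
    and idx: "inj_on idx (kinds scs)" "\<And>\<kappa>. \<kappa> \<in> kinds scs \<Longrightarrow> idx \<kappa> < g"
begin

definition bd :: "bool list \<Rightarrow> nat" where "bd x = tv (env3 x 0 0 0) bT"

lemma tv_bT [simp]: "e 0 = length x \<Longrightarrow> tv e bT = bd x"
  unfolding bd_def using bT by (intro tv_eq) (auto simp: env3_def)

definition nT :: trm where "nT = Ti (Ti bT bT) (Cn g)"
definition mT :: trm where "mT = Ti (Ti (Ti bT bT) bT) (Cn (length scs))"

definition litF :: "bool \<Rightarrow> (bool \<times> 'k \<times> trm \<times> trm) list \<Rightarrow> fm" where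
  "litF s ls = exs [(35, bT), (36, bT)] (Disj (map (\<lambda>(s', \<kappa>, tt, ii). ands [if s' = s then Tr else Ng Tr,
    Eq (V 31) (Pl (Ti (Pl (Ti (V 35) bT) (V 36)) (Cn g)) (Cn (idx \<kappa>))), Eq (V 35) tt, Eq (V 36) ii]) ls))"

definition clF :: "nat \<Rightarrow> fm" where
  "clF d = Eq (V 30) (Pl (Ti (Pl (Ti (Pl (Ti (V 32) bT) (V 33)) bT) (V 34)) (Cn (length scs))) (Cn d))"

definition posF :: fm where
  "posF = An (Ls (V 31) nT) (Or (Eq (V 30) mT) (exs [(32, bT), (33, bT), (34, bT)]
    (Disj (map (\<lambda>d. An (clF d) (Or (Ng (fst (scs ! d))) (litF True (snd (scs ! d))))) [0..<length scs]))))"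

definition negF :: fm where
  "negF = An (Ls (V 31) nT) (exs [(32, bT), (33, bT), (34, bT)]
    (Disj (map (\<lambda>d. An (clF d) (An (fst (scs ! d)) (litF False (snd (scs ! d))))) [0..<length scs])))"

lemma wf_nth: "d < length scs \<Longrightarrow> wf_schema (scs ! d)"
  using wf by simp

sublocale graph_formula nT mT posF negF
proof
  have [simp]: "wft d bT" if "d > 0" for d using bT that by (auto simp: wft_iff)
  show "tvs nT \<subseteq> {0}" "tvs mT \<subseteq> {0}" using bT by (auto simp: nT_def mT_def)
  have lit: "fvs (litF s (snd (scs ! d))) \<subseteq> {0, 31, 32, 33, 34}" "wff 35 (litF s (snd (scs ! d)))" if "d < length scs" for s d
  proof -
    let ?l = "\<lambda>(s', \<kappa>, tt, ii). ands [if s' = s then Tr else Ng Tr,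
      Eq (V 31) (Pl (Ti (Pl (Ti (V 35) bT) (V 36)) (Cn g)) (Cn (idx \<kappa>))), Eq (V 35) tt, Eq (V 36) ii]"
    have l: "fvs (?l l) \<subseteq> {0, 31, 32, 33, 34, 35, 36} \<and> wff 37 (?l l)" if l: "l \<in> set (snd (scs ! d))" for l
    proof -
      obtain s' \<kappa> tt ii where e: "l = (s', \<kappa>, tt, ii)" by (cases l)
      have "tvs tt \<subseteq> {0, 32, 33, 34}" "tvs ii \<subseteq> {0, 32, 33, 34}"
        using wf_nth[OF \<open>d < length scs\<close>] l e by (auto simp: wf_schema_def)
      then show ?thesis unfolding e using bT by (cases "s' = s") (auto simp: wft_iff)
    qed
    define X where "X = (\<Union>l \<in> set (snd (scs ! d)). fvs (?l l))"
    have "X \<subseteq> {0, 31, 32, 33, 34, 35, 36}" unfolding X_def by (rule UN_least) (rule l[THEN conjunct1])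
    moreover have "fvs (litF s (snd (scs ! d))) = tvs bT \<union> (tvs bT \<union> (X - {36}) - {35})"
      unfolding X_def litF_def exs.simps fvs.simps fvs_Disj set_map image_image ..
    ultimately show "fvs (litF s (snd (scs ! d))) \<subseteq> {0, 31, 32, 33, 34}" using bT by auto
    show "wff 35 (litF s (snd (scs ! d)))" using l by (simp add: litF_def)
  qed
  have cl: "fvs (clF d) \<subseteq> {0, 30, 32, 33, 34}" "wff 35 (clF d)" for d
    using bT by (auto simp: clF_def)
  have sc: "fvs (fst (scs ! d)) \<subseteq> {0, 32, 33, 34}" "wff 35 (fst (scs ! d))" if "d < length scs" for d
    using wf_nth[OF that] by (auto simp: wf_schema_def)
  have "i \<in> {0, 30, 31}" if "i \<in> fvs posF" for i
  proof -
    from that consider "i \<in> tvs nT \<union> tvs mT \<union> tvs bT \<union> {30, 31}"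
      | d where "d < length scs" "i \<in> fvs (clF d) \<union> fvs (fst (scs ! d)) \<union> fvs (litF True (snd (scs ! d)))" "i \<notin> {32, 33, 34}"
      unfolding posF_def by auto
    then show ?thesis
    proof cases
      case 1
      then show ?thesis using bT by (auto simp: nT_def mT_def)
    next
      case 2
      then show ?thesis using cl(1)[of d] sc(1)[of d] lit(1)[of d True] by blast
    qed
  qed
  then show "fvs posF \<subseteq> {0, 30, 31}" by blast
  have "i \<in> {0, 30, 31}" if "i \<in> fvs negF" for i
  proof -
    from that consider "i \<in> tvs nT \<union> tvs mT \<union> tvs bT \<union> {30, 31}"
      | d where "d < length scs" "i \<in> fvs (clF d) \<union> fvs (fst (scs ! d)) \<union> fvs (litF False (snd (scs ! d)))" "i \<notin> {32, 33, 34}"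
      unfolding negF_def by auto
    then show ?thesis
    proof cases
      case 1
      then show ?thesis using bT by (auto simp: nT_def mT_def)
    next
      case 2
      then show ?thesis using cl(1)[of d] sc(1)[of d] lit(1)[of d False] by blast
    qed
  qed
  then show "fvs negF \<subseteq> {0, 30, 31}" by blast
  show "wff 32 posF" using cl(2) sc(2) lit(2) by (simp add: posF_def nT_def mT_def)
  show "wff 32 negF" using cl(2) sc(2) lit(2) by (simp add: negF_def nT_def mT_def)
qed

lemma nx: "n x = bd x * bd x * g" and mx: "m x = bd x * bd x * bd x * length scs"
proof -
  have "tv (env (length x) 0 0) bT = bd x" by (rule tv_bT) simp
  then show "n x = bd x * bd x * g" "m x = bd x * bd x * bd x * length scs"
    unfolding n_def m_def by (simp_all add: nT_def mT_def)
qed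

definition cl :: "bool list \<Rightarrow> nat \<Rightarrow> nat \<Rightarrow> nat \<Rightarrow> nat \<Rightarrow> nat" where
  "cl x d t i j = ((t * bd x + i) * bd x + j) * length scs + d"

definition vr :: "bool list \<Rightarrow> 'k \<Rightarrow> nat \<Rightarrow> nat \<Rightarrow> nat" where
  "vr x \<kappa> t i = (t * bd x + i) * g + idx \<kappa>"

lemma cl_inj:
  assumes "cl x d t i j = cl x d' t' i' j'" "d < length scs" "d' < length scs" "i < bd x" "i' < bd x" "j < bd x" "j' < bd x"
  shows "d = d' \<and> t = t' \<and> i = i' \<and> j = j'"
  using assms radix_eq unfolding cl_def by metis

lemma cl_less: "d < length scs \<Longrightarrow> t < bd x \<Longrightarrow> i < bd x \<Longrightarrow> j < bd x \<Longrightarrow> cl x d t i j < m x"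
  unfolding cl_def mx by (intro radix_less)

lemma cl_ex:
  assumes "c < m x"
  shows "\<exists>d < length scs. \<exists>t < bd x. \<exists>i < bd x. \<exists>j < bd x. c = cl x d t i j"
  using radix_ex[OF assms[unfolded mx]] radix_ex[of _ "bd x * bd x" "bd x"] radix_ex[of _ "bd x" "bd x"]
  unfolding cl_def by metis

lemma vr_inj:
  assumes "vr x \<kappa> t i = vr x \<kappa>' t' i'" "\<kappa> \<in> kinds scs" "\<kappa>' \<in> kinds scs" "i < bd x" "i' < bd x"
  shows "\<kappa> = \<kappa>' \<and> t = t' \<and> i = i'"
  using assms radix_eq idx unfolding vr_def by (metis inj_onD)

lemma vr_less: "\<kappa> \<in> kinds scs \<Longrightarrow> t < bd x \<Longrightarrow> i < bd x \<Longrightarrow> vr x \<kappa> t i < n x"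
  unfolding vr_def nx by (intro radix_less idx)

definition holds :: "bool list \<Rightarrow> nat \<Rightarrow> nat \<Rightarrow> nat \<Rightarrow> nat \<Rightarrow> bool" where
  "holds x d t i j = fv x (env3 x t i j) (fst (scs ! d))"

definition occ :: "bool list \<Rightarrow> bool \<Rightarrow> nat \<Rightarrow> nat \<Rightarrow> nat \<Rightarrow> nat \<Rightarrow> nat \<Rightarrow> bool" where
  "occ x s d t i j v \<longleftrightarrow> (\<exists>\<kappa> tt ii. (s, \<kappa>, tt, ii) \<in> set (snd (scs ! d)) \<and>
    tv (env3 x t i j) tt < bd x \<and> tv (env3 x t i j) ii < bd x \<and>
    v = vr x \<kappa> (tv (env3 x t i j) tt) (tv (env3 x t i j) ii))"

lemma fv_litF:
  assumes "e 0 = length x" "d < length scs"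
  shows "fv x e (litF s (snd (scs ! d))) \<longleftrightarrow> occ x s d (e 32) (e 33) (e 34) (e 31)"
proof -
  have t: "tv (e(35 := a, 36 := b)) tt = tv (env3 x (e 32) (e 33) (e 34)) tt" if "tvs tt \<subseteq> {0, 32, 33, 34}" for a b tt
    using that assms by (intro tv_eq) (auto simp: env3_def)
  have sign: "fv x e (if b then Tr else Ng Tr) \<longleftrightarrow> b" for e b by simp
  have w: "tvs tt \<subseteq> {0, 32, 33, 34} \<and> tvs ii \<subseteq> {0, 32, 33, 34}" if "(s', \<kappa>, tt, ii) \<in> set (snd (scs ! d))" for s' \<kappa> tt ii
    using wf_nth[OF assms(2)] that by (auto simp: wf_schema_def)
  have "fv x e (litF s (snd (scs ! d))) \<longleftrightarrow> (\<exists>a < bd x. \<exists>b < bd x. \<exists>(s', \<kappa>, tt, ii) \<in> set (snd (scs ! d)).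
      s' = s \<and> e 31 = (a * bd x + b) * g + idx \<kappa> \<and> a = tv (e(35 := a, 36 := b)) tt \<and> b = tv (e(35 := a, 36 := b)) ii)"
    using assms unfolding litF_def by (simp add: case_prod_unfold sign)
  also have "\<dots> \<longleftrightarrow> (\<exists>a < bd x. \<exists>b < bd x. \<exists>(s', \<kappa>, tt, ii) \<in> set (snd (scs ! d)).
      s' = s \<and> e 31 = (a * bd x + b) * g + idx \<kappa> \<and> a = tv (env3 x (e 32) (e 33) (e 34)) tt \<and> b = tv (env3 x (e 32) (e 33) (e 34)) ii)"
    using t w by (intro ex_cong1 conj_cong refl bex_cong) fastforce
  also have "\<dots> \<longleftrightarrow> occ x s d (e 32) (e 33) (e 34) (e 31)"
  proof
    assume "occ x s d (e 32) (e 33) (e 34) (e 31)"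
    then obtain \<kappa> tt ii where "(s, \<kappa>, tt, ii) \<in> set (snd (scs ! d))"
      "tv (env3 x (e 32) (e 33) (e 34)) tt < bd x" "tv (env3 x (e 32) (e 33) (e 34)) ii < bd x"
      "e 31 = vr x \<kappa> (tv (env3 x (e 32) (e 33) (e 34)) tt) (tv (env3 x (e 32) (e 33) (e 34)) ii)"
      unfolding occ_def by (elim exE conjE)
    then show "\<exists>a < bd x. \<exists>b < bd x. \<exists>(s', \<kappa>, tt, ii) \<in> set (snd (scs ! d)).
      s' = s \<and> e 31 = (a * bd x + b) * g + idx \<kappa> \<and> a = tv (env3 x (e 32) (e 33) (e 34)) tt \<and> b = tv (env3 x (e 32) (e 33) (e 34)) ii"
      by (intro exI[of _ "tv (env3 x (e 32) (e 33) (e 34)) tt"] conjI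
          exI[of _ "tv (env3 x (e 32) (e 33) (e 34)) ii"] bexI[of _ "(s, \<kappa>, tt, ii)"]) (simp_all add: vr_def)
  qed (auto simp: occ_def vr_def)
  finally show ?thesis .
qed

lemma fv_sc:
  assumes "e 0 = length x" "d < length scs"
  shows "fv x e (fst (scs ! d)) \<longleftrightarrow> holds x d (e 32) (e 33) (e 34)"
  unfolding holds_def using wf_nth[OF assms(2)] assms by (intro fv_eq) (auto simp: wf_schema_def env3_def)

lemma fv_clF: "e 0 = length x \<Longrightarrow> fv x e (clF d) \<longleftrightarrow> e 30 = cl x d (e 32) (e 33) (e 34)"
  by (simp add: clF_def cl_def)

lemma Pos_iff: "Pos x c v \<longleftrightarrow> v < n x \<and> (c = m x \<or> (\<exists>t < bd x. \<exists>i < bd x. \<exists>j < bd x. \<exists>d < length scs.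
    c = cl x d t i j \<and> (\<not> holds x d t i j \<or> occ x True d t i j v)))"
  unfolding Pos_def unfolding posF_def exs.simps fv.simps fv_derived fv_Disj
  by (simp add: fv_litF fv_sc fv_clF Bex_def)

lemma Neg_iff: "Neg x c v \<longleftrightarrow> v < n x \<and> (\<exists>t < bd x. \<exists>i < bd x. \<exists>j < bd x. \<exists>d < length scs.
    c = cl x d t i j \<and> holds x d t i j \<and> occ x False d t i j v)"
  unfolding Neg_def unfolding negF_def exs.simps fv.simps fv_derived fv_Disj
  by (simp add: fv_litF fv_sc fv_clF Bex_def)

lemma cnf: "cnf (n x) (m x) (Pos x) (Neg x)"
proof
  show "\<not> Neg x (m x) v" for v
    unfolding Neg_iff using cl_less by (metis nat_neq_iff)
qed (auto simp: Pos_iff Neg_iff)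

lemma Pos_cl:
  assumes "d < length scs" "t < bd x" "i < bd x" "j < bd x"
  shows "Pos x (cl x d t i j) v \<longleftrightarrow> v < n x \<and> (\<not> holds x d t i j \<or> occ x True d t i j v)"
  unfolding Pos_iff using assms cl_inj cl_less by (metis nat_neq_iff)

lemma Neg_cl:
  assumes "d < length scs" "t < bd x" "i < bd x" "j < bd x"
  shows "Neg x (cl x d t i j) v \<longleftrightarrow> v < n x \<and> holds x d t i j \<and> occ x False d t i j v"
  unfolding Neg_iff using assms cl_inj by metis

lemma occ_kinds: "d < length scs \<Longrightarrow> (s, \<kappa>, tt, ii) \<in> set (snd (scs ! d)) \<Longrightarrow> \<kappa> \<in> kinds scs"
proof -
  assume d: "d < length scs" and l: "(s, \<kappa>, tt, ii) \<in> set (snd (scs ! d))"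
  have "\<kappa> \<in> (\<lambda>l. fst (snd l)) ` set (snd (scs ! d))" by (rule image_eqI[OF _ l]) simp
  then show ?thesis unfolding kinds_def using d by (intro UN_I[of "scs ! d"]) simp_all
qed

theorem cnf_sat_iff:
  "cnf_sat (n x) (m x) (Pos x) (Neg x) \<longleftrightarrow>
    (\<exists>val. \<forall>sc \<in> set scs. \<forall>t < bd x. \<forall>i < bd x. \<forall>j < bd x. csat x (bd x) val t i j sc) \<and> bd x > 0"
proof
  assume "cnf_sat (n x) (m x) (Pos x) (Neg x)"
  then obtain z where z: "\<And>c. c \<le> m x \<Longrightarrow> \<exists>v < n x. (Pos x c v \<and> z v) \<or> (Neg x c v \<and> \<not> z v)"
    unfolding cnf_sat_def by blast
  have "csat x (bd x) (\<lambda>\<kappa> t i. z (vr x \<kappa> t i)) t i j (scs ! d)"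
    if d: "d < length scs" "t < bd x" "i < bd x" "j < bd x" for d t i j
    unfolding csat_def
  proof
    assume h: "fv x (env3 x t i j) (fst (scs ! d))"
    then have h: "holds x d t i j" by (simp add: holds_def)
    from z[of "cl x d t i j"] cl_less[OF d] obtain v s where "occ x s d t i j v" "z v = s"
      unfolding Pos_cl[OF d] Neg_cl[OF d] using h by (metis (full_types) less_imp_le)
    then show "\<exists>(s, \<kappa>, tt, ii) \<in> set (snd (scs ! d)).
        tv (env3 x t i j) tt < bd x \<and> tv (env3 x t i j) ii < bd x \<and>
        z (vr x \<kappa> (tv (env3 x t i j) tt) (tv (env3 x t i j) ii)) = s"
      unfolding occ_def by blast
  qed
  then have "\<forall>sc \<in> set scs. \<forall>t < bd x. \<forall>i < bd x. \<forall>j < bd x. csat x (bd x) (\<lambda>\<kappa> t i. z (vr x \<kappa> t i)) t i j sc"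
    by (metis in_set_conv_nth)
  \<comment> \<open>With bound 0 there are no propositional variables, and the last clause would be
    empty.\<close>
  moreover have "bd x > 0" using z[of "m x"] by (auto simp: nx intro: gr0I)
  ultimately show "(\<exists>val. \<forall>sc \<in> set scs. \<forall>t < bd x. \<forall>i < bd x. \<forall>j < bd x. csat x (bd x) val t i j sc) \<and> bd x > 0"
    by blast
next
  assume "(\<exists>val. \<forall>sc \<in> set scs. \<forall>t < bd x. \<forall>i < bd x. \<forall>j < bd x. csat x (bd x) val t i j sc) \<and> bd x > 0"
  then obtain val where val: "\<And>sc t i j. sc \<in> set scs \<Longrightarrow> t < bd x \<Longrightarrow> i < bd x \<Longrightarrow> j < bd x \<Longrightarrow> csat x (bd x) val t i j sc"
    and pos: "bd x > 0" by blast
  define z where "z v \<longleftrightarrow> (\<exists>\<kappa> \<in> kinds scs. \<exists>t < bd x. \<exists>i < bd x. v = vr x \<kappa> t i \<and> val \<kappa> t i)" for v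
  have zv: "z (vr x \<kappa> t i) = val \<kappa> t i" if "\<kappa> \<in> kinds scs" "t < bd x" "i < bd x" for \<kappa> t i
    unfolding z_def using vr_inj that by metis
  have k0: "\<kappa>0 \<in> kinds scs" unfolding kinds_def by (rule UN_I[OF unit]) simp
  have "val \<kappa>0 0 0" using val[OF unit pos pos pos] by (simp add: csat_def)
  then have v0: "vr x \<kappa>0 0 0 < n x" "z (vr x \<kappa>0 0 0)" using zv vr_less k0 pos by auto
  have "\<exists>v < n x. (Pos x c v \<and> z v) \<or> (Neg x c v \<and> \<not> z v)" if "c \<le> m x" for c
  proof (cases "c = m x")
    case True
    then show ?thesis using v0 by (auto simp: Pos_iff)
  next
    case False
    then have "c < m x" using that by simp
    from cl_ex[OF this] obtain d t i j where d: "d < length scs" "t < bd x" "i < bd x" "j < bd x" and c: "c = cl x d t i j"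
      by (elim exE conjE)
    show ?thesis
    proof (cases "holds x d t i j")
      case False
      then show ?thesis using v0 unfolding c Pos_cl[OF d] by blast
    next
      case True
      then obtain s \<kappa> tt ii where l: "(s, \<kappa>, tt, ii) \<in> set (snd (scs ! d))"
        "tv (env3 x t i j) tt < bd x" "tv (env3 x t i j) ii < bd x"
        "val \<kappa> (tv (env3 x t i j) tt) (tv (env3 x t i j) ii) = s"
        using val[of "scs ! d" t i j] d unfolding csat_def holds_def by auto
      define v where "v = vr x \<kappa> (tv (env3 x t i j) tt) (tv (env3 x t i j) ii)"
      have "occ x s d t i j v" unfolding occ_def v_def using l by blast
      moreover have "v < n x" "z v = s" using zv vr_less occ_kinds[OF d(1) l(1)] l by (auto simp: v_def)
      ultimately show ?thesis unfolding c Pos_cl[OF d] Neg_cl[OF d] using True by (cases s) auto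
    qed
  qed
  then show "cnf_sat (n x) (m x) (Pos x) (Neg x)" unfolding cnf_sat_def by blast
qed

end

section \<open>The Cook-Levin tableau\<close>

lemma poly_mono_nat: "a \<le> b \<Longrightarrow> poly p a \<le> poly (p :: nat poly) b"
  by (induction p) (auto intro!: mult_le_mono)

lemma length_double: "length (concat (map (\<lambda>b. [b, b]) x)) = 2 * length x"
  by (induction x) auto

lemma nth_double: "i < 2 * length x \<Longrightarrow> concat (map (\<lambda>b. [b, b]) x) ! i = x ! (i div 2)"
proof (induction x arbitrary: i)
  case (Cons a x)
  consider "i = 0" | "i = 1" | j where "i = Suc (Suc j)" by (metis One_nat_def not0_implies_Suc)
  then show ?case using Cons by cases auto
qed simp

lemma length_pair_code: "length (pair_code x u) = 2 * length x + 2 + length u"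
  by (simp add: pair_code_def length_double)

lemma nth_pair_code:
  "i < 2 * length x \<Longrightarrow> pair_code x u ! i = x ! (i div 2)"
  "pair_code x u ! (2 * length x) = True"
  "pair_code x u ! Suc (2 * length x) = False"
  "pair_code x u ! (2 * length x + 2 + i) = u ! i"
  by (simp_all add: pair_code_def nth_append length_double nth_double)

lemma word_tape_nth: "i < length w \<Longrightarrow> word_tape w (int i) = (if w ! i then 2 else 1)"
  by (simp add: word_tape_def)

lemma word_tape_outside: "i < 0 \<or> int (length w) \<le> i \<Longrightarrow> word_tape w i = 0"
  by (auto simp: word_tape_def)

lemma word_tape_inject: "word_tape a = word_tape b \<Longrightarrow> a = b"
proof (rule nth_equalityI)
  assume e: "word_tape a = word_tape b"
  have i: "i < length a \<longleftrightarrow> i < length b" for i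
    using fun_cong[OF e, of "int i"] by (simp add: word_tape_def split: if_splits)
  then show "length a = length b" by (metis linorder_neq_iff)
  fix j assume "j < length a"
  then show "a ! j = b ! j" using i[of j] fun_cong[OF e, of "int j"] by (simp add: word_tape_def split: if_splits)
qed

text \<open>\<open>Sc\<close> is a scanned symbol, \<open>Vw\<close> the state together with all
  scanned symbols, and \<open>Uu\<close> marks the occupied cells of the certificate.
  \<open>Sc\<close> and \<open>Vw\<close> depend on the time only. Without them, a transition clause
  would mention the head positions of all tapes at once, more than the three numbers of a
  schema.\<close>

datatype kind = St nat | Hd nat | Ce nat nat | Sc nat nat | Vw nat "nat list" | Uu

text \<open>Idling in the halting state, so that the tableau has the same height for all
  runs.\<close>

definition del :: "tm \<Rightarrow> nat \<Rightarrow> nat list \<Rightarrow> nat \<times> (nat \<times> int) list" where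
  "del M q s = (if q < n_states M then delta M q s else (q, map (\<lambda>a. (a, 0)) s))"

section \<open>Coordinates of a run: state, heads and tape contents over time\<close>

locale run =
  fixes M :: tm and w :: "bool list"
  assumes wf: "wf_tm M"
begin

definition conf :: "nat \<Rightarrow> config" where "conf t = (step M ^^ t) (init_config M w)"
definition qs :: "nat \<Rightarrow> nat" where "qs t = fst (conf t)"
definition tp :: "nat \<Rightarrow> nat \<Rightarrow> int \<Rightarrow> nat" where "tp k t = fst (snd (conf t) ! k)"
definition hd :: "nat \<Rightarrow> nat \<Rightarrow> int" where "hd k t = snd (snd (conf t) ! k)"
definition sy :: "nat \<Rightarrow> nat \<Rightarrow> nat" where "sy k t = tp k t (hd k t)"
definition syms :: "nat \<Rightarrow> nat list" where "syms t = map (\<lambda>k. sy k t) [0..<n_tapes M]"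

lemma scanned_syms: "length (snd (conf t)) = n_tapes M \<Longrightarrow> map (\<lambda>(f, h). f h) (snd (conf t)) = syms t"
  by (rule nth_equalityI) (simp_all add: syms_def sy_def tp_def hd_def case_prod_unfold)

lemma tapes_pos: "n_tapes M \<ge> 1" "n_symbols M \<ge> 3"
  using wf by (auto simp: wf_tm_def)

lemma qs_0: "qs 0 = 0"
  by (simp add: qs_def conf_def init_config_def)

lemma hd_0: "k < n_tapes M \<Longrightarrow> hd k 0 = 0"
  by (cases k) (simp_all add: hd_def conf_def init_config_def)

lemma tp_0: "k < n_tapes M \<Longrightarrow> tp k 0 = (if k = 0 then word_tape w else (\<lambda>_. 0))"
  by (cases k) (simp_all add: tp_def conf_def init_config_def)

lemma del_wf:
  assumes "q \<le> n_states M" "length s = n_tapes M" "set s \<subseteq> {..<n_symbols M}"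
  shows "fst (del M q s) \<le> n_states M" "length (snd (del M q s)) = n_tapes M"
    "\<And>k. k < n_tapes M \<Longrightarrow> fst (snd (del M q s) ! k) < n_symbols M \<and> snd (snd (del M q s) ! k) \<in> {-1, 0, 1}"
proof -
  have *: "fst (del M q s) \<le> n_states M \<and> length (snd (del M q s)) = n_tapes M \<and>
      (\<forall>b \<in> set (snd (del M q s)). fst b < n_symbols M \<and> snd b \<in> {-1, 0, 1})"
  proof (cases "q < n_states M")
    case True
    then show ?thesis using wf assms unfolding wf_tm_def del_def by (simp add: case_prod_unfold)
  next
    case False
    then show ?thesis using assms by (auto simp: del_def)
  qed
  then show "fst (del M q s) \<le> n_states M" "length (snd (del M q s)) = n_tapes M" by auto
  show "fst (snd (del M q s) ! k) < n_symbols M \<and> snd (snd (del M q s) ! k) \<in> {-1, 0, 1}" if "k < n_tapes M" for k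
    using * that nth_mem[of k "snd (del M q s)"] by metis
qed

lemma conf_Suc:
  assumes "length (snd (conf t)) = n_tapes M" "length (snd (del M (qs t) (syms t))) = n_tapes M"
  shows "conf (Suc t) = (fst (del M (qs t) (syms t)), map2 act_on_tape (snd (del M (qs t) (syms t))) (snd (conf t)))"
proof -
  obtain q ts where c: "conf t = (q, ts)" by fastforce
  have s: "map (\<lambda>(f, h). f h) ts = syms t" using scanned_syms[OF assms(1)] c by simp
  have "map2 act_on_tape (map (\<lambda>a. (a, 0)) (map (\<lambda>(f, h). f h) ts)) ts = ts"
    by (induction ts) auto
  then have k: "map2 act_on_tape (map (\<lambda>a. (a, 0)) (syms t)) ts = ts" unfolding s .
  have "step M (q, ts) = (fst (del M q (syms t)), map2 act_on_tape (snd (del M q (syms t))) ts)"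
    unfolding step.simps s using k by (cases "q < n_states M") (simp_all add: del_def split: prod.split)
  then show ?thesis using c by (simp add: conf_def qs_def)
qed

lemma inv: "qs t \<le> n_states M \<and> length (snd (conf t)) = n_tapes M \<and>
  (\<forall>k < n_tapes M. (\<forall>i. tp k t i < n_symbols M) \<and> \<bar>hd k t\<bar> \<le> int t)"
proof (induction t)
  case 0
  have "length (snd (conf 0)) = n_tapes M" using tapes_pos by (simp add: conf_def init_config_def)
  moreover have "qs 0 \<le> n_states M" by (simp add: qs_def conf_def init_config_def)
  ultimately show ?case using hd_0 tp_0 tapes_pos by (auto simp: word_tape_def)
next
  case (Suc t)
  have s: "length (syms t) = n_tapes M" "set (syms t) \<subseteq> {..<n_symbols M}"
    using Suc by (auto simp: syms_def sy_def)
  note d = del_wf[OF _ s, of "qs t"]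
  have c: "conf (Suc t) = (fst (del M (qs t) (syms t)), map2 act_on_tape (snd (del M (qs t) (syms t))) (snd (conf t)))"
    using Suc d by (intro conf_Suc) auto
  have k: "tp k (Suc t) = (tp k t)(hd k t := fst (snd (del M (qs t) (syms t)) ! k)) \<and>
      hd k (Suc t) = hd k t + snd (snd (del M (qs t) (syms t)) ! k)" if "k < n_tapes M" for k
  proof -
    have "snd (conf (Suc t)) ! k = act_on_tape (snd (del M (qs t) (syms t)) ! k) (snd (conf t) ! k)"
      using c that Suc d by simp
    moreover have "snd (conf t) ! k = (tp k t, hd k t)" by (simp add: tp_def hd_def)
    ultimately show ?thesis
      by (cases "snd (del M (qs t) (syms t)) ! k") (simp add: tp_def[of k "Suc t"] hd_def[of k "Suc t"])
  qed
  show ?case using Suc c d k by (fastforce simp: qs_def)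
qed

lemma syms_wf: "length (syms t) = n_tapes M" "set (syms t) \<subseteq> {..<n_symbols M}"
  using inv[of t] by (auto simp: syms_def sy_def)

lemma conf_Suc': "conf (Suc t) = (fst (del M (qs t) (syms t)), map2 act_on_tape (snd (del M (qs t) (syms t))) (snd (conf t)))"
  using inv[of t] del_wf[OF _ syms_wf, of "qs t"] by (intro conf_Suc) auto

lemma qs_Suc: "qs (Suc t) = fst (del M (qs t) (syms t))"
  using conf_Suc'[of t] by (simp add: qs_def)

lemma tape_Suc:
  assumes "k < n_tapes M"
  shows "tp k (Suc t) = (tp k t)(hd k t := fst (snd (del M (qs t) (syms t)) ! k))"
    "hd k (Suc t) = hd k t + snd (snd (del M (qs t) (syms t)) ! k)"
proof -
  have "snd (conf (Suc t)) ! k = act_on_tape (snd (del M (qs t) (syms t)) ! k) (snd (conf t) ! k)"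
    using conf_Suc'[of t] assms inv[of t] del_wf[OF _ syms_wf, of "qs t"] by simp
  moreover have "snd (conf t) ! k = (tp k t, hd k t)" by (simp add: tp_def hd_def)
  ultimately show "tp k (Suc t) = (tp k t)(hd k t := fst (snd (del M (qs t) (syms t)) ! k))"
    "hd k (Suc t) = hd k t + snd (snd (del M (qs t) (syms t)) ! k)"
    by (cases "snd (del M (qs t) (syms t)) ! k"; simp add: tp_def[of k "Suc t"] hd_def[of k "Suc t"])+
qed

lemma tp_far: "k < n_tapes M \<Longrightarrow> \<bar>i\<bar> > int t \<Longrightarrow> tp k t i = tp k 0 i"
proof (induction t)
  case (Suc t)
  then have "i \<noteq> hd k t" using inv[of t] by auto
  then show ?case using Suc tape_Suc(1)[OF Suc.prems(1), of t] by simp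
qed simp

lemma output_tape:
  assumes "outputs_within M w y t" "t \<le> T"
  shows "tp (n_tapes M - 1) T = word_tape y"
proof -
  obtain ts where c: "conf t = (n_states M, ts)" "fst (last ts) = word_tape y"
    using assms(1) unfolding outputs_within_def conf_def by (auto split: prod.splits)
  have "(step M ^^ s) (n_states M, ts) = (n_states M, ts)" for s by (induction s) auto
  moreover have "conf T = (step M ^^ (T - t)) (conf t)"
    using assms(2) unfolding conf_def by (metis comp_apply funpow_add le_add_diff_inverse2)
  ultimately have "conf T = (n_states M, ts)" using c by simp
  moreover from this have "length ts = n_tapes M" using inv[of T] by simp
  then have "ts \<noteq> []" using tapes_pos by auto
  ultimately show ?thesis using c(2) \<open>length ts = n_tapes M\<close> by (simp add: tp_def last_conv_nth)
qed

end

section \<open>The clauses of the tableau\<close>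

locale tableau =
  fixes M :: tm and pc pq :: "nat poly"
  assumes wf: "wf_tm M"
begin

abbreviation "K \<equiv> n_tapes M"
abbreviation "A \<equiv> n_symbols M"
abbreviation "ns \<equiv> n_states M"

text \<open>\<open>Len\<close> bounds the length of the verifier's input and \<open>Tm\<close> its
  running time. Heads may move \<open>Tm x\<close> cells to the left, so position \<open>i\<close>
  of the tableau stands for cell \<open>i - Tm x\<close> of the tape. The certificate begins at
  position \<open>cert x\<close>.\<close>

definition Len :: "bool list \<Rightarrow> nat" where "Len x = 2 * length x + 2 + poly pc (length x)"
definition Tm :: "bool list \<Rightarrow> nat" where "Tm x = poly pq (Len x)"
definition Bd :: "bool list \<Rightarrow> nat" where "Bd x = 2 * Tm x + Len x + 2"
definition cert :: "bool list \<Rightarrow> nat" where "cert x = Tm x + 2 * length x + 2"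

definition pT :: trm where "pT = ptrm pc (V 0)"
definition lenT :: trm where "lenT = Pl (Pl (Ti (Cn 2) (V 0)) (Cn 2)) pT"
definition tT :: trm where "tT = ptrm pq lenT"
definition bT :: trm where "bT = Pl (Pl (Ti (Cn 2) tT) lenT) (Cn 2)"
definition certT :: trm where "certT = Pl (Pl tT (Ti (Cn 2) (V 0))) (Cn 2)"

lemma tv_terms [simp]:
  "e 0 = length x \<Longrightarrow> tv e pT = poly pc (length x)" "e 0 = length x \<Longrightarrow> tv e lenT = Len x"
  "e 0 = length x \<Longrightarrow> tv e tT = Tm x" "e 0 = length x \<Longrightarrow> tv e bT = Bd x" "e 0 = length x \<Longrightarrow> tv e certT = cert x"
  by (simp_all add: pT_def lenT_def tT_def bT_def certT_def Len_def Tm_def Bd_def cert_def)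

lemma tvs_terms: "tvs pT \<subseteq> {0}" "tvs lenT \<subseteq> {0}" "tvs tT \<subseteq> {0}" "tvs bT \<subseteq> {0}" "tvs certT \<subseteq> {0}"
proof -
  show 1: "tvs pT \<subseteq> {0}" using tvs_ptrm[of pc "V 0"] by (simp add: pT_def)
  then show 2: "tvs lenT \<subseteq> {0}" by (auto simp: lenT_def)
  show 3: "tvs tT \<subseteq> {0}" using tvs_ptrm[of pq lenT] 2 by (auto simp: tT_def)
  show "tvs bT \<subseteq> {0}" "tvs certT \<subseteq> {0}" using 1 2 3 by (auto simp: bT_def certT_def)
qed

text \<open>Position \<open>V 33\<close> holds one of the two copies of the input bit
  \<open>V 37\<close>, since \<open>pair_code\<close> doubles the bits.\<close>

definition cellF :: "fm \<Rightarrow> fm" where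
  "cellF \<phi> = Ex 37 (V 0) (An (Or (Eq (V 33) (Pl tT (Ti (Cn 2) (V 37)))) (Eq (V 33) (Pl tT (Pl (Ti (Cn 2) (V 37)) (Cn 1))))) \<phi>)"

definition views :: "(nat \<times> nat list) list" where
  "views = concat (map (\<lambda>q. map (\<lambda>s. (q, s)) (List.n_lists K [0..<A])) [0..<Suc ns])"

lemma set_views: "(q, s) \<in> set views \<longleftrightarrow> q \<le> ns \<and> length s = K \<and> set s \<subseteq> {..<A}"
  by (auto simp: views_def set_n_lists less_Suc_eq_le subset_eq simp del: upt_Suc)

abbreviation Po :: "kind \<Rightarrow> trm \<Rightarrow> trm \<Rightarrow> bool \<times> kind \<times> trm \<times> trm" where "Po \<kappa> t i \<equiv> (True, \<kappa>, t, i)"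
abbreviation Ne :: "kind \<Rightarrow> trm \<Rightarrow> trm \<Rightarrow> bool \<times> kind \<times> trm \<times> trm" where "Ne \<kappa> t i \<equiv> (False, \<kappa>, t, i)"
abbreviation Z :: trm where "Z \<equiv> Cn 0"
abbreviation t1 :: trm where "t1 \<equiv> Pl (V 32) (Cn 1)"
abbreviation i1 :: trm where "i1 \<equiv> Pl (V 33) (Cn 1)"

definition move :: "nat \<Rightarrow> nat list \<Rightarrow> nat \<Rightarrow> int" where "move q s k = snd (snd (del M q s) ! k)"
definition wr :: "nat \<Rightarrow> nat list \<Rightarrow> nat \<Rightarrow> nat" where "wr q s k = fst (snd (del M q s) ! k)"

definition init_scs :: "kind schema list" where
  "init_scs = [(Tr, [Po (St 0) Z Z])] @ map (\<lambda>k. (Tr, [Po (Hd k) Z tT])) [0..<K] @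
    map (\<lambda>k. (Tr, [Po (Ce k 0) Z (V 33)])) [1..<K]"

text \<open>The certificate is the only free choice: an occupied cell of its area carries a bit, the
  other cells are blank, and the occupied cells form an initial segment.\<close>

definition input_scs :: "kind schema list" where
  "input_scs = [(Ls (V 33) tT, [Po (Ce 0 0) Z (V 33)]),
    (cellF (Bt (V 37)), [Po (Ce 0 2) Z (V 33)]),
    (cellF (Ng (Bt (V 37))), [Po (Ce 0 1) Z (V 33)]),
    (Tr, [Po (Ce 0 2) Z (Pl tT (Ti (Cn 2) (V 0)))]),
    (Tr, [Po (Ce 0 1) Z (Pl tT (Pl (Ti (Cn 2) (V 0)) (Cn 1)))]),
    (Ls (V 33) pT, [Ne Uu Z (V 33), Po (Ce 0 1) Z (Pl certT (V 33)), Po (Ce 0 2) Z (Pl certT (V 33))]),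
    (Ls (V 33) pT, [Po Uu Z (V 33), Po (Ce 0 0) Z (Pl certT (V 33))]),
    (Ls i1 pT, [Ne Uu Z i1, Po Uu Z (V 33)]),
    (Ng (Ls (V 33) (Pl certT pT)), [Po (Ce 0 0) Z (V 33)])]"

definition scan_scs :: "kind schema list" where
  "scan_scs = concat (map (\<lambda>k. map (\<lambda>a.
      (Tr, [Ne (Hd k) (V 32) (V 33), Ne (Ce k a) (V 32) (V 33), Po (Sc k a) (V 32) Z])) [0..<A]) [0..<K])"

definition view_scs :: "kind schema list" where
  "view_scs = map (\<lambda>(q, s). (Tr, [Ne (St q) (V 32) Z] @ map (\<lambda>k. Ne (Sc k (s ! k)) (V 32) Z) [0..<K] @ [Po (Vw q s) (V 32) Z])) views"

definition state_scs :: "kind schema list" where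
  "state_scs = map (\<lambda>(q, s). (Ls (V 32) tT, [Ne (Vw q s) (V 32) Z, Po (St (fst (del M q s))) t1 Z])) views"

text \<open>\<open>V 33\<close> is the smaller one of the old and the new head position, which
  avoids subtraction: for a move to the left the old position is one more, for a move to the right
  the new one.\<close>

definition head_scs :: "kind schema list" where
  "head_scs = concat (map (\<lambda>(q, s). map (\<lambda>k. (An (Ls (V 32) tT) (Ls i1 bT),
    [Ne (Vw q s) (V 32) Z, Ne (Hd k) (V 32) (Pl (V 33) (Cn (if move q s k = -1 then 1 else 0))),
     Po (Hd k) t1 (Pl (V 33) (Cn (if move q s k = 1 then 1 else 0)))])) [0..<K]) views)"

definition write_scs :: "kind schema list" where
  "write_scs = concat (map (\<lambda>(q, s). map (\<lambda>k. (Ls (V 32) tT,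
    [Ne (Vw q s) (V 32) Z, Ne (Hd k) (V 32) (V 33), Po (Ce k (wr q s k)) t1 (V 33)])) [0..<K]) views)"

definition frame_scs :: "kind schema list" where
  "frame_scs = concat (map (\<lambda>k. map (\<lambda>a. (An (Ls (V 32) tT) (Ng (Eq (V 33) (V 34))),
    [Ne (Hd k) (V 32) (V 34), Ne (Ce k a) (V 32) (V 33), Po (Ce k a) t1 (V 33)])) [0..<A]) [0..<K])"

text \<open>The output is \<open>[True]\<close>: symbol 2 in cell 0, which is position
  \<open>tT\<close>, and blanks elsewhere. Forbidding the other symbols is enough, because the
  symbol actually present is forced to be true.\<close>

definition final_scs :: "kind schema list" where
  "final_scs = map (\<lambda>a. (Ng (Eq (V 33) tT), [Ne (Ce (K - 1) a) tT (V 33)])) (filter (\<lambda>a. a \<noteq> 0) [0..<A]) @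
    map (\<lambda>a. (Tr, [Ne (Ce (K - 1) a) tT tT])) (filter (\<lambda>a. a \<noteq> 2) [0..<A])"

definition scs :: "kind schema list" where
  "scs = init_scs @ input_scs @ scan_scs @ view_scs @ state_scs @ head_scs @ write_scs @ frame_scs @ final_scs"

lemma wf_scs: "sc \<in> set scs \<Longrightarrow> wf_schema sc"
proof -
  have [simp]: "wft d pT" "wft d tT" "wft d bT" "wft d certT" if "d > 0" for d
    using tvs_terms that by (auto simp: wft_iff)
  have t: "\<And>y. y \<in> tvs pT \<Longrightarrow> y = 0" "\<And>y. y \<in> tvs tT \<Longrightarrow> y = 0" "\<And>y. y \<in> tvs bT \<Longrightarrow> y = 0"
    "\<And>y. y \<in> tvs certT \<Longrightarrow> y = 0"
    using tvs_terms by auto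
  have "wf_schema sc" if "sc \<in> set init_scs \<union> set input_scs" for sc
    using that by (auto simp: init_scs_def input_scs_def wf_schema_def cellF_def dest!: t)
  moreover have "wf_schema sc" if "sc \<in> set scan_scs \<union> set view_scs \<union> set state_scs" for sc
    using that by (auto simp: scan_scs_def view_scs_def state_scs_def wf_schema_def dest!: t)
  moreover have "wf_schema sc" if "sc \<in> set head_scs \<union> set write_scs \<union> set frame_scs \<union> set final_scs" for sc
    using that by (auto simp: head_scs_def write_scs_def frame_scs_def final_scs_def wf_schema_def dest!: t)
  ultimately show "sc \<in> set scs \<Longrightarrow> wf_schema sc" unfolding scs_def set_append Un_iff by blast
qed

lemma scs_subset: "set scan_scs \<subseteq> set scs" "set view_scs \<subseteq> set scs" "set state_scs \<subseteq> set scs"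
  "set head_scs \<subseteq> set scs" "set write_scs \<subseteq> set scs" "set frame_scs \<subseteq> set scs"
  by (auto simp: scs_def)

lemma bounds: "Tm x < Bd x" "0 < Bd x" "cert x + poly pc (length x) < Bd x" "Tm x + Len x < Bd x"
  by (simp_all add: Bd_def cert_def Len_def)

text \<open>The schemata with terms and ranges evaluated. A model may make more variables true than
  a run does, for instance several symbols in one cell.\<close>

definition model :: "bool list \<Rightarrow> (kind \<Rightarrow> nat \<Rightarrow> nat \<Rightarrow> bool) \<Rightarrow> bool" where
  "model x val \<longleftrightarrow> (let T = Tm x; B = Bd x; pb = poly pc (length x); n = length x in
    val (St 0) 0 0 \<and> (\<forall>k < K. val (Hd k) 0 T) \<and> (\<forall>k < K. \<forall>i < B. 1 \<le> k \<longrightarrow> val (Ce k 0) 0 i) \<and>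
    (\<forall>i < T. val (Ce 0 0) 0 i) \<and>
    (\<forall>y < n. \<forall>b < 2. val (Ce 0 (if x ! y then 2 else 1)) 0 (T + 2 * y + b)) \<and>
    val (Ce 0 2) 0 (T + 2 * n) \<and> val (Ce 0 1) 0 (T + 2 * n + 1) \<and>
    (\<forall>i < pb. val Uu 0 i \<longrightarrow> val (Ce 0 1) 0 (cert x + i) \<or> val (Ce 0 2) 0 (cert x + i)) \<and>
    (\<forall>i < pb. val Uu 0 i \<or> val (Ce 0 0) 0 (cert x + i)) \<and>
    (\<forall>i. i + 1 < pb \<longrightarrow> val Uu 0 (i + 1) \<longrightarrow> val Uu 0 i) \<and>
    (\<forall>i < B. cert x + pb \<le> i \<longrightarrow> val (Ce 0 0) 0 i) \<and>
    (\<forall>t < B. \<forall>i < B. \<forall>k < K. \<forall>a < A. val (Hd k) t i \<longrightarrow> val (Ce k a) t i \<longrightarrow> val (Sc k a) t 0) \<and>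
    (\<forall>t < B. \<forall>(q, s) \<in> set views. val (St q) t 0 \<longrightarrow> (\<forall>k < K. val (Sc k (s ! k)) t 0) \<longrightarrow> val (Vw q s) t 0) \<and>
    (\<forall>t < T. \<forall>(q, s) \<in> set views. val (Vw q s) t 0 \<longrightarrow> val (St (fst (del M q s))) (t + 1) 0 \<and>
      (\<forall>k < K. \<forall>i. i + 1 < B \<longrightarrow> val (Hd k) t (i + (if move q s k = -1 then 1 else 0)) \<longrightarrow>
        val (Hd k) (t + 1) (i + (if move q s k = 1 then 1 else 0))) \<and>
      (\<forall>k < K. \<forall>i < B. val (Hd k) t i \<longrightarrow> val (Ce k (wr q s k)) (t + 1) i)) \<and>
    (\<forall>t < T. \<forall>i < B. \<forall>j < B. i \<noteq> j \<longrightarrow> (\<forall>k < K. \<forall>a < A. val (Hd k) t j \<longrightarrow> val (Ce k a) t i \<longrightarrow> val (Ce k a) (t + 1) i)) \<and>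
    (\<forall>i < B. i \<noteq> T \<longrightarrow> (\<forall>a < A. a \<noteq> 0 \<longrightarrow> \<not> val (Ce (K - 1) a) T i)) \<and> (\<forall>a < A. a \<noteq> 2 \<longrightarrow> \<not> val (Ce (K - 1) a) T T))"

lemma sat_model:
  assumes S: "\<And>sc t i j. sc \<in> set scs \<Longrightarrow> t < Bd x \<Longrightarrow> i < Bd x \<Longrightarrow> j < Bd x \<Longrightarrow> csat x (Bd x) val t i j sc"
  shows "model x val"
proof -
  note b = bounds[of x]
  note ev = csat_def env3_def scs_def
  have init: "val (St 0) 0 0" "\<And>k. k < K \<Longrightarrow> val (Hd k) 0 (Tm x)"
    "\<And>k i. k < K \<Longrightarrow> i < Bd x \<Longrightarrow> 1 \<le> k \<Longrightarrow> val (Ce k 0) 0 i"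
    using S[of "(Tr, [Po (St 0) Z Z])" 0 0 0] S[of "(Tr, [Po (Hd _) Z tT])" 0 0 0] S[of "(Tr, [Po (Ce _ 0) Z (V 33)])" 0 _ 0] b
    by (simp_all add: ev init_scs_def image_iff)
  have in1: "val (Ce 0 0) 0 i" if "i < Tm x" for i
    using S[of "(Ls (V 33) tT, [Po (Ce 0 0) Z (V 33)])" 0 i 0] b that by (simp add: ev input_scs_def)
  have in2: "val (Ce 0 (if x ! y then 2 else 1)) 0 (Tm x + 2 * y + c)" if "y < length x" "c < 2" for y c
  proof -
    let ?i = "Tm x + 2 * y + c"
    have i: "?i < Bd x" using that b by (simp add: Bd_def Len_def)
    have f: "fv x (env3 x 0 ?i 0) (cellF \<phi>)" if "fv x ((env3 x 0 ?i 0)(37 := y)) \<phi>" for \<phi>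
      using that \<open>y < length x\<close> \<open>c < 2\<close> unfolding cellF_def
      by (auto simp: env3_def less_2_cases_iff intro!: exI[of _ y])
    show ?thesis
    proof (cases "x ! y")
      case True
      have "csat x (Bd x) val 0 ?i 0 (cellF (Bt (V 37)), [Po (Ce 0 2) Z (V 33)])"
        by (rule S) (use i b in \<open>auto simp: scs_def input_scs_def\<close>)
      then show ?thesis using f[of "Bt (V 37)"] True that by (simp add: csat_def) (simp add: env3_def)
    next
      case False
      have "csat x (Bd x) val 0 ?i 0 (cellF (Ng (Bt (V 37))), [Po (Ce 0 1) Z (V 33)])"
        by (rule S) (use i b in \<open>auto simp: scs_def input_scs_def\<close>)
      then show ?thesis using f[of "Ng (Bt (V 37))"] False that by (simp add: csat_def) (simp add: env3_def)
    qed
  qed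
  have in3: "val (Ce 0 2) 0 (Tm x + 2 * length x)" "val (Ce 0 1) 0 (Tm x + 2 * length x + 1)"
    using S[of "(Tr, [Po (Ce 0 2) Z (Pl tT (Ti (Cn 2) (V 0)))])" 0 0 0]
      S[of "(Tr, [Po (Ce 0 1) Z (Pl tT (Pl (Ti (Cn 2) (V 0)) (Cn 1)))])" 0 0 0] b
    by (simp_all add: ev input_scs_def add.assoc)
  have in4: "val (Ce 0 1) 0 (cert x + i) \<or> val (Ce 0 2) 0 (cert x + i)" if "i < poly pc (length x)" "val Uu 0 i" for i
    using S[of "(Ls (V 33) pT, [Ne Uu Z (V 33), Po (Ce 0 1) Z (Pl certT (V 33)), Po (Ce 0 2) Z (Pl certT (V 33))])" 0 i 0] b that
    by (auto simp: ev input_scs_def)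
  have in5: "val Uu 0 i \<or> val (Ce 0 0) 0 (cert x + i)" if "i < poly pc (length x)" for i
    using S[of "(Ls (V 33) pT, [Po Uu Z (V 33), Po (Ce 0 0) Z (Pl certT (V 33))])" 0 i 0] b that
    by (auto simp: ev input_scs_def)
  have in6: "val Uu 0 i" if "i + 1 < poly pc (length x)" "val Uu 0 (i + 1)" for i
    using S[of "(Ls i1 pT, [Ne Uu Z i1, Po Uu Z (V 33)])" 0 i 0] b that
    by (auto simp: ev input_scs_def)
  have in7: "val (Ce 0 0) 0 i" if "i < Bd x" "cert x + poly pc (length x) \<le> i" for i
    using S[of "(Ng (Ls (V 33) (Pl certT pT)), [Po (Ce 0 0) Z (V 33)])" 0 i 0] b that
    by (auto simp: ev input_scs_def)
  have sc: "val (Sc k a) t 0" if "t < Bd x" "i < Bd x" "k < K" "a < A" "val (Hd k) t i" "val (Ce k a) t i" for t i k a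
  proof -
    have "(Tr, [Ne (Hd k) (V 32) (V 33), Ne (Ce k a) (V 32) (V 33), Po (Sc k a) (V 32) Z]) \<in> set scan_scs"
      unfolding scan_scs_def set_concat set_map image_image using that
      by (intro UN_I[of k] image_eqI[of _ _ a]) auto
    from S[OF subsetD[OF scs_subset(1) this] that(1,2) b(2)] show ?thesis using that b by (auto simp: csat_def env3_def)
  qed
  have vw: "val (Vw q s) t 0" if "t < Bd x" "(q, s) \<in> set views" "val (St q) t 0" "\<forall>k < K. val (Sc k (s ! k)) t 0" for t q s
  proof -
    have "(Tr, [Ne (St q) (V 32) Z] @ map (\<lambda>k. Ne (Sc k (s ! k)) (V 32) Z) [0..<K] @ [Po (Vw q s) (V 32) Z]) \<in> set view_scs"
      unfolding view_scs_def set_map using that(2) by (intro image_eqI[of _ _ "(q, s)"]) auto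
    from S[OF subsetD[OF scs_subset(2) this] that(1) b(2) b(2)] show ?thesis using that b by (auto simp: csat_def env3_def)
  qed
  have tr: "val (St (fst (del M q s))) (t + 1) 0"
    "\<And>k i. k < K \<Longrightarrow> i + 1 < Bd x \<Longrightarrow> val (Hd k) t (i + (if move q s k = -1 then 1 else 0)) \<Longrightarrow>
        val (Hd k) (t + 1) (i + (if move q s k = 1 then 1 else 0))"
    "\<And>k i. k < K \<Longrightarrow> i < Bd x \<Longrightarrow> val (Hd k) t i \<Longrightarrow> val (Ce k (wr q s k)) (t + 1) i"
    if t: "t < Tm x" "(q, s) \<in> set views" "val (Vw q s) t 0" for t q s
  proof -
    have tB: "t < Bd x" "t + 1 < Bd x" using t b by (auto simp: Bd_def)
    have "(Ls (V 32) tT, [Ne (Vw q s) (V 32) Z, Po (St (fst (del M q s))) t1 Z]) \<in> set state_scs"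
      unfolding state_scs_def set_map using t(2) by (intro image_eqI[of _ _ "(q, s)"]) auto
    from S[OF subsetD[OF scs_subset(3) this] tB(1) b(2) b(2)] show "val (St (fst (del M q s))) (t + 1) 0"
      using t tB b by (auto simp: csat_def env3_def)
  next
    fix k i assume k: "k < K" "i + 1 < Bd x" "val (Hd k) t (i + (if move q s k = -1 then 1 else 0))"
    have tB: "t < Bd x" "t + 1 < Bd x" "i < Bd x" using t k b by (auto simp: Bd_def)
    have "(An (Ls (V 32) tT) (Ls i1 bT),
    [Ne (Vw q s) (V 32) Z, Ne (Hd k) (V 32) (Pl (V 33) (Cn (if move q s k = -1 then 1 else 0))),
     Po (Hd k) t1 (Pl (V 33) (Cn (if move q s k = 1 then 1 else 0)))]) \<in> set head_scs"
      using t(2) k(1) unfolding head_scs_def set_concat set_map image_image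
      by (intro UN_I[of "(q, s)"]) (auto intro!: image_eqI[of _ _ k])
    from S[OF subsetD[OF scs_subset(4) this] tB(1,3) b(2)] show "val (Hd k) (t + 1) (i + (if move q s k = 1 then 1 else 0))"
      using t tB b k by (auto simp: csat_def env3_def split: if_splits)
  next
    fix k i assume k: "k < K" "i < Bd x" "val (Hd k) t i"
    have tB: "t < Bd x" "t + 1 < Bd x" using t k b by (auto simp: Bd_def)
    have "(Ls (V 32) tT, [Ne (Vw q s) (V 32) Z, Ne (Hd k) (V 32) (V 33), Po (Ce k (wr q s k)) t1 (V 33)]) \<in> set write_scs"
      using t(2) k(1) unfolding write_scs_def set_concat set_map image_image
      by (intro UN_I[of "(q, s)"]) (auto intro!: image_eqI[of _ _ k])
    from S[OF subsetD[OF scs_subset(5) this] tB(1) k(2) b(2)] show "val (Ce k (wr q s k)) (t + 1) i"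
      using t tB b k by (auto simp: csat_def env3_def)
  qed
  have fr: "val (Ce k a) (t + 1) i" if "t < Tm x" "i < Bd x" "j < Bd x" "i \<noteq> j" "k < K" "a < A" "val (Hd k) t j" "val (Ce k a) t i" for t i j k a
  proof -
    have tB: "t < Bd x" "t + 1 < Bd x" using that b by (auto simp: Bd_def)
    have "(An (Ls (V 32) tT) (Ng (Eq (V 33) (V 34))),
      [Ne (Hd k) (V 32) (V 34), Ne (Ce k a) (V 32) (V 33), Po (Ce k a) t1 (V 33)]) \<in> set frame_scs"
      unfolding frame_scs_def set_concat set_map image_image using that
      by (intro UN_I[of k] image_eqI[of _ _ a]) auto
    from S[OF subsetD[OF scs_subset(6) this] tB(1) that(2,3)] show ?thesis
      using that tB b by (auto simp: csat_def env3_def)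
  qed
  have fi: "\<not> val (Ce (K - 1) a) (Tm x) i" if "i < Bd x" "i \<noteq> Tm x" "a < A" "a \<noteq> 0" for i a
    using S[of "(Ng (Eq (V 33) tT), [Ne (Ce (K - 1) a) tT (V 33)])" 0 i 0] b that by (auto simp: ev final_scs_def)
  have fi2: "\<not> val (Ce (K - 1) a) (Tm x) (Tm x)" if "a < A" "a \<noteq> 2" for a
    using S[of "(Tr, [Ne (Ce (K - 1) a) tT tT])" 0 0 0] b that by (auto simp: ev final_scs_def)
  show ?thesis unfolding model_def Let_def
  proof (intro conjI allI impI ballI, goal_cases)
    case 1
    show ?case by (rule init(1))
  next
    case (2 k)
    then show ?case by (rule init(2))
  next
    case (3 k i)
    then show ?case by (rule init(3))
  next
    case (4 i)
    then show ?case by (rule in1)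
  next
    case (5 y c)
    then show ?case by (rule in2)
  next
    case 6
    show ?case by (rule in3(1))
  next
    case 7
    show ?case by (rule in3(2))
  next
    case (8 i)
    then show ?case by (rule in4)
  next
    case (9 i)
    then show ?case by (rule in5)
  next
    case (10 i)
    then show ?case by (rule in6)
  next
    case (11 i)
    then show ?case by (rule in7)
  next
    case (12 t i k a)
    then show ?case by (rule sc)
  next
    case (15 t i j k a)
    then show ?case by (rule fr)
  next
    case (16 i a)
    then show ?case by (rule fi)
  next
    case (17 a)
    then show ?case by (rule fi2)
  next
    case (13 t qs)
    then show ?case using vw by (cases qs) auto
  next
    case (14 t qs)
    then show ?case using tr by (cases qs) auto
  qed
qed

lemma model_sat:
  assumes m: "model x val" and sc: "sc \<in> set scs" and tij: "t < Bd x" "i < Bd x" "j < Bd x"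
  shows "csat x (Bd x) val t i j sc"
proof -
  note b = bounds[of x]
  note ev = csat_def env3_def
  note m' = m[unfolded model_def Let_def]
  note M1 = m'[THEN conjunct1] and R1 = m'[THEN conjunct2]
  note M2 = R1[THEN conjunct1] and R2 = R1[THEN conjunct2]
  note M3 = R2[THEN conjunct1] and R3 = R2[THEN conjunct2]
  note M4 = R3[THEN conjunct1] and R4 = R3[THEN conjunct2]
  note M5 = R4[THEN conjunct1] and R5 = R4[THEN conjunct2]
  note M6 = R5[THEN conjunct1] and R6 = R5[THEN conjunct2]
  note M7 = R6[THEN conjunct1] and R7 = R6[THEN conjunct2]
  note M8 = R7[THEN conjunct1] and R8 = R7[THEN conjunct2]
  note M9 = R8[THEN conjunct1] and R9 = R8[THEN conjunct2]
  note M10 = R9[THEN conjunct1] and R10 = R9[THEN conjunct2]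
  note M11 = R10[THEN conjunct1] and R11 = R10[THEN conjunct2]
  note M12 = R11[THEN conjunct1] and R12 = R11[THEN conjunct2]
  note M13 = R12[THEN conjunct1] and R13 = R12[THEN conjunct2]
  note M14 = R13[THEN conjunct1] and R14 = R13[THEN conjunct2]
  note M15 = R14[THEN conjunct1] and R15 = R14[THEN conjunct2]
  note M16 = R15[THEN conjunct1] and R16 = R15[THEN conjunct2]
  note M17 = R16
  have t: "t + 1 < Bd x" if "t < Tm x" using that b by (simp add: Bd_def)
  consider "sc \<in> set init_scs" | "sc \<in> set input_scs" | "sc \<in> set scan_scs" | "sc \<in> set view_scs"
    | "sc \<in> set state_scs" | "sc \<in> set head_scs" | "sc \<in> set write_scs" | "sc \<in> set frame_scs" | "sc \<in> set final_scs"
    using sc unfolding scs_def by auto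
  then show ?thesis
  proof cases
    case 1
    then show ?thesis using M1 M2 M3 b tij by (auto simp: init_scs_def ev)
  next
    case 2
    have c: "\<exists>y < length x. \<exists>c < 2. i = Tm x + 2 * y + c \<and> fv x ((env3 x t i j)(37 := y)) \<phi>" if "fv x (env3 x t i j) (cellF \<phi>)" for \<phi>
    proof -
      from that obtain y where "y < length x" "i = Tm x + 2 * y \<or> i = Tm x + (2 * y + 1)" "fv x ((env3 x t i j)(37 := y)) \<phi>"
        unfolding cellF_def by (auto simp: env3_def)
      moreover from this(2) have "\<exists>c < 2. i = Tm x + 2 * y + c" by (auto intro: exI[of _ 0] exI[of _ 1])
      ultimately show ?thesis by blast
    qed
    have c1: "csat x (Bd x) val t i j (cellF (Bt (V 37)), [Po (Ce 0 2) Z (V 33)])"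
    proof -
      have "val (Ce 0 2) 0 i" if "fv x (env3 x t i j) (cellF (Bt (V 37)))"
      proof -
        from c[OF that] obtain y e where "y < length x" "e < 2" "i = Tm x + 2 * y + e" "x ! y" by auto
        then show ?thesis using M5 by (metis (full_types))
      qed
      then show ?thesis using b tij by (auto simp: csat_def) (auto simp: env3_def)
    qed
    have c2: "csat x (Bd x) val t i j (cellF (Ng (Bt (V 37))), [Po (Ce 0 1) Z (V 33)])"
    proof -
      have "val (Ce 0 1) 0 i" if "fv x (env3 x t i j) (cellF (Ng (Bt (V 37))))"
      proof -
        from c[OF that] obtain y e where "y < length x" "e < 2" "i = Tm x + 2 * y + e" "\<not> x ! y" by auto
        then show ?thesis using M5 by (metis (full_types))
      qed
      then show ?thesis using b tij by (auto simp: csat_def) (auto simp: env3_def)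
    qed
    have c3: "csat x (Bd x) val t i j (Ls (V 33) tT, [Po (Ce 0 0) Z (V 33)])"
      using M4 b tij by (auto simp: ev)
    have c4: "csat x (Bd x) val t i j (Tr, [Po (Ce 0 2) Z (Pl tT (Ti (Cn 2) (V 0)))])"
      "csat x (Bd x) val t i j (Tr, [Po (Ce 0 1) Z (Pl tT (Pl (Ti (Cn 2) (V 0)) (Cn 1)))])"
      using M6 M7 b by (auto simp: ev Bd_def Len_def add.assoc)
    have c5: "csat x (Bd x) val t i j (Ls (V 33) pT, [Ne Uu Z (V 33), Po (Ce 0 1) Z (Pl certT (V 33)), Po (Ce 0 2) Z (Pl certT (V 33))])"
      using M8 b tij by (auto simp: ev)
    have c6: "csat x (Bd x) val t i j (Ls (V 33) pT, [Po Uu Z (V 33), Po (Ce 0 0) Z (Pl certT (V 33))])"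
      using M9 b tij by (auto simp: ev)
    have c7: "csat x (Bd x) val t i j (Ls i1 pT, [Ne Uu Z i1, Po Uu Z (V 33)])"
      using M10 b tij by (auto simp: ev)
    have c8: "csat x (Bd x) val t i j (Ng (Ls (V 33) (Pl certT pT)), [Po (Ce 0 0) Z (V 33)])"
      using M11 b tij by (auto simp: ev)
    show ?thesis using 2 unfolding input_scs_def list.set insert_iff empty_iff
      by (elim disjE) (simp_all only: c1 c2 c3 c4 c5 c6 c7 c8)
  next
    case 3
    then show ?thesis using M12 b tij by (auto simp: scan_scs_def ev)
  next
    case 4
    then obtain q s where qs: "(q, s) \<in> set views" "sc = (Tr, [Ne (St q) (V 32) Z] @ map (\<lambda>k. Ne (Sc k (s ! k)) (V 32) Z) [0..<K] @ [Po (Vw q s) (V 32) Z])"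
      by (auto simp: view_scs_def)
    then have "val (St q) t 0 \<longrightarrow> (\<forall>k < K. val (Sc k (s ! k)) t 0) \<longrightarrow> val (Vw q s) t 0" using M13 tij(1) by fast
    then show ?thesis using b tij by (auto simp: ev qs(2))
  next
    case 5
    then obtain q s where qs: "(q, s) \<in> set views" "sc = (Ls (V 32) tT, [Ne (Vw q s) (V 32) Z, Po (St (fst (del M q s))) t1 Z])"
      by (auto simp: state_scs_def)
    then have "t < Tm x \<longrightarrow> val (Vw q s) t 0 \<longrightarrow> val (St (fst (del M q s))) (t + 1) 0" using M14 by fast
    then show ?thesis using b tij t by (auto simp: ev qs(2))
  next
    case 6
    then obtain q s k where qs: "(q, s) \<in> set views" "k < K" "sc = (An (Ls (V 32) tT) (Ls i1 bT),
      [Ne (Vw q s) (V 32) Z, Ne (Hd k) (V 32) (Pl (V 33) (Cn (if move q s k = -1 then 1 else 0))),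
      Po (Hd k) t1 (Pl (V 33) (Cn (if move q s k = 1 then 1 else 0)))])"
      by (auto simp: head_scs_def)
    then have "t < Tm x \<longrightarrow> i + 1 < Bd x \<longrightarrow> val (Vw q s) t 0 \<longrightarrow> val (Hd k) t (i + (if move q s k = -1 then 1 else 0)) \<longrightarrow>
        val (Hd k) (t + 1) (i + (if move q s k = 1 then 1 else 0))" using M14 by fast
    then show ?thesis using b tij t by (auto simp: ev qs(3))
  next
    case 7
    then obtain q s k where qs: "(q, s) \<in> set views" "k < K" "sc = (Ls (V 32) tT,
      [Ne (Vw q s) (V 32) Z, Ne (Hd k) (V 32) (V 33), Po (Ce k (wr q s k)) t1 (V 33)])"
      by (auto simp: write_scs_def)
    then have "t < Tm x \<longrightarrow> val (Vw q s) t 0 \<longrightarrow> val (Hd k) t i \<longrightarrow> val (Ce k (wr q s k)) (t + 1) i" using M14 tij(2) by fast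
    then show ?thesis using b tij t by (auto simp: ev qs(3))
  next
    case 8
    then show ?thesis using M15 b tij t by (auto simp: frame_scs_def ev)
  next
    case 9
    then show ?thesis using M16 M17 b tij by (auto simp: final_scs_def ev)
  qed
qed

text \<open>A certificate is read off at time 0. By induction on the time, all variables that
  describe the run on it are true, and then the final clauses leave \<open>[True]\<close> as the
  only possible output.\<close>

lemma model_accept:
  assumes m: "model x val"
  shows "\<exists>u. length u \<le> poly pc (length x) \<and> run.tp M (pair_code x u) (K - 1) (Tm x) = word_tape [True]"
proof -
  define T where "T = Tm x"
  define B where "B = Bd x"
  define pb where "pb = poly pc (length x)"
  define n where "n = length x"
  have ct: "cert x = T + 2 * n + 2" by (simp add: cert_def T_def n_def)
  have BT: "B = 2 * T + 2 * n + pb + 4" by (simp add: B_def Bd_def T_def Len_def n_def pb_def)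
  note m' = m[unfolded model_def Let_def, folded T_def B_def pb_def n_def]
  note M1 = m'[THEN conjunct1] and R1 = m'[THEN conjunct2]
  note M2 = R1[THEN conjunct1] and R2 = R1[THEN conjunct2]
  note M3 = R2[THEN conjunct1] and R3 = R2[THEN conjunct2]
  note M4 = R3[THEN conjunct1] and R4 = R3[THEN conjunct2]
  note M5 = R4[THEN conjunct1] and R5 = R4[THEN conjunct2]
  note M6 = R5[THEN conjunct1] and R6 = R5[THEN conjunct2]
  note M7 = R6[THEN conjunct1] and R7 = R6[THEN conjunct2]
  note M8 = R7[THEN conjunct1] and R8 = R7[THEN conjunct2]
  note M9 = R8[THEN conjunct1] and R9 = R8[THEN conjunct2]
  note M10 = R9[THEN conjunct1] and R10 = R9[THEN conjunct2]
  note M11 = R10[THEN conjunct1] and R11 = R10[THEN conjunct2]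
  note M12 = R11[THEN conjunct1] and R12 = R11[THEN conjunct2]
  note M13 = R12[THEN conjunct1] and R13 = R12[THEN conjunct2]
  note M14 = R13[THEN conjunct1] and R14 = R13[THEN conjunct2]
  note M15 = R14[THEN conjunct1] and R15 = R14[THEN conjunct2]
  note M16 = R15[THEN conjunct1] and R16 = R15[THEN conjunct2]
  note M17 = R16
  note init = M1 M2[rule_format] M3[rule_format] and in1 = M4[rule_format] and in2 = M5[rule_format]
    and in3 = M6 M7 and in4 = M8[rule_format] and in5 = M9[rule_format] and in6 = M10[rule_format]
    and in7 = M11[rule_format] and sc = M12[rule_format] and fr = M15[rule_format]
    and fi = M16[rule_format] M17[rule_format]
  have vw: "val (Vw q s) t 0" if "t < B" "(q, s) \<in> set views" "val (St q) t 0" "\<forall>k < K. val (Sc k (s ! k)) t 0" for t q s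
    using M13 that by fast
  have tr: "val (St (fst (del M q s))) (t + 1) 0 \<and>
      (\<forall>k < K. \<forall>i. i + 1 < B \<longrightarrow> val (Hd k) t (i + (if move q s k = -1 then 1 else 0)) \<longrightarrow>
        val (Hd k) (t + 1) (i + (if move q s k = 1 then 1 else 0))) \<and>
      (\<forall>k < K. \<forall>i < B. val (Hd k) t i \<longrightarrow> val (Ce k (wr q s k)) (t + 1) i)"
    if "t < T" "(q, s) \<in> set views" "val (Vw q s) t 0" for t q s
  proof -
    have "case (q, s) of (q, s) \<Rightarrow> val (Vw q s) t 0 \<longrightarrow> val (St (fst (del M q s))) (t + 1) 0 \<and>
      (\<forall>k < K. \<forall>i. i + 1 < B \<longrightarrow> val (Hd k) t (i + (if move q s k = -1 then 1 else 0)) \<longrightarrow>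
        val (Hd k) (t + 1) (i + (if move q s k = 1 then 1 else 0))) \<and>
      (\<forall>k < K. \<forall>i < B. val (Hd k) t i \<longrightarrow> val (Ce k (wr q s k)) (t + 1) i)"
      using M14 that by fast
    then show ?thesis using that(3) by simp
  qed
  \<comment> \<open>The length of the occupied segment. Nothing is known about \<open>Uu\<close>
    from \<open>pb\<close> on, hence the alternative \<open>i = pb\<close>.\<close>
  define l where "l = (LEAST i. i = pb \<or> \<not> val Uu 0 i)"
  have l: "l = pb \<or> \<not> val Uu 0 l" unfolding l_def by (rule LeastI[of _ pb]) simp
  have lU: "val Uu 0 i" if "i < l" for i using not_less_Least[of i "\<lambda>i. i = pb \<or> \<not> val Uu 0 i"] that unfolding l_def by blast
  have lpb: "l \<le> pb" unfolding l_def by (rule Least_le) simp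
  have nU: "\<not> val Uu 0 (l + i)" if "l + i < pb" for i
    using that
  proof (induction i)
    case 0
    then show ?case using l by auto
  next
    case (Suc i)
    then show ?case using in6[of "l + i"] by auto
  qed
  \<comment> \<open>Should both bit symbols be true at a cell, symbol 2 is chosen; the tape at time
    0 then still agrees with true variables.\<close>
  define u where "u = map (\<lambda>i. val (Ce 0 2) 0 (cert x + i)) [0..<l]"
  define w where "w = pair_code x u"
  have lw: "length w = 2 * n + 2 + l" by (simp add: w_def length_pair_code u_def n_def)
  interpret R: run M w using wf by unfold_locales
  have c0: "val (Ce 0 (word_tape w (int i - int T))) 0 i" if i: "i < B" for i
  proof -
    consider "i < T" | y where "i = T + y" "y < 2 * n" | "i = T + 2 * n" | "i = T + 2 * n + 1"
      | j where "i = cert x + j" "j < l" | j where "i = cert x + (l + j)" "l + j < pb" | "i \<ge> cert x + pb"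
    proof -
      have "i < T \<or> (\<exists>y. i = T + y \<and> y < 2 * n) \<or> i = T + 2 * n \<or> i = T + 2 * n + 1 \<or> (\<exists>j. i = cert x + j \<and> j < l) \<or>
          (\<exists>j. i = cert x + (l + j) \<and> l + j < pb) \<or> i \<ge> cert x + pb"
        unfolding ct by presburger
      then show thesis using that by blast
    qed
    then show ?thesis
    proof cases
      case 1
      then show ?thesis using in1 by (simp add: word_tape_outside)
    next
      case 2
      have "w ! y = x ! (y div 2)" using 2 by (simp add: w_def nth_pair_code n_def)
      moreover have "val (Ce 0 (if x ! (y div 2) then 2 else 1)) 0 (T + 2 * (y div 2) + y mod 2)" using 2 by (intro in2) auto
      moreover have "T + 2 * (y div 2) + y mod 2 = i" using 2 by simp
      ultimately show ?thesis using 2 lw by (simp add: word_tape_nth)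
    next
      case 3
      have "int i - int T = int (2 * n)" "w ! (2 * n)" using 3 by (simp_all add: w_def nth_pair_code n_def)
      then show ?thesis using 3 in3 lw by (simp only: word_tape_nth) simp
    next
      case 4
      have "int i - int T = int (Suc (2 * n))" "\<not> w ! Suc (2 * n)" using 4 by (simp_all add: w_def nth_pair_code n_def)
      then show ?thesis using 4 in3 lw by (simp only: word_tape_nth) simp
    next
      case 5
      have "int i - int T = int (2 * n + 2 + j)" using 5 ct by simp
      moreover have "w ! (2 * n + 2 + j) = val (Ce 0 2) 0 (cert x + j)"
        using 5 unfolding w_def n_def nth_pair_code(4) by (simp add: u_def)
      moreover have "2 * n + 2 + j < length w" using lw 5 by simp
      ultimately show ?thesis using 5 in4[of j] lU[of j] lpb by (simp only: word_tape_nth) auto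
    next
      case 6
      have "int (length w) \<le> int i - int T" using 6 ct lw by simp
      then show ?thesis using 6 in5[of "l + j"] nU[of j] by (simp add: word_tape_outside)
    next
      case 7
      have "int (length w) \<le> int i - int T" using 7 ct lw lpb by simp
      then show ?thesis using 7 in7[OF i] by (simp add: word_tape_outside)
    qed
  qed
  have inv: "val (St (R.qs t)) t 0 \<and> (\<forall>k < K. val (Hd k) t (nat (R.hd k t + int T))) \<and>
      (\<forall>k < K. \<forall>i < B. val (Ce k (R.tp k t (int i - int T))) t i)" if "t \<le> T" for t
    using that
  proof (induction t)
    case 0
    have "val (Ce k (R.tp k 0 (int i - int T))) 0 i" if "k < K" "i < B" for k i
      using c0[OF that(2)] init(3)[OF that] R.tp_0[OF that(1)] by (cases "k = 0") auto
    then show ?case using init R.qs_0 R.hd_0 by simp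
  next
    case (Suc t)
    then have t: "t < T" "t < B" and IH: "val (St (R.qs t)) t 0" "\<And>k. k < K \<Longrightarrow> val (Hd k) t (nat (R.hd k t + int T))"
      "\<And>k i. k < K \<Longrightarrow> i < B \<Longrightarrow> val (Ce k (R.tp k t (int i - int T))) t i" using BT by auto
    have h: "- int t \<le> R.hd k t" "R.hd k t \<le> int t" if "k < K" for k using R.inv[of t] that by (auto simp: abs_le_iff)
    have hB: "nat (R.hd k t + int T) + 1 < B" "int (nat (R.hd k t + int T)) = R.hd k t + int T" "nat (R.hd k t + int T) \<ge> 1" if "k < K" for k
      using h[OF that] t BT by auto
    have "val (Sc k (R.sy k t)) t 0" if "k < K" for k
      using sc[OF t(2) _ that _ IH(2)[OF that], of "R.sy k t"] IH(3)[OF that, of "nat (R.hd k t + int T)"] hB[OF that]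
        R.inv[of t] that by (simp add: R.sy_def)
    moreover have v: "(R.qs t, R.syms t) \<in> set views" using R.inv[of t] R.syms_wf[of t] by (simp add: set_views)
    ultimately have V: "val (Vw (R.qs t) (R.syms t)) t 0" using vw[OF t(2) v IH(1)] by (simp add: R.syms_def)
    note tr' = tr[OF t(1) v V]
    have H: "val (Hd k) (Suc t) (nat (R.hd k (Suc t) + int T))" if k: "k < K" for k
    proof -
      define d where "d = move (R.qs t) (R.syms t) k"
      have d: "d \<in> {-1, 0, 1}" "R.hd k (Suc t) = R.hd k t + d"
        using R.del_wf(3)[OF _ R.syms_wf k, of "R.qs t"] R.inv[of t] R.tape_Suc(2)[OF k, of t] by (auto simp: d_def move_def)
      define i where "i = nat (R.hd k t + int T) - (if d = -1 then 1 else 0)"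
      have i1: "i + (if d = -1 then 1 else 0) = nat (R.hd k t + int T)" using hB(3)[OF k] by (simp add: i_def)
      have i2: "i + (if d = 1 then 1 else 0) = nat (R.hd k (Suc t) + int T)" using d hB[OF k] by (auto simp: i_def)
      have "i + 1 < B" using hB(1)[OF k] by (simp add: i_def)
      moreover have "val (Hd k) t (i + (if d = -1 then 1 else 0))" using IH(2)[OF k] i1 by simp
      ultimately have "val (Hd k) (t + 1) (i + (if d = 1 then 1 else 0))" using tr' k unfolding d_def by blast
      then show ?thesis using i2 by simp
    qed
    have C: "val (Ce k (R.tp k (Suc t) (int i - int T))) (Suc t) i" if k: "k < K" "i < B" for k i
    proof (cases "i = nat (R.hd k t + int T)")
      case True
      then have e: "int i - int T = R.hd k t" using hB[OF k(1)] by simp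
      have "val (Ce k (wr (R.qs t) (R.syms t) k)) (t + 1) i" using tr' k IH(2)[OF k(1)] True by blast
      then show ?thesis using R.tape_Suc(1)[OF k(1), of t] unfolding e by (simp add: wr_def)
    next
      case False
      then have e: "int i - int T \<noteq> R.hd k t" using hB[OF k(1)] by linarith
      have "val (Ce k (R.tp k t (int i - int T))) (t + 1) i"
        using fr[OF t(1) k(2) _ False k(1) _ IH(2)[OF k(1)] IH(3)[OF k]] hB[OF k(1)] R.inv[of t] k by auto
      then show ?thesis using R.tape_Suc(1)[OF k(1), of t] e by simp
    qed
    show ?case using H C tr' R.qs_Suc[of t] by simp
  qed
  have K1: "K - 1 < K" using R.tapes_pos by simp
  have "R.tp (K - 1) T i = word_tape [True] i" for i
  proof (cases "- int T \<le> i \<and> i < int B - int T")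
    case True
    define j where "j = nat (i + int T)"
    have j: "j < B" "int j - int T = i" using True by (auto simp: j_def)
    have v: "val (Ce (K - 1) (R.tp (K - 1) T i)) T j" using inv[OF order_refl] K1 j by metis
    have a: "R.tp (K - 1) T i < A" using R.inv[of T] K1 by blast
    show ?thesis
    proof (cases "j = T")
      case True
      then show ?thesis using fi(2)[OF a] v j by (auto simp: word_tape_def)
    next
      case False
      then show ?thesis using fi(1)[OF j(1) False a] v j by (auto simp: word_tape_def)
    qed
  next
    case False
    \<comment> \<open>Cells outside the window are not reached within \<open>T\<close> steps and lie
      beyond the input, so they are still blank.\<close>
    then have "R.tp (K - 1) T i = R.tp (K - 1) 0 i" using BT by (intro R.tp_far[OF K1]) auto
    also have "\<dots> = 0" using False R.tp_0[OF K1] BT lw lpb by (auto intro!: word_tape_outside)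
    also have "\<dots> = word_tape [True] i" using False BT by (subst word_tape_outside) auto
    finally show ?thesis .
  qed
  then have "R.tp (K - 1) (Tm x) = word_tape [True]" unfolding T_def by blast
  moreover have "length u \<le> pb" using lpb by (simp add: u_def)
  ultimately show ?thesis unfolding w_def pb_def by blast
qed

lemma accept_model:
  assumes u: "length u \<le> poly pc (length x)"
    and acc: "run.tp M (pair_code x u) (K - 1) (Tm x) = word_tape [True]"
  shows "\<exists>val. model x val"
proof -
  define T where "T = Tm x"
  define w where "w = pair_code x u"
  interpret R: run M w using wf by unfold_locales
  define n where "n = length x"
  have lw: "length w = 2 * n + 2 + length u" by (simp add: w_def length_pair_code n_def)
  have ct: "cert x = T + 2 * n + 2" by (simp add: cert_def T_def n_def)
  define val where "val \<kappa> t i = (case \<kappa> of St q \<Rightarrow> R.qs t = q | Hd k \<Rightarrow> R.hd k t + int T = int i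
    | Ce k a \<Rightarrow> R.tp k t (int i - int T) = a | Sc k a \<Rightarrow> R.sy k t = a
    | Vw q s \<Rightarrow> R.qs t = q \<and> R.syms t = s | Uu \<Rightarrow> i < length u)" for \<kappa> t i
  have K0: "0 < K" using R.tapes_pos by simp
  have c0: "val (Ce 0 a) 0 i \<longleftrightarrow> word_tape w (int i - int T) = a" for i a
    by (simp add: val_def R.tp_0[OF K0])
  have acc': "R.tp (K - 1) T = word_tape [True]" using acc by (simp add: w_def T_def)
  have "model x val" unfolding model_def Let_def T_def[symmetric] n_def[symmetric]
  proof (intro conjI allI impI ballI, goal_cases)
    case 1
    then show ?case by (simp add: val_def R.qs_0)
  next
    case (2 k)
    then show ?case by (simp add: val_def R.hd_0)
  next
    case (3 k i)
    then show ?case by (simp add: val_def R.tp_0)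
  next
    case (4 i)
    then show ?case by (simp add: c0 word_tape_outside)
  next
    case (5 y b)
    have "int (T + 2 * y + b) - int T = int (2 * y + b)" by simp
    moreover have "w ! (2 * y + b) = x ! y" using 5 by (simp add: w_def nth_pair_code n_def)
    moreover have "2 * y + b < length w" using 5 lw by simp
    ultimately show ?case unfolding c0 by (simp only: word_tape_nth)
  next
    case 6
    have "int (T + 2 * n) - int T = int (2 * n)" by simp
    moreover have "w ! (2 * n)" by (simp add: w_def nth_pair_code n_def)
    moreover have "2 * n < length w" using lw by simp
    ultimately show ?case unfolding c0 by (simp only: word_tape_nth if_True)
  next
    case 7
    have "int (T + 2 * n + 1) - int T = int (Suc (2 * n))" by simp
    moreover have "\<not> w ! Suc (2 * n)" by (simp add: w_def nth_pair_code n_def)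
    moreover have "Suc (2 * n) < length w" using lw by simp
    ultimately show ?case unfolding c0 by (simp only: word_tape_nth if_False)
  next
    case (8 i)
    then have "2 * n + 2 + i < length w" using lw by (simp add: val_def)
    moreover have "int (cert x + i) - int T = int (2 * n + 2 + i)" using ct by simp
    ultimately show ?case unfolding c0 by (simp only: word_tape_nth) simp
  next
    case (9 i)
    have "word_tape w (int (cert x + i) - int T) = 0" if "\<not> i < length u"
      using that lw ct by (intro word_tape_outside) simp
    then show ?case unfolding c0 by (cases "i < length u") (simp_all add: val_def)
  next
    case (10 i)
    then show ?case by (simp add: val_def)
  next
    case (11 i)
    then show ?case unfolding c0 using lw u ct by (intro word_tape_outside) (simp add: n_def)
  next
    case (12 t i k a)
    have "R.hd k t = int i - int T" if "val (Hd k) t i" using that by (simp add: val_def)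
    then have "val (Sc k (R.tp k t (int i - int T))) t 0" if "val (Hd k) t i"
      using that by (simp only: val_def kind.case R.sy_def)
    then show ?case using 12 by (auto simp: val_def)
  next
    case (13 t qs)
    obtain q s where qs: "qs = (q, s)" by fastforce
    have "R.syms t = s" if "\<forall>k < K. R.sy k t = s ! k"
      using 13(2) that unfolding qs set_views by (intro nth_equalityI) (simp_all add: R.syms_def)
    then show ?case unfolding qs prod.case by (simp add: val_def)
  next
    case (14 t qs)
    obtain q s where qs: "qs = (q, s)" by fastforce
    have M: "R.hd k (Suc t) = R.hd k t + move (R.qs t) (R.syms t) k" "R.tp k (Suc t) = (R.tp k t)(R.hd k t := wr (R.qs t) (R.syms t) k)"
      "move (R.qs t) (R.syms t) k \<in> {-1, 0, 1}"
      if "k < K" for k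
      using R.tape_Suc[OF that, of t] R.del_wf(3)[OF _ R.syms_wf that, of "R.qs t"] R.inv[of t] by (auto simp: move_def wr_def)
    show ?case unfolding qs prod.case
    proof (intro impI conjI allI)
      assume v: "val (Vw q s) t 0"
      then have e: "q = R.qs t" "s = R.syms t" by (auto simp: val_def)
      show "val (St (fst (del M q s))) (t + 1) 0" using R.qs_Suc[of t] e by (simp add: val_def)
      fix k i assume k: "k < K"
      show "val (Hd k) (t + 1) (i + (if move q s k = 1 then 1 else 0))" if "val (Hd k) t (i + (if move q s k = - 1 then 1 else 0))"
        using that M[OF k] unfolding e by (auto simp: val_def)
      show "val (Ce k (wr q s k)) (t + 1) i" if "val (Hd k) t i"
      proof -
        have "int i - int T = R.hd k t" using that by (simp add: val_def)
        then show ?thesis using M(2)[OF k] unfolding e by (simp add: val_def)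
      qed
    qed
  next
    case (15 t i j k a)
    then have "int i - int T \<noteq> R.hd k t" by (auto simp: val_def)
    then show ?case using 15 R.tape_Suc(1)[of k t] by (simp add: val_def)
  next
    case (16 i a)
    then show ?case using acc' by (simp add: val_def word_tape_def)
  next
    case (17 a)
    then show ?case using acc' by (simp add: val_def word_tape_def)
  qed
  then show ?thesis by blast
qed

end

theorem NP_reduces_to_tolerance:
  assumes "L \<in> NP"
  shows "\<exists>f. polytime f \<and> (\<forall>x.
    (x \<in> L \<longrightarrow> f x \<in> graph_code ` {G. graph_instance G \<and> trapezoid_graph G \<and> tolerance_graph G}) \<and>
    (x \<notin> L \<longrightarrow> f x \<in> graph_code ` {G. graph_instance G \<and> trapezoid_graph G \<and> \<not> tolerance_graph G}))"
proof -
  from assms obtain v pc where v: "polytime v" and L: "\<And>x. x \<in> L \<longleftrightarrow> has_certificate v pc x"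
    unfolding NP_def by blast
  from v obtain M pq where M: "wf_tm M" "\<And>x. outputs_within M x (v x) (poly pq (length x))"
    unfolding polytime_def by blast
  interpret T: tableau M pc pq using M(1) by unfold_locales
  have fin: "finite (kinds T.scs)" by (simp add: kinds_def)
  then obtain idx where "bij_betw idx (kinds T.scs) {0..<card (kinds T.scs)}"
    using ex_bij_betw_finite_nat by blast
  then have idx: "inj_on idx (kinds T.scs)" "\<And>\<kappa>. \<kappa> \<in> kinds T.scs \<Longrightarrow> idx \<kappa> < card (kinds T.scs)"
    by (auto simp: bij_betw_def)
  interpret S: schemata T.scs T.bT idx "card (kinds T.scs)" "St 0"
  proof
    show "(Tr, [(True, St 0, Cn 0, Cn 0)]) \<in> set T.scs" by (simp add: T.scs_def T.init_scs_def)
  qed (use T.tvs_terms T.wf_scs idx in auto)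
  have bd: "S.bd x = T.Bd x" for x unfolding S.bd_def by (rule T.tv_terms) (simp add: env3_def)
  have "x \<in> L \<longleftrightarrow> cnf_sat (S.n x) (S.m x) (S.Pos x) (S.Neg x)" for x
  proof -
    have acc: "v (pair_code x u) = [True] \<longleftrightarrow> run.tp M (pair_code x u) (n_tapes M - 1) (T.Tm x) = word_tape [True]"
      if "length u \<le> poly pc (length x)" for u
    proof -
      interpret R: run M "pair_code x u" using M(1) by unfold_locales
      have "length (pair_code x u) \<le> T.Len x" using that by (simp add: length_pair_code T.Len_def)
      \<comment> \<open>One height serves all certificates, since a halted run does not change any
        more.\<close>
      then have "poly pq (length (pair_code x u)) \<le> T.Tm x" unfolding T.Tm_def by (rule poly_mono_nat)
      from R.output_tape[OF M(2) this] show ?thesis using word_tape_inject by metis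
    qed
    have "x \<in> L \<longleftrightarrow> (\<exists>u. length u \<le> poly pc (length x) \<and> run.tp M (pair_code x u) (n_tapes M - 1) (T.Tm x) = word_tape [True])"
      unfolding L has_certificate_def using acc by blast
    also have "\<dots> \<longleftrightarrow> (\<exists>val. T.model x val)" using T.model_accept T.accept_model by blast
    also have "\<dots> \<longleftrightarrow> (\<exists>val. \<forall>sc \<in> set T.scs. \<forall>t < T.Bd x. \<forall>i < T.Bd x. \<forall>j < T.Bd x. csat x (T.Bd x) val t i j sc)"
    proof (rule ex_cong1)
      fix val
      show "T.model x val \<longleftrightarrow> (\<forall>sc \<in> set T.scs. \<forall>t < T.Bd x. \<forall>i < T.Bd x. \<forall>j < T.Bd x. csat x (T.Bd x) val t i j sc)"
        using T.sat_model[of x val] T.model_sat[of x val] by auto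
    qed
    also have "\<dots> \<longleftrightarrow> cnf_sat (S.n x) (S.m x) (S.Pos x) (S.Neg x)"
      unfolding S.cnf_sat_iff bd using T.bounds(2) by simp
    finally show ?thesis .
  qed
  moreover have "graph_instance (S.G x)" for x
  proof -
    have "pverts (S.G x) = {..<2 * (12 * ((S.m x + 1) * (S.n x + 1)))}"
      by (simp only: cnf_graph_def join_graph_def pair_pre_digraph.simps)
    moreover have "pair_graph (S.G x)" unfolding cnf_graph_def by (rule pair_graph_join)
    ultimately show ?thesis unfolding graph_instance_def by blast
  qed
  moreover have "trapezoid_graph (S.G x)" "cnf_sat (S.n x) (S.m x) (S.Pos x) (S.Neg x) \<longleftrightarrow> tolerance_graph (S.G x)" for x
  proof -
    interpret cnf "S.n x" "S.m x" "S.Pos x" "S.Neg x" by (rule S.cnf)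
    show "trapezoid_graph (S.G x)" by (rule trapezoid_cnf)
    show "cnf_sat (S.n x) (S.m x) (S.Pos x) (S.Neg x) \<longleftrightarrow> tolerance_graph (S.G x)"
      using sat_imp_tolerance tolerance_imp_sat by blast
  qed
  ultimately show ?thesis using S.polytime_graph by (intro exI[of _ "\<lambda>x. graph_code (S.G x)"]) auto
qed

section \<open>Small integer solutions of linear inequalities\<close>

text \<open>The Leibniz formula has \<open>fact k\<close> summands, each of absolute value at most
  1.\<close>

lemma abs_det_le:
  fixes A :: "int mat"
  assumes A: "A \<in> carrier_mat k k" and e: "\<And>i j. i < k \<Longrightarrow> j < k \<Longrightarrow> \<bar>A $$ (i, j)\<bar> \<le> 1"
  shows "\<bar>det A\<bar> \<le> fact k"
proof -
  have "\<bar>det A\<bar> \<le> (\<Sum>p \<in> {p. p permutes {0..<k}}. \<bar>signof p * (\<Prod>i = 0..<k. A $$ (i, p i))\<bar>)"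
    unfolding det_def'[OF A] by (rule sum_abs)
  also have "\<dots> \<le> (\<Sum>p \<in> {p. p permutes {0..<k}}. 1)"
  proof (rule sum_mono)
    fix p assume "p \<in> {p. p permutes {0..<k}}"
    then have p: "p permutes {0..<k}" by simp
    have "(\<Prod>i = 0..<k. \<bar>A $$ (i, p i)\<bar>) \<le> (\<Prod>i = 0..<k. 1)"
      using e permutes_in_image[OF p] by (intro prod_mono) auto
    then show "\<bar>signof p * (\<Prod>i = 0..<k. A $$ (i, p i))\<bar> \<le> 1"
      by (simp add: abs_mult abs_prod sign_def)
  qed
  also have "\<dots> = fact k" by (simp add: card_permutations)
  finally show ?thesis .
qed

text \<open>Cramer's rule without division, in terms of functions and sums: \<open>c\<close> is the
  adjugate matrix and \<open>D\<close> the determinant. The cofactors are determinants of size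
  \<open>d - 1\<close>, which bounds them; in the singular case a kernel vector is supplied
  instead.\<close>

lemma adjugate:
  fixes a :: "nat \<Rightarrow> nat \<Rightarrow> int"
  assumes a: "\<forall>i < d. \<forall>j < d. \<bar>a i j\<bar> \<le> 1"
  obtains c D where "\<forall>k < d. \<forall>j < d. (\<Sum>i<d. c k i * a i j) = (if k = j then D else 0)"
    and "\<forall>i < d. \<forall>k < d. (\<Sum>j<d. a i j * c j k) = (if i = k then D else 0)"
    and "\<forall>k < d. \<forall>i < d. \<bar>c k i\<bar> \<le> fact (d - 1)"
    and "D = 0 \<longrightarrow> (\<exists>v :: nat \<Rightarrow> real. (\<exists>j < d. v j \<noteq> 0) \<and> (\<forall>i < d. (\<Sum>j<d. real_of_int (a i j) * v j) = 0))"
proof -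
  define A where "A = mat d d (\<lambda>(i, j). a i j)"
  have A: "A \<in> carrier_mat d d" by (simp add: A_def)
  have Aij: "A $$ (i, j) = a i j" if "i < d" "j < d" for i j using that by (simp add: A_def)
  define c where "c k i = adj_mat A $$ (k, i)" for k i
  have adj: "adj_mat A \<in> carrier_mat d d" using adj_mat(1)[OF A] .
  have 1: "(\<Sum>i<d. c k i * a i j) = (if k = j then det A else 0)" if kj: "k < d" "j < d" for k j
  proof -
    have "(adj_mat A * A) $$ (k, j) = (\<Sum>i = 0..<d. c k i * a i j)"
      using kj A adj by (simp add: times_mat_def scalar_prod_def c_def Aij)
    also have "(adj_mat A * A) $$ (k, j) = (if k = j then det A else 0)"
      using adj_mat(3)[OF A] kj by simp
    finally show ?thesis by (simp add: atLeast0LessThan)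
  qed
  have 2: "(\<Sum>j<d. a i j * c j k) = (if i = k then det A else 0)" if ik: "i < d" "k < d" for i k
  proof -
    have "(A * adj_mat A) $$ (i, k) = (\<Sum>j = 0..<d. a i j * c j k)"
      using ik A adj by (simp add: times_mat_def scalar_prod_def c_def Aij)
    also have "(A * adj_mat A) $$ (i, k) = (if i = k then det A else 0)"
      using adj_mat(2)[OF A] ik by simp
    finally show ?thesis by (simp add: atLeast0LessThan)
  qed
  have 3: "\<bar>c k i\<bar> \<le> fact (d - 1)" if ki: "k < d" "i < d" for k i
  proof -
    have "mat_delete A i k \<in> carrier_mat (d - 1) (d - 1)" using A by (rule mat_delete_carrier)
    moreover have "\<bar>mat_delete A i k $$ (i', j')\<bar> \<le> 1" if "i' < d - 1" "j' < d - 1" for i' j'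
      using that A a by (simp add: mat_delete_def A_def)
    ultimately have "\<bar>det (mat_delete A i k)\<bar> \<le> fact (d - 1)" by (rule abs_det_le)
    moreover have "c k i = (-1) ^ (i + k) * det (mat_delete A i k)"
      using ki A by (simp add: c_def adj_mat_def cofactor_def)
    ultimately show ?thesis by (simp add: abs_mult power_abs)
  qed
  have 4: "\<exists>v :: nat \<Rightarrow> real. (\<exists>j < d. v j \<noteq> 0) \<and> (\<forall>i < d. (\<Sum>j<d. real_of_int (a i j) * v j) = 0)" if D: "det A = 0"
  proof -
    define R where "R = map_mat real_of_int A"
    have R: "R \<in> carrier_mat d d" using A by (simp add: R_def)
    have "det R = 0" unfolding R_def using D by (simp add: of_int_hom.hom_det)
    then obtain v where v: "v \<in> carrier_vec d" "v \<noteq> 0\<^sub>v d" "R *\<^sub>v v = 0\<^sub>v d"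
      using det_0_iff_vec_prod_zero_field[OF R] by blast
    have "\<exists>j < d. v $ j \<noteq> 0"
    proof (rule ccontr)
      assume "\<not> ?thesis"
      then have "v = 0\<^sub>v d" using v(1) by (intro eq_vecI) auto
      then show False using v(2) by simp
    qed
    moreover have "(\<Sum>j<d. real_of_int (a i j) * v $ j) = 0" if i: "i < d" for i
    proof -
      have "(R *\<^sub>v v) $ i = (\<Sum>j = 0..<d. real_of_int (a i j) * v $ j)"
        using i R v(1) by (simp add: scalar_prod_def R_def A_def)
      then show ?thesis using v(3) i by (simp add: atLeast0LessThan)
    qed
    ultimately show ?thesis by (intro exI[of _ "\<lambda>j. v $ j"]) auto
  qed
  show thesis by (rule that[of c "det A"]) (use 1 2 3 4 in blast)+
qed

text \<open>
  A row of a nonsingular system that is not tight is exchanged for a constraint that becomes tight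
  when the solution is moved, along the edge given by the other rows, towards this row.
\<close>

lemma tight_rows:
  fixes C :: "((nat \<Rightarrow> int) \<times> int) set" and y :: "nat \<Rightarrow> real"
  assumes fin: "finite C" and coef: "\<And>c j. c \<in> C \<Longrightarrow> j < d \<Longrightarrow> \<bar>fst c j\<bar> \<le> 1"
    and feas: "\<And>c. c \<in> C \<Longrightarrow> (\<Sum>j<d. real_of_int (fst c j) * y j) \<ge> real_of_int (snd c)"
    and f: "\<And>i. i < d \<Longrightarrow> f i \<in> C"
    and inj: "\<And>v. (\<forall>i < d. (\<Sum>j<d. real_of_int (fst (f i) j) * v j) = 0) \<Longrightarrow> (\<forall>j < d. v j = (0 :: real))"
  shows "\<exists>f y. (\<forall>c \<in> C. (\<Sum>j<d. real_of_int (fst c j) * y j) \<ge> real_of_int (snd c)) \<and> (\<forall>i < d. f i \<in> C) \<and>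
    (\<forall>v. (\<forall>i < d. (\<Sum>j<d. real_of_int (fst (f i) j) * v j) = 0) \<longrightarrow> (\<forall>j < d. v j = (0 :: real))) \<and>
    (\<forall>i < d. (\<Sum>j<d. real_of_int (fst (f i) j) * y j) = real_of_int (snd (f i)))"
  using feas f inj
proof (induction "card {i \<in> {..<d}. (\<Sum>j<d. real_of_int (fst (f i) j) * y j) \<noteq> real_of_int (snd (f i))}"
    arbitrary: f y rule: less_induct)
  case less
  define dt where "dt c v = (\<Sum>j<d. real_of_int (fst c j) * v j)" for c :: "(nat \<Rightarrow> int) \<times> int" and v :: "nat \<Rightarrow> real"
  have lin: "dt c (\<lambda>j. v j - s * w j) = dt c v - s * dt c w" for c v w s
    by (simp add: dt_def sum_subtractf sum_distrib_left algebra_simps)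
  note feas = less.prems(1)[folded dt_def] and f = less.prems(2)
  have inj: "\<forall>j < d. v j = 0" if "\<forall>i < d. dt (f i) v = 0" for v
    using less.prems(3) that unfolding dt_def by blast
  show ?case
  proof (cases "\<forall>i < d. dt (f i) y = real_of_int (snd (f i))")
    case True
    show ?thesis
    proof (intro exI conjI ballI allI impI)
      show "v j = 0" if "\<forall>i < d. (\<Sum>j<d. real_of_int (fst (f i) j) * v j) = 0" "j < d" for v j
        using less.prems(3)[OF that(1)] that(2) by simp
      show "(\<Sum>j<d. real_of_int (fst (f i) j) * y j) = real_of_int (snd (f i))" if "i < d" for i
        using True that by (simp only: dt_def)
    qed (use less.prems(1,2) in simp_all)
  next
    case False
    then obtain r where r: "r < d" "dt (f r) y \<noteq> real_of_int (snd (f r))" by blast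
    have ab: "\<forall>i < d. \<forall>j < d. \<bar>fst (f i) j\<bar> \<le> 1" using coef[OF f] by simp
    obtain c D where "\<forall>k < d. \<forall>j < d. (\<Sum>i<d. c k i * fst (f i) j) = (if k = j then D else 0)"
      and c: "\<forall>i < d. \<forall>k < d. (\<Sum>j<d. fst (f i) j * c j k) = (if i = k then D else 0)"
      and "\<forall>k < d. \<forall>i < d. \<bar>c k i\<bar> \<le> fact (d - 1)"
      and D: "D = 0 \<longrightarrow> (\<exists>v :: nat \<Rightarrow> real. (\<exists>j < d. v j \<noteq> 0) \<and> (\<forall>i < d. (\<Sum>j<d. real_of_int (fst (f i) j) * v j) = 0))"
      by (rule adjugate[of d "\<lambda>i. fst (f i)", OF ab]) (rule that)
    have D0: "D \<noteq> 0" using D[folded dt_def] inj by blast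
    \<comment> \<open>Column \<open>r\<close> of the inverse matrix: moving along its negative
      lowers row \<open>r\<close> at unit rate and keeps all other rows constant.\<close>
    define z where "z j = real_of_int (c j r) / real_of_int D" for j
    have z: "dt (f i) z = (if i = r then 1 else 0)" if "i < d" for i
    proof -
      have "dt (f i) z = real_of_int (\<Sum>j<d. fst (f i) j * c j r) / real_of_int D"
        by (simp add: dt_def z_def sum_divide_distrib)
      then show ?thesis using c[rule_format, OF that r(1)] D0 by simp
    qed
    define S where "S = {k \<in> C. dt k z > 0}"
    \<comment> \<open>The ratio test of the simplex method: \<open>g k\<close> is the step length at
      which constraint \<open>k\<close> becomes tight. Row \<open>r\<close> is a candidate itself,
      so the minimum exists.\<close>
    define g where "g k = (dt k y - real_of_int (snd k)) / dt k z" for k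
    have fr: "f r \<in> S" using z[OF r(1)] f[OF r(1)] by (simp add: S_def)
    have S: "finite S" using fin by (simp add: S_def)
    have S0: "S \<noteq> {}" using fr by blast
    obtain k where k: "k \<in> S" "\<And>k'. k' \<in> S \<Longrightarrow> g k \<le> g k'"
      using arg_min_if_finite(1)[OF S S0, of g] arg_min_least[OF S S0, of _ g] by blast
    define s where "s = g k"
    have kS: "k \<in> C" "dt k z > 0" using k by (auto simp: S_def)
    have s0: "s \<ge> 0" unfolding s_def g_def using feas[OF kS(1)] kS(2) by simp
    define y' where "y' j = y j - s * z j" for j
    have y': "dt c y' = dt c y - s * dt c z" for c unfolding y'_def by (rule lin)
    have feas': "dt c y' \<ge> real_of_int (snd c)" if "c \<in> C" for c
    proof (cases "dt c z > 0")
      case True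
      then have "s \<le> g c" using k(2)[of c] that by (simp add: S_def s_def)
      then have "s * dt c z \<le> dt c y - real_of_int (snd c)" using True by (simp add: g_def pos_le_divide_eq)
      then show ?thesis by (simp add: y')
    next
      case False
      then have "s * dt c z \<le> 0" using s0 by (simp add: mult_nonneg_nonpos)
      then show ?thesis using feas[OF that] by (simp add: y')
    qed
    have tk: "dt k y' = real_of_int (snd k)" using kS(2) by (simp add: y' s_def g_def)
    define f' where "f' = f(r := k)"
    have f': "f' i \<in> C" if "i < d" for i using f[OF that] kS by (simp add: f'_def)
    \<comment> \<open>A solution of the new homogeneous system is a multiple of \<open>z\<close>,
      because the kept rows vanish on it, and \<open>k\<close> does not vanish on
      \<open>z\<close>.\<close>
    have inj': "\<forall>j < d. v j = 0" if v: "\<forall>i < d. dt (f' i) v = 0" for v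
    proof -
      define b where "b = dt (f r) v"
      have "dt (f i) (\<lambda>j. v j - b * z j) = 0" if "i < d" for i
        using v z[OF that] that unfolding lin by (auto simp: f'_def b_def split: if_splits)
      then have e: "v j = b * z j" if "j < d" for j using inj[of "\<lambda>j. v j - b * z j"] that by auto
      have "dt k v = b * dt k z" using e by (simp add: dt_def sum_distrib_left algebra_simps)
      moreover have "dt k v = 0" using v r(1) by (auto simp: f'_def)
      ultimately have "b = 0" using kS by simp
      then show ?thesis using e by simp
    qed
    have "{i \<in> {..<d}. dt (f' i) y' \<noteq> real_of_int (snd (f' i))} \<subset> {i \<in> {..<d}. dt (f i) y \<noteq> real_of_int (snd (f i))}"
    proof (rule psubsetI)
      show "{i \<in> {..<d}. dt (f' i) y' \<noteq> real_of_int (snd (f' i))} \<subseteq> {i \<in> {..<d}. dt (f i) y \<noteq> real_of_int (snd (f i))}"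
        using tk z by (auto simp: f'_def y' split: if_splits)
      have "r \<notin> {i \<in> {..<d}. dt (f' i) y' \<noteq> real_of_int (snd (f' i))}" using tk by (simp add: f'_def)
      then show "{i \<in> {..<d}. dt (f' i) y' \<noteq> real_of_int (snd (f' i))} \<noteq> {i \<in> {..<d}. dt (f i) y \<noteq> real_of_int (snd (f i))}"
        using r by blast
    qed
    then have "card {i \<in> {..<d}. dt (f' i) y' \<noteq> real_of_int (snd (f' i))} < card {i \<in> {..<d}. dt (f i) y \<noteq> real_of_int (snd (f i))}"
      by (intro psubset_card_mono) auto
    from less.hyps[OF this[unfolded dt_def] feas'[unfolded dt_def] f' inj'[unfolded dt_def]] show ?thesis by simp
  qed
qed

text \<open>By Cramer's rule the coordinates of a vertex have the common denominator
  \<open>D\<close>. Multiplication by its absolute value, at least 1, preserves inequalities with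
  right-hand sides 0 or 1 and makes the solution integral; \<open>d\<close> cofactors of size at
  most \<open>fact (d - 1)\<close> add up to \<open>fact d\<close>. The sign constraints
  \<open>unit\<close> provide the initial nonsingular subsystem and nonnegativity.\<close>

theorem small_solution:
  fixes C :: "((nat \<Rightarrow> int) \<times> int) set" and y :: "nat \<Rightarrow> real"
  assumes fin: "finite C" and coef: "\<And>c j. c \<in> C \<Longrightarrow> j < d \<Longrightarrow> \<bar>fst c j\<bar> \<le> 1"
    and rhs: "\<And>c. c \<in> C \<Longrightarrow> snd c \<in> {0, 1}"
    and unit: "\<And>i. i < d \<Longrightarrow> ((\<lambda>j. if j = i then 1 else 0), 0) \<in> C"
    and feas: "\<And>c. c \<in> C \<Longrightarrow> (\<Sum>j<d. real_of_int (fst c j) * y j) \<ge> real_of_int (snd c)"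
  shows "\<exists>z :: nat \<Rightarrow> int. (\<forall>c \<in> C. (\<Sum>j<d. fst c j * z j) \<ge> snd c) \<and> (\<forall>j < d. 0 \<le> z j \<and> z j \<le> fact d)"
proof -
  define f where "f i = ((\<lambda>j. if j = i then 1 else 0 :: int), 0 :: int)" for i :: nat
  have fs: "(\<Sum>j<d. real_of_int (fst (f i) j) * v j) = v i" if "i < d" for i and v :: "nat \<Rightarrow> real"
    using that by (simp add: f_def if_distrib[of real_of_int] if_distrib[of "\<lambda>c. c * _"] cong: if_cong)
  have "\<exists>f y. (\<forall>c \<in> C. (\<Sum>j<d. real_of_int (fst c j) * y j) \<ge> real_of_int (snd c)) \<and> (\<forall>i < d. f i \<in> C) \<and>
    (\<forall>v. (\<forall>i < d. (\<Sum>j<d. real_of_int (fst (f i) j) * v j) = 0) \<longrightarrow> (\<forall>j < d. v j = (0 :: real))) \<and>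
    (\<forall>i < d. (\<Sum>j<d. real_of_int (fst (f i) j) * y j) = real_of_int (snd (f i)))"
    by (rule tight_rows[OF fin coef feas, of f]) (use unit fs in \<open>auto simp: f_def[symmetric]\<close>)
  then obtain f y where fy: "\<forall>c \<in> C. (\<Sum>j<d. real_of_int (fst c j) * y j) \<ge> real_of_int (snd c)" "\<forall>i < d. f i \<in> C"
    "\<forall>v. (\<forall>i < d. (\<Sum>j<d. real_of_int (fst (f i) j) * v j) = 0) \<longrightarrow> (\<forall>j < d. v j = (0 :: real))"
    "\<forall>i < d. (\<Sum>j<d. real_of_int (fst (f i) j) * y j) = real_of_int (snd (f i))"
    by (elim exE conjE)
  note y = fy(1)[rule_format] and f = fy(2)[rule_format] and tight = fy(4)[rule_format]
  have inj: "\<forall>j < d. v j = 0" if "\<forall>i < d. (\<Sum>j<d. real_of_int (fst (f i) j) * v j) = 0" for v :: "nat \<Rightarrow> real"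
    using fy(3) that by simp
  have ab: "\<forall>i < d. \<forall>j < d. \<bar>fst (f i) j\<bar> \<le> 1" using coef[OF f] by simp
  obtain c D where c: "\<forall>k < d. \<forall>j < d. (\<Sum>i<d. c k i * fst (f i) j) = (if k = j then D else 0)"
    and "\<forall>i < d. \<forall>k < d. (\<Sum>j<d. fst (f i) j * c j k) = (if i = k then D else 0)"
    and cb: "\<forall>k < d. \<forall>i < d. \<bar>c k i\<bar> \<le> fact (d - 1)"
    and D: "D = 0 \<longrightarrow> (\<exists>v :: nat \<Rightarrow> real. (\<exists>j < d. v j \<noteq> 0) \<and> (\<forall>i < d. (\<Sum>j<d. real_of_int (fst (f i) j) * v j) = 0))"
    by (rule adjugate[of d "\<lambda>i. fst (f i)", OF ab]) (rule that)
  have D0: "D \<noteq> 0" using D inj by blast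
  define z where "z k = sgn D * (\<Sum>i<d. c k i * snd (f i))" for k
  have z: "real_of_int (z k) = real_of_int \<bar>D\<bar> * y k" if k: "k < d" for k
  proof -
    have "real_of_int (\<Sum>i<d. c k i * snd (f i)) = (\<Sum>i<d. real_of_int (c k i) * (\<Sum>j<d. real_of_int (fst (f i) j) * y j))"
      using tight by simp
    also have "\<dots> = (\<Sum>j<d. (\<Sum>i<d. real_of_int (c k i * fst (f i) j)) * y j)"
      unfolding sum_distrib_left sum_distrib_right by (subst sum.swap) (simp add: mult.assoc)
    also have "\<dots> = (\<Sum>j<d. real_of_int (\<Sum>i<d. c k i * fst (f i) j) * y j)" by simp
    also have "\<dots> = (\<Sum>j<d. if k = j then real_of_int D * y k else 0)"
      using c k by (intro sum.cong) auto
    also have "\<dots> = real_of_int D * y k" using k by simp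
    finally have "real_of_int (z k) = real_of_int (sgn D) * (real_of_int D * y k)" unfolding z_def of_int_mult by (rule arg_cong)
    moreover have "sgn D * D = \<bar>D\<bar>" by (simp add: mult_sgn_abs mult.commute abs_sgn)
    ultimately show ?thesis by (metis (no_types, lifting) mult.assoc of_int_mult)
  qed
  have D1: "real_of_int \<bar>D\<bar> \<ge> 1" using D0 by linarith
  have feas': "(\<Sum>j<d. fst c j * z j) \<ge> snd c" if "c \<in> C" for c
  proof -
    have "real_of_int (\<Sum>j<d. fst c j * z j) = real_of_int \<bar>D\<bar> * (\<Sum>j<d. real_of_int (fst c j) * y j)"
      using z by (simp add: sum_distrib_left algebra_simps)
    also have "\<dots> \<ge> real_of_int \<bar>D\<bar> * real_of_int (snd c)" using y[OF that] D1 by (intro mult_left_mono) auto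
    moreover have "real_of_int \<bar>D\<bar> * real_of_int (snd c) \<ge> real_of_int (snd c)" using rhs[OF that] D1 by auto
    ultimately show ?thesis by linarith
  qed
  have "0 \<le> z j \<and> z j \<le> fact d" if j: "j < d" for j
  proof
    have "(\<Sum>i<d. (if i = j then 1 else 0) * z i) \<ge> 0" using feas'[OF unit[OF j]] by simp
    then show "0 \<le> z j" using j by (simp add: if_distrib[of "\<lambda>c. c * _"] cong: if_cong)
    have "\<bar>z j\<bar> \<le> \<bar>\<Sum>i<d. c j i * snd (f i)\<bar>" by (simp add: z_def abs_mult abs_sgn_eq)
    also have "\<dots> \<le> (\<Sum>i<d. \<bar>c j i * snd (f i)\<bar>)" by (rule sum_abs)
    also have "\<dots> \<le> (\<Sum>i<d. fact (d - 1))"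
    proof (rule sum_mono)
      fix i assume "i \<in> {..<d}"
      then show "\<bar>c j i * snd (f i)\<bar> \<le> fact (d - 1)" using cb[rule_format, OF j, of i] rhs[OF f, of i] by (auto simp: abs_mult)
    qed
    also have "\<dots> = int d * fact (d - 1)" by simp
    also have "\<dots> = fact d" using j by (simp add: fact_reduce)
    finally show "z j \<le> fact d" by simp
  qed
  then show ?thesis using feas' by blast
qed

section \<open>Tolerance representations by natural numbers of polynomial length\<close>

definition tol_adj :: "('v \<Rightarrow> 'a :: ordered_ab_semigroup_add) \<Rightarrow> ('v \<Rightarrow> 'a) \<Rightarrow> ('v \<Rightarrow> 'a) \<Rightarrow> 'v \<Rightarrow> 'v \<Rightarrow> bool" where
  "tol_adj l r t u v \<longleftrightarrow> (\<exists>z \<in> {u, v}. \<forall>x \<in> {u, v}. \<forall>y \<in> {u, v}. l y + t z \<le> r x)"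

lemma min_le_measure_iff:
  fixes l r t :: "'v \<Rightarrow> real"
  assumes "t u > 0" "t v > 0"
  shows "min (t u) (t v) \<le> measure lborel ({l u..r u} \<inter> {l v..r v}) \<longleftrightarrow> tol_adj l r t u v"
proof -
  have "m \<le> max 0 a \<longleftrightarrow> m \<le> a" if "m > 0" for m a :: real using that by auto
  then have "min (t u) (t v) \<le> measure lborel ({l u..r u} \<inter> {l v..r v}) \<longleftrightarrow>
      min (t u) (t v) \<le> min (r u) (r v) - max (l u) (l v)"
    unfolding measure_Int_intervals using assms by simp
  also have "\<dots> \<longleftrightarrow> tol_adj l r t u v"
    unfolding tol_adj_def by (auto simp: min_def max_def)
  finally show ?thesis .
qed

text \<open>A false comparison is a strict inequality. Dividing by the least positive gap
  \<open>\<epsilon>\<close>, which is also at most every tolerance, raises the strict inequalities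
  and the tolerances to at least 1, and the shift by \<open>s\<close> makes all ends nonnegative.
  What remains is a system in the \<open>3 * n\<close> unknowns \<open>l\<close>, \<open>r\<close>,
  \<open>t\<close> to which \<open>small_solution\<close> applies.\<close>

lemma natural_tolerance_rep:
  fixes l r t :: "nat \<Rightarrow> real"
  assumes tol_pos: "\<forall>v < n. t v > 0"
  obtains l' r' t' :: "nat \<Rightarrow> nat" where "\<forall>v < n. l' v \<le> fact (3 * n) \<and> r' v \<le> fact (3 * n) \<and> t' v \<le> fact (3 * n) \<and> 1 \<le> t' v"
    and "\<forall>x < n. \<forall>y < n. \<forall>z < n. l' y + t' z \<le> r' x \<longleftrightarrow> l y + t z \<le> r x"
proof -
  note t = tol_pos[rule_format]
  define d where "d = 3 * n"
  define e :: "nat \<Rightarrow> nat \<Rightarrow> int" where "e i j = (if j = i then 1 else 0)" for i j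
  have eR: "(\<Sum>j<d. real_of_int (e i j) * v j) = v i" if "i < d" for i and v :: "nat \<Rightarrow> real"
    using that by (simp add: e_def if_distrib[of real_of_int] if_distrib[of "\<lambda>c. c * _"] cong: if_cong)
  have eZ: "(\<Sum>j<d. e i j * v j) = v i" if "i < d" for i and v :: "nat \<Rightarrow> int"
    using that by (simp add: e_def if_distrib[of "\<lambda>c. c * _"] cong: if_cong)
  define gaps where "gaps = {l y + t z - r x | x y z. x < n \<and> y < n \<and> z < n \<and> r x < l y + t z}"
  have "gaps \<subseteq> (\<lambda>(x, y, z). l y + t z - r x) ` ({..<n} \<times> {..<n} \<times> {..<n})" by (force simp: gaps_def)
  then have fin: "finite (insert 1 (gaps \<union> t ` {..<n}))" using finite_subset by (auto intro: finite_subset)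
  define \<epsilon> where "\<epsilon> = Min (insert 1 (gaps \<union> t ` {..<n}))"
  have "\<epsilon> \<in> insert 1 (gaps \<union> t ` {..<n})" unfolding \<epsilon>_def using fin by (intro Min_in) auto
  then have e0: "\<epsilon> > 0" using t by (auto simp: gaps_def)
  have gap: "\<epsilon> \<le> l y + t z - r x" if "x < n" "y < n" "z < n" "\<not> l y + t z \<le> r x" for x y z
  proof -
    have "l y + t z - r x \<in> gaps" unfolding gaps_def using that by force
    then show ?thesis unfolding \<epsilon>_def using fin by (intro Min_le) auto
  qed
  have tol: "\<epsilon> \<le> t v" if "v < n" for v unfolding \<epsilon>_def using fin that by (intro Min_le) auto
  define s where "s = - (\<Sum>v<n. \<bar>l v\<bar> + \<bar>r v\<bar>)"
  have s: "s \<le> l v" "s \<le> r v" if "v < n" for v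
  proof -
    have "\<bar>l v\<bar> + \<bar>r v\<bar> \<le> (\<Sum>v<n. \<bar>l v\<bar> + \<bar>r v\<bar>)"
      by (rule member_le_sum) (use that in auto)
    then show "s \<le> l v" "s \<le> r v" by (auto simp: s_def)
  qed
  define y where "y j = (if j < n then l j - s else if j < 2 * n then r (j - n) - s else t (j - 2 * n)) / \<epsilon>" for j
  have yv: "y v = (l v - s) / \<epsilon>" "y (n + v) = (r v - s) / \<epsilon>" "y (2 * n + v) = t v / \<epsilon>" if "v < n" for v
    using that by (simp_all add: y_def)
  have d: "v < d" "n + v < d" "2 * n + v < d" if "v < n" for v using that by (auto simp: d_def)
  define row where "row = (\<lambda>(x, u, z). if l u + t z \<le> r x then (\<lambda>j. e (n + x) j - e u j - e (2 * n + z) j, 0)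
    else (\<lambda>j. e u j + e (2 * n + z) j - e (n + x) j, 1 :: int))"
  define C where "C = (\<lambda>i. (e i, 0)) ` {..<d} \<union> (\<lambda>v. (e (2 * n + v), 1)) ` {..<n} \<union> row ` ({..<n} \<times> {..<n} \<times> {..<n})"
  have "\<exists>z :: nat \<Rightarrow> int. (\<forall>c \<in> C. (\<Sum>j<d. fst c j * z j) \<ge> snd c) \<and> (\<forall>j < d. 0 \<le> z j \<and> z j \<le> fact d)"
  proof (rule small_solution)
    show "finite C" by (simp add: C_def)
    show "\<bar>fst c j\<bar> \<le> 1" if "c \<in> C" for c j using that by (auto simp: C_def row_def e_def)
    show "snd c \<in> {0, 1}" if "c \<in> C" for c using that by (auto simp: C_def row_def split: if_splits)
    show "((\<lambda>j. if j = i then 1 else 0), 0) \<in> C" if "i < d" for i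
    proof -
      have "(e i, 0) \<in> C" using that by (simp add: C_def)
      moreover have "e i = (\<lambda>j. if j = i then 1 else 0)" by (auto simp: e_def)
      ultimately show ?thesis by simp
    qed
    show "real_of_int (snd c) \<le> (\<Sum>j<d. real_of_int (fst c j) * y j)" if c: "c \<in> C" for c
    proof -
      consider i where "i < d" "c = (e i, 0)" | v where "v < n" "c = (e (2 * n + v), 1)"
        | x u z where "x < n" "u < n" "z < n" "c = row (x, u, z)"
        using c unfolding C_def by (elim UnE imageE) auto
      then show ?thesis
      proof cases
        case 1
        have "0 \<le> y i"
        proof -
          have "i - 2 * n < n" if "\<not> i < 2 * n" using 1(1) that by (simp add: d_def)
          moreover have "i - n < n" if "i < 2 * n" "\<not> i < n" using that by simp
          ultimately show ?thesis using e0 s t by (simp add: y_def less_imp_le)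
        qed
        then show ?thesis using 1 by (simp add: eR)
      next
        case 2
        then show ?thesis using e0 tol by (simp add: eR d yv)
      next
        case 3
        show ?thesis
        proof (cases "l u + t z \<le> r x")
          case True
          have "(\<Sum>j<d. real_of_int (fst c j) * y j) = y (n + x) - y u - y (2 * n + z)"
            using True 3 by (simp add: row_def left_diff_distrib sum_subtractf eR d)
          also have "\<dots> = (r x - (l u + t z)) / \<epsilon>" using 3 by (simp add: yv diff_divide_distrib add_divide_distrib)
          finally show ?thesis using True 3 e0 by (simp add: row_def)
        next
          case False
          have "(\<Sum>j<d. real_of_int (fst c j) * y j) = y u + y (2 * n + z) - y (n + x)"
            using False 3 by (simp add: row_def left_diff_distrib distrib_right sum.distrib sum_subtractf eR d)
          also have "\<dots> = (l u + t z - r x) / \<epsilon>" using 3 by (simp add: yv diff_divide_distrib add_divide_distrib)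
          finally show ?thesis using False 3 e0 gap[OF 3(1-3) False] by (simp add: row_def)
        qed
      qed
    qed
  qed
  then obtain z :: "nat \<Rightarrow> int" where z: "\<forall>c \<in> C. (\<Sum>j<d. fst c j * z j) \<ge> snd c" "\<forall>j < d. 0 \<le> z j \<and> z j \<le> fact d"
    by (elim exE conjE)
  have tz: "z (2 * n + v) \<ge> 1" if "v < n" for v
  proof -
    have "(e (2 * n + v), 1) \<in> C" using that by (simp add: C_def)
    then show ?thesis using z(1) eZ[OF d(3)[OF that], of z] by force
  qed
  have tri: "z u + z (2 * n + w) \<le> z (n + x) \<longleftrightarrow> l u + t w \<le> r x" if "x < n" "u < n" "w < n" for x u w
  proof -
    have "row (x, u, w) \<in> C" using that by (simp add: C_def)
    then have R: "(\<Sum>j<d. fst (row (x, u, w)) j * z j) \<ge> snd (row (x, u, w))" using z(1) by blast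
    show ?thesis
    proof (cases "l u + t w \<le> r x")
      case True
      then have "z (n + x) - z u - z (2 * n + w) \<ge> 0"
        using R that by (simp add: row_def left_diff_distrib sum_subtractf eZ d)
      then show ?thesis using True by simp
    next
      case False
      then have "z u + z (2 * n + w) - z (n + x) \<ge> 1"
        using R that by (simp add: row_def left_diff_distrib distrib_right sum.distrib sum_subtractf eZ d)
      then show ?thesis using False by simp
    qed
  qed
  have zn: "int (nat (z j)) = z j" "nat (z j) \<le> fact d" if "j < d" for j
    using z(2) that by (auto simp: nat_le_iff)
  show thesis
  proof (rule that[of "\<lambda>v. nat (z v)" "\<lambda>v. nat (z (n + v))" "\<lambda>v. nat (z (2 * n + v))"])
    show "\<forall>v < n. nat (z v) \<le> fact (3 * n) \<and> nat (z (n + v)) \<le> fact (3 * n) \<and> nat (z (2 * n + v)) \<le> fact (3 * n) \<and> 1 \<le> nat (z (2 * n + v))"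
      using zn(2)[OF d(1)] zn(2)[OF d(2)] zn(2)[OF d(3)] tz by (force simp: d_def)
    show "\<forall>x < n. \<forall>u < n. \<forall>w < n. nat (z u) + nat (z (2 * n + w)) \<le> nat (z (n + x)) \<longleftrightarrow> l u + t w \<le> r x"
    proof (intro allI impI)
      fix x u w assume A: "x < n" "u < n" "w < n"
      have "nat (z u) + nat (z (2 * n + w)) \<le> nat (z (n + x)) \<longleftrightarrow> int (nat (z u)) + int (nat (z (2 * n + w))) \<le> int (nat (z (n + x)))"
        by linarith
      then show "nat (z u) + nat (z (2 * n + w)) \<le> nat (z (n + x)) \<longleftrightarrow> l u + t w \<le> r x"
        using tri[OF A] by (simp only: zn(1) d A)
    qed
  qed
qed

text \<open>From (3n)! \<le> (3n)^(3n) and 3n < 2^(3n). The exponent is the origin of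
  \<open>width\<close>.\<close>

lemma fact_less_two_power:
  assumes "n > 0"
  shows "(fact (3 * n) :: nat) < 2 ^ (9 * (n * n))"
proof -
  define k where "k = 3 * n"
  have "(fact k :: nat) \<le> k ^ k" using fact_le_power[of k, where ?'a = nat] by simp
  also have "\<dots> < (2 ^ k) ^ k" using assms by (intro power_strict_mono) (auto simp: k_def)
  also have "\<dots> = 2 ^ (9 * (n * n))" by (simp add: power_mult[symmetric] k_def)
  finally show ?thesis by (simp add: k_def)
qed

section \<open>The verifier\<close>

text \<open>With \<beta> = bt - 1 the hypothesis is p b + \<beta> b \<le> q b + 2 * \<beta> (b + 1),
  a digitwise subtraction with an inequality in each place. Weighting by powers of 2 telescopes, and
  \<open>bt W \<le> 1\<close> says that no borrow is left over. The shift by 1 keeps the borrows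
  natural; it causes the summands \<open>2 ^ k\<close> in the induction.\<close>

lemma borrow_sound:
  fixes p q bt :: "nat \<Rightarrow> nat"
  assumes "\<forall>b < W. p b + bt b < q b + 2 * bt (Suc b)" "bt W \<le> 1"
  shows "(\<Sum>b<W. p b * 2 ^ b) + bt 0 \<le> (\<Sum>b<W. q b * 2 ^ b) + 1"
proof -
  have "(\<Sum>b<k. p b * 2 ^ b) + bt 0 + 2 ^ k \<le> (\<Sum>b<k. q b * 2 ^ b) + bt k * 2 ^ k + 1" if "k \<le> W" for k
    using that
  proof (induction k)
    case (Suc k)
    then have "(p k + bt k + 1) * 2 ^ k \<le> (q k + 2 * bt (Suc k)) * 2 ^ k"
      using assms(1) by (intro mult_right_mono) (auto simp: Suc_le_eq)
    then show ?case using Suc by (simp add: algebra_simps)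
  qed simp
  from this[of W] assms(2) have "(\<Sum>b<W. p b * 2 ^ b) + bt 0 + 2 ^ W \<le> (\<Sum>b<W. q b * 2 ^ b) + 1 * 2 ^ W + 1"
    by (meson add_mono le_refl le_trans mult_right_mono zero_le)
  then show ?thesis by simp
qed

text \<open>The least admissible borrow in each place, a quotient rounded up. The initial value
  encodes the amount \<open>c\<close> that is added to the left-hand side.\<close>

primrec borrows :: "(nat \<Rightarrow> nat) \<Rightarrow> (nat \<Rightarrow> nat) \<Rightarrow> nat \<Rightarrow> nat \<Rightarrow> nat" where
  "borrows p q c 0 = Suc c"
| "borrows p q c (Suc k) = (p k + borrows p q c k + 2 - q k) div 2"

lemma borrows_complete:
  fixes p q :: "nat \<Rightarrow> nat"
  assumes pq: "\<And>b. p b \<le> 2" "\<And>b. q b \<le> 2" and c: "c \<le> 1"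
    and le: "(\<Sum>b<W. p b * 2 ^ b) + c \<le> (\<Sum>b<W. q b * 2 ^ b)"
  shows "p b + borrows p q c b < q b + 2 * borrows p q c (Suc b)" "borrows p q c b \<le> 3" "borrows p q c W \<le> 1"
proof -
  show "p b + borrows p q c b < q b + 2 * borrows p q c (Suc b)" by simp
  show "borrows p q c b \<le> 3"
  proof (induction b)
    case (Suc b)
    have "p b + borrows p q c b + 2 - q b \<le> 7" using Suc pq(1)[of b] by linarith
    then have "(p b + borrows p q c b + 2 - q b) div 2 \<le> 7 div 2" by (rule div_le_mono)
    then show ?case by simp
  qed (use c in simp)
  have Q: "(\<Sum>b<k. q b * 2 ^ b) < 2 * 2 ^ k" for k
  proof (induction k)
    case (Suc k)
    have "q k * 2 ^ k \<le> 2 * 2 ^ k" using pq(2) by (intro mult_right_mono) auto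
    from add_less_le_mono[OF Suc.IH this] show ?case by simp
  qed simp
  \<comment> \<open>Minimality of the greedy choice: if the lower digits leave room for a borrow
    \<open>m\<close>, the computed one is at most \<open>m\<close>. The statement is needed for all
    \<open>m\<close>, since the available borrow changes from digit to digit.\<close>
  have inv: "borrows p q c k \<le> m" if "(\<Sum>b<k. p b * 2 ^ b) + c + 2 ^ k \<le> (\<Sum>b<k. q b * 2 ^ b) + m * 2 ^ k" for k m
    using that
  proof (induction k arbitrary: m)
    case (Suc k)
    have le: "(\<Sum>b<k. p b * 2 ^ b) + c + (p k + 2) * 2 ^ k \<le> (\<Sum>b<k. q b * 2 ^ b) + (q k + 2 * m) * 2 ^ k"
      using Suc.prems by (simp add: algebra_simps)
    have "p k + 1 \<le> q k + 2 * m"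
    proof (rule ccontr)
      assume "\<not> ?thesis"
      then have "(q k + 2 * m) * 2 ^ k \<le> p k * 2 ^ k" by (intro mult_right_mono) auto
      then show False using le Q[of k] by (simp add: algebra_simps)
    qed
    then obtain m' where m': "q k + 2 * m = p k + 1 + m'" using le_Suc_ex by blast
    have "(\<Sum>b<k. p b * 2 ^ b) + c + 2 ^ k \<le> (\<Sum>b<k. q b * 2 ^ b) + m' * 2 ^ k"
      using le unfolding m' by (simp add: algebra_simps)
    then have "borrows p q c k \<le> m'" by (rule Suc.IH)
    then show ?case using m' by simp
  qed simp
  show "borrows p q c W \<le> 1" by (rule inv) (use le in simp)
qed

lemma binary_expansion: "(\<Sum>b<W. of_bool (odd (a div 2 ^ b)) * 2 ^ b) = a mod 2 ^ W" for a :: nat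
proof (induction W)
  case (Suc W)
  have "a mod 2 ^ Suc W = 2 ^ W * (a div 2 ^ W mod 2) + a mod 2 ^ W"
    unfolding power_Suc2 by (rule mod_mult2_eq)
  then show ?case using Suc by (simp add: mod2_eq_if)
qed simp

text \<open>
  A certificate consists of the binary representations of \<open>l\<close>, \<open>r\<close> and \<open>t - 1\<close>, followed, for all
  vertices \<open>x\<close>, \<open>y\<close> and \<open>z\<close>, by the borrows of a subtraction that decides whether
  \<open>l y + t z \<le> r x\<close>. A borrow is in \<open>{-1, ..., 2}\<close>; it is increased by one and stored in two bits.
\<close>

definition width :: "nat \<Rightarrow> nat" where "width n = 9 * (n * n)"

definition bpos :: "nat \<Rightarrow> nat \<Rightarrow> nat \<Rightarrow> nat \<Rightarrow> nat \<Rightarrow> nat \<Rightarrow> nat" where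
  "bpos n x y z b c = 3 * n * width n + ((((x * n + y) * n + z) * (width n + 1) + b) * 2 + c)"

definition digit :: "nat \<Rightarrow> (nat \<Rightarrow> bool) \<Rightarrow> nat \<Rightarrow> nat \<Rightarrow> nat" where
  "digit n U g b = of_bool (U (g * width n + b))"

definition number :: "nat \<Rightarrow> (nat \<Rightarrow> bool) \<Rightarrow> nat \<Rightarrow> nat" where
  "number n U g = (\<Sum>b<width n. digit n U g b * 2 ^ b)"

definition borrow :: "nat \<Rightarrow> (nat \<Rightarrow> bool) \<Rightarrow> nat \<Rightarrow> nat \<Rightarrow> nat \<Rightarrow> nat \<Rightarrow> nat" where
  "borrow n U x y z b = of_bool (U (bpos n x y z b 0)) + 2 * of_bool (U (bpos n x y z b 1))"

text \<open>The verdict is the high bit of the initial borrow. With \<open>t - 1\<close> stored, the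
  claim \<open>l y + t z \<le> r x\<close> becomes l y + (t z - 1) + 1 \<le> r x, with stored
  initial borrow 2; its negation becomes r x \<le> l y + (t z - 1), with stored initial borrow
  1.\<close>

definition leq :: "nat \<Rightarrow> (nat \<Rightarrow> bool) \<Rightarrow> nat \<Rightarrow> nat \<Rightarrow> nat \<Rightarrow> bool" where
  "leq n U x y z \<longleftrightarrow> U (bpos n x y z 0 1)"

definition leq_ok :: "nat \<Rightarrow> (nat \<Rightarrow> bool) \<Rightarrow> nat \<Rightarrow> nat \<Rightarrow> nat \<Rightarrow> bool" where
  "leq_ok n U x y z \<longleftrightarrow> (U (bpos n x y z 0 0) \<longleftrightarrow> \<not> leq n U x y z) \<and> \<not> U (bpos n x y z (width n) 1) \<and>
    (\<forall>b < width n. if leq n U x y z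
      then digit n U y b + digit n U (2 * n + z) b + borrow n U x y z b < digit n U (n + x) b + 2 * borrow n U x y z (Suc b)
      else digit n U (n + x) b + borrow n U x y z b < digit n U y b + digit n U (2 * n + z) b + 2 * borrow n U x y z (Suc b))"

definition accepts :: "nat \<Rightarrow> (nat \<Rightarrow> bool) \<Rightarrow> (nat \<Rightarrow> bool) \<Rightarrow> bool" where
  "accepts n U X \<longleftrightarrow> (\<forall>x < n. \<forall>y < n. \<forall>z < n. leq_ok n U x y z) \<and>
    (\<forall>u < n. \<forall>v < n. X (u * n + v) \<longleftrightarrow>
      u \<noteq> v \<and> (\<exists>z \<in> {u, v}. \<forall>x \<in> {u, v}. \<forall>y \<in> {u, v}. leq n U x y z))"

lemma number_add: "number n U g + number n U h = (\<Sum>b<width n. (digit n U g b + digit n U h b) * 2 ^ b)"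
  by (simp add: number_def sum.distrib distrib_right)

lemma leq_iff:
  assumes "leq_ok n U x y z"
  shows "leq n U x y z \<longleftrightarrow> number n U y + (number n U (2 * n + z) + 1) \<le> number n U (n + x)"
proof -
  have W: "borrow n U x y z (width n) \<le> 1" using assms by (simp add: leq_ok_def borrow_def)
  show ?thesis
  proof (cases "leq n U x y z")
    case True
    then have "(\<Sum>b<width n. (digit n U y b + digit n U (2 * n + z) b) * 2 ^ b) + borrow n U x y z 0 \<le> (\<Sum>b<width n. digit n U (n + x) b * 2 ^ b) + 1"
      using assms W by (intro borrow_sound) (simp_all add: leq_ok_def)
    moreover have "borrow n U x y z 0 = 2" using True assms by (simp add: leq_ok_def borrow_def leq_def)
    ultimately show ?thesis using True unfolding number_add[symmetric] by (simp add: number_def[symmetric])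
  next
    case False
    then have "(\<Sum>b<width n. digit n U (n + x) b * 2 ^ b) + borrow n U x y z 0 \<le> (\<Sum>b<width n. (digit n U y b + digit n U (2 * n + z) b) * 2 ^ b) + 1"
      using assms W by (intro borrow_sound) (simp_all add: leq_ok_def)
    moreover have "borrow n U x y z 0 = 1" using False assms by (simp add: leq_ok_def borrow_def leq_def)
    ultimately show ?thesis using False unfolding number_add[symmetric] by (simp add: number_def[symmetric])
  qed
qed

definition cert_length :: "nat \<Rightarrow> nat" where
  "cert_length n = 3 * n * width n + n * n * n * (width n + 1) * 2"

lemma digit_pos_less: "g < 3 * n \<Longrightarrow> b < width n \<Longrightarrow> g * width n + b < 3 * n * width n"
proof -
  assume "g < 3 * n" "b < width n"
  then have "g * width n + b < Suc g * width n" by simp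
  also have "\<dots> \<le> 3 * n * width n" using \<open>g < 3 * n\<close> by (intro mult_right_mono) auto
  finally show ?thesis .
qed

lemma certificate:
  fixes l r t :: "nat \<Rightarrow> nat"
  assumes b: "\<forall>v < n. l v < 2 ^ width n \<and> r v < 2 ^ width n \<and> t v < 2 ^ width n \<and> 1 \<le> t v"
  obtains u where "length u = cert_length n"
    and "\<forall>x < n. \<forall>y < n. \<forall>z < n. leq_ok n (\<lambda>i. i < length u \<and> u ! i) x y z \<and>
      (leq n (\<lambda>i. i < length u \<and> u ! i) x y z \<longleftrightarrow> l y + t z \<le> r x)"
proof -
  define W where "W = width n"
  define a where "a g = (if g < n then l g else if g < 2 * n then r (g - n) else t (g - 2 * n) - 1)" for g
  define bit :: "nat \<Rightarrow> nat \<Rightarrow> nat" where "bit k j = of_bool (odd (k div 2 ^ j))" for k j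
  define bt where "bt x y z = (if l y + t z \<le> r x
    then borrows (\<lambda>b. bit (l y) b + bit (t z - 1) b) (bit (r x)) 1
    else borrows (bit (r x)) (\<lambda>b. bit (l y) b + bit (t z - 1) b) 0)" for x y z
  define U where "U i = (if i < 3 * n * W then odd (a (i div W) div 2 ^ (i mod W))
    else let j = i - 3 * n * W; k = j div 2 div (W + 1) in
      odd (bt (k div n div n) (k div n mod n) (k mod n) (j div 2 mod (W + 1)) div 2 ^ (j mod 2)))" for i
  define u where "u = map U [0..<cert_length n]"
  define D where "D = (\<lambda>i. i < length u \<and> u ! i)"
  have D: "D i \<longleftrightarrow> U i" if "i < cert_length n" for i using that by (simp add: D_def u_def)
  have dig: "digit n D g b = bit (a g) b" if "g < 3 * n" "b < W" for g b
  proof -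
    have "g * W + b < 3 * n * W" using digit_pos_less that by (simp add: W_def)
    moreover have "(g * W + b) div W = g" "(g * W + b) mod W = b" using that by auto
    ultimately show ?thesis using D by (simp add: digit_def W_def[symmetric] U_def bit_def cert_length_def)
  qed
  have bp: "D (bpos n x y z b c) \<longleftrightarrow> odd (bt x y z b div 2 ^ c)" if "x < n" "y < n" "z < n" "b \<le> W" "c < 2" for x y z b c
  proof -
    define k where "k = (x * n + y) * n + z"
    define j where "j = (k * (W + 1) + b) * 2 + c"
    have "Suc x * n \<le> n * n" using that by (intro mult_right_mono) auto
    then have "x * n + y < n * n" using that by simp
    then have "Suc (x * n + y) * n \<le> n * n * n" by (intro mult_right_mono) auto
    then have k: "k < n * n * n" using that unfolding k_def by simp
    then have "Suc k * (W + 1) \<le> n * n * n * (W + 1)" by (intro mult_right_mono) auto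
    then have "k * (W + 1) + b < n * n * n * (W + 1)" using that by simp
    then have "j < n * n * n * (W + 1) * 2" using that by (simp add: j_def)
    then have c: "bpos n x y z b c < cert_length n" by (simp add: bpos_def j_def k_def cert_length_def W_def)
    have "(q * 2 + c) div 2 = q" "(q * 2 + c) mod 2 = c" for q using that(5) by presburger+
    then have "j div 2 = k * (W + 1) + b" "j mod 2 = c" by (simp_all only: j_def)
    moreover have "(k * (W + 1) + b) div (W + 1) = k" "(k * (W + 1) + b) mod (W + 1) = b"
      using that div_mult_self3[of "W + 1" k b] mod_mult_self3[of k "W + 1" b] by auto
    moreover have "k div n = x * n + y" "k mod n = z" using that by (auto simp: k_def)
    moreover have "(x * n + y) div n = x" "(x * n + y) mod n = y" using that by auto
    moreover have e: "bpos n x y z b c = 3 * n * W + j" by (simp add: bpos_def j_def k_def W_def)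
    ultimately show ?thesis unfolding D[OF c] by (simp add: U_def Let_def del: mult_Suc_right add_Suc_right)
  qed
  have num: "(\<Sum>b<W. bit k b * 2 ^ b) = k" if "k < 2 ^ W" for k
    using that unfolding bit_def binary_expansion by simp
  have "leq_ok n D x y z \<and> (leq n D x y z \<longleftrightarrow> l y + t z \<le> r x)" if xyz: "x < n" "y < n" "z < n" for x y z
  proof -
    have t: "t z \<ge> 1" and nl: "(\<Sum>b<W. bit (l y) b * 2 ^ b) = l y" and nr: "(\<Sum>b<W. bit (r x) b * 2 ^ b) = r x"
      and nt: "(\<Sum>b<W. bit (t z - 1) b * 2 ^ b) = t z - 1"
      using b xyz num by (auto simp: W_def less_imp_diff_less)
    have nlt: "(\<Sum>b<W. (bit (l y) b + bit (t z - 1) b) * 2 ^ b) = l y + (t z - 1)"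
      using nl nt by (simp add: sum.distrib distrib_right)
    have d: "digit n D y b = bit (l y) b" "digit n D (n + x) b = bit (r x) b" "digit n D (2 * n + z) b = bit (t z - 1) b" if "b < W" for b
      using dig[OF _ that, of y] dig[OF _ that, of "n + x"] dig[OF _ that, of "2 * n + z"] xyz by (simp_all add: a_def)
    have b1: "bit k b \<le> 1" for k b by (simp add: bit_def)
    have b2: "bit k b \<le> 2" "bit k b + bit k' b \<le> 2" for k k' b using b1[of k b] b1[of k' b] by auto
    have chain: "(if l y + t z \<le> r x then bit (l y) b + bit (t z - 1) b + bt x y z b < bit (r x) b + 2 * bt x y z (Suc b)
        else bit (r x) b + bt x y z b < bit (l y) b + bit (t z - 1) b + 2 * bt x y z (Suc b)) \<and> bt x y z b \<le> 3 \<and> bt x y z W \<le> 1" for b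
    proof (cases "l y + t z \<le> r x")
      case True
      have "(\<Sum>b<W. (bit (l y) b + bit (t z - 1) b) * 2 ^ b) + 1 \<le> (\<Sum>b<W. bit (r x) b * 2 ^ b)"
        unfolding nlt nr using True t by simp
      from borrows_complete[OF b2(2) b2(1) _ this] show ?thesis using True by (simp add: bt_def)
    next
      case False
      have "(\<Sum>b<W. bit (r x) b * 2 ^ b) + 0 \<le> (\<Sum>b<W. (bit (l y) b + bit (t z - 1) b) * 2 ^ b)"
        unfolding nlt nr using False t by simp
      from borrows_complete[OF b2(1) b2(2) _ this] show ?thesis using False by (simp add: bt_def)
    qed
    have two: "of_bool (odd k) + 2 * of_bool (odd (k div 2)) = k" if "k \<le> 3" for k :: nat
    proof -
      have "k \<in> {0, 1, 2, 3}" using that by auto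
      then show ?thesis by auto
    qed
    have bo: "borrow n D x y z b = bt x y z b" if "b \<le> W" for b
      using bp[OF xyz that, of 0] bp[OF xyz that, of 1] two[of "bt x y z b"] chain[of b] by (simp add: borrow_def)
    have bt0: "bt x y z 0 = (if l y + t z \<le> r x then 2 else 1)" by (simp add: bt_def)
    have l0: "leq n D x y z \<longleftrightarrow> l y + t z \<le> r x" using bp[OF xyz, of 0 1] by (simp add: leq_def bt0)
    have "D (bpos n x y z 0 0) \<longleftrightarrow> \<not> l y + t z \<le> r x" using bp[OF xyz, of 0 0] by (simp add: bt0)
    moreover have "\<not> D (bpos n x y z W 1)" using bp[OF xyz, of W 1] chain[of 0] by simp
    moreover have "if l y + t z \<le> r x
        then digit n D y b + digit n D (2 * n + z) b + borrow n D x y z b < digit n D (n + x) b + 2 * borrow n D x y z (Suc b)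
        else digit n D (n + x) b + borrow n D x y z b < digit n D y b + digit n D (2 * n + z) b + 2 * borrow n D x y z (Suc b)"
      if "b < W" for b using chain[of b] that by (simp add: d bo split: if_splits)
    ultimately have "leq_ok n D x y z" unfolding leq_ok_def l0 W_def[symmetric] by blast
    then show ?thesis using l0 by simp
  qed
  then show thesis using that[of u] by (simp add: D_def u_def)
qed

theorem tolerance_iff_accepts:
  "w \<in> graph_code ` {G. graph_instance G \<and> tolerance_graph G} \<longleftrightarrow>
    (\<exists>u. length u \<le> poly [:0, 0, 29, 18:] (length w) \<and>
      (\<exists>n. n * n = length w \<and> accepts n (\<lambda>i. i < length u \<and> u ! i) (\<lambda>i. w ! i)))"
proof
  assume "w \<in> graph_code ` {G. graph_instance G \<and> tolerance_graph G}"
  then obtain G where G: "graph_instance G" "tolerance_graph G" and w: "w = graph_code G" by blast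
  from G(1) obtain n where n: "pverts G = {..<n}" by (auto simp: graph_instance_def)
  interpret G: pair_graph G using G(1) by (simp add: graph_instance_def)
  from G(2) obtain l r t :: "nat \<Rightarrow> real" where lr: "\<forall>v \<in> pverts G. l v \<le> r v \<and> t v > 0"
    "\<forall>u \<in> pverts G. \<forall>v \<in> pverts G. u \<noteq> v \<longrightarrow> ((u, v) \<in> parcs G \<longleftrightarrow> measure lborel ({l u..r u} \<inter> {l v..r v}) \<ge> min (t u) (t v))"
    unfolding tolerance_graph_def by (elim exE conjE)
  have t0: "\<forall>v < n. t v > 0" using lr(1) n by simp
  obtain l' r' t' :: "nat \<Rightarrow> nat" where b: "\<forall>v < n. l' v \<le> fact (3 * n) \<and> r' v \<le> fact (3 * n) \<and> t' v \<le> fact (3 * n) \<and> 1 \<le> t' v"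
    and tri: "\<forall>x < n. \<forall>y < n. \<forall>z < n. l' y + t' z \<le> r' x \<longleftrightarrow> l y + t z \<le> r x"
    by (rule natural_tolerance_rep[of n t l r, OF t0]) (rule that)
  have b': "\<forall>v < n. l' v < 2 ^ width n \<and> r' v < 2 ^ width n \<and> t' v < 2 ^ width n \<and> 1 \<le> t' v"
  proof (intro allI impI)
    fix v assume v: "v < n"
    then have "(fact (3 * n) :: nat) < 2 ^ width n" unfolding width_def by (intro fact_less_two_power) simp
    then show "l' v < 2 ^ width n \<and> r' v < 2 ^ width n \<and> t' v < 2 ^ width n \<and> 1 \<le> t' v"
      using b v by (meson le_less_trans)
  qed
  obtain u where u: "length u = cert_length n"
    and ok: "\<forall>x < n. \<forall>y < n. \<forall>z < n. leq_ok n (\<lambda>i. i < length u \<and> u ! i) x y z \<and>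
      (leq n (\<lambda>i. i < length u \<and> u ! i) x y z \<longleftrightarrow> l' y + t' z \<le> r' x)"
    by (rule certificate[OF b']) (rule that)
  have lw: "length w = n * n" unfolding w graph_code_def Let_def n by (simp only: length_concat_rows card_lessThan)
  have wn: "w ! (i * n + j) \<longleftrightarrow> (i, j) \<in> parcs G" if "i < n" "j < n" for i j
    using nth_concat_rows[OF that, of "\<lambda>i j. (i, j) \<in> parcs G"] by (simp add: w graph_code_def n)
  have "accepts n (\<lambda>i. i < length u \<and> u ! i) (\<lambda>i. w ! i)"
    unfolding accepts_def
  proof (intro conjI allI impI)
    show "leq_ok n (\<lambda>i. i < length u \<and> u ! i) x y z" if "x < n" "y < n" "z < n" for x y z using ok that by simp
    fix i j assume ij: "i < n" "j < n"
    have "leq n (\<lambda>i. i < length u \<and> u ! i) x y z \<longleftrightarrow> l y + t z \<le> r x" if "x \<in> {i, j}" "y \<in> {i, j}" "z \<in> {i, j}" for x y z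
    proof -
      have "x < n" "y < n" "z < n" using ij that by auto
      then show ?thesis using ok tri by simp
    qed
    then have "(\<exists>z \<in> {i, j}. \<forall>x \<in> {i, j}. \<forall>y \<in> {i, j}. leq n (\<lambda>i. i < length u \<and> u ! i) x y z) \<longleftrightarrow> tol_adj l r t i j"
      unfolding tol_adj_def by blast
    moreover have "(i, j) \<in> parcs G \<longleftrightarrow> i \<noteq> j \<and> tol_adj l r t i j"
    proof (cases "i = j")
      case True
      then show ?thesis using G.no_loops[of "(i, j)"] by auto
    next
      case False
      have "i \<in> pverts G" "j \<in> pverts G" using ij n by simp_all
      from lr(2)[rule_format, OF this False] show ?thesis
        using min_le_measure_iff[of t i j l r] t0 ij False by simp
    qed
    ultimately show "w ! (i * n + j) \<longleftrightarrow> i \<noteq> j \<and> (\<exists>z \<in> {i, j}. \<forall>x \<in> {i, j}. \<forall>y \<in> {i, j}. leq n (\<lambda>i. i < length u \<and> u ! i) x y z)"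
      using wn[OF ij] by simp
  qed
  moreover have "cert_length n \<le> poly [:0, 0, 29, 18:] (n * n)"
  proof -
    \<comment> \<open>The polynomial is 27 m^2 for the digits plus 2 m^2 (9 m + 1) for the borrows,
      where m is the length of the graph code and bounds n.\<close>
    define m where "m = n * n"
    have nm: "n \<le> m" unfolding m_def by (cases n) auto
    have e: "cert_length n = 27 * (n * m) + n * m * (9 * m + 1) * 2" by (simp add: cert_length_def width_def m_def)
    have "n * m \<le> m * m" using nm by (rule mult_right_mono) simp
    then have "cert_length n \<le> 27 * (m * m) + m * m * (9 * m + 1) * 2" unfolding e using nm by (intro add_mono mult_mono) auto
    then show ?thesis by (simp add: m_def algebra_simps)
  qed
  ultimately show "\<exists>u. length u \<le> poly [:0, 0, 29, 18:] (length w) \<and>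
      (\<exists>n. n * n = length w \<and> accepts n (\<lambda>i. i < length u \<and> u ! i) (\<lambda>i. w ! i))"
    using u lw by (intro exI[of _ u] conjI exI[of _ n]) simp_all
next
  assume "\<exists>u. length u \<le> poly [:0, 0, 29, 18:] (length w) \<and>
      (\<exists>n. n * n = length w \<and> accepts n (\<lambda>i. i < length u \<and> u ! i) (\<lambda>i. w ! i))"
  then obtain U n where n: "n * n = length w" and acc: "accepts n U (\<lambda>i. w ! i)" by (elim exE conjE)
  \<comment> \<open>The acceptance condition is symmetric in the two vertices and excludes loops, so
    it also certifies that the word is the code of a graph.\<close>
  define G where "G = \<lparr>pverts = {..<n}, parcs = {(i, j). i < n \<and> j < n \<and> w ! (i * n + j)}\<rparr>"
  have arc: "w ! (i * n + j) \<longleftrightarrow> i \<noteq> j \<and> (\<exists>z \<in> {i, j}. \<forall>x \<in> {i, j}. \<forall>y \<in> {i, j}. leq n U x y z)"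
    if "i < n" "j < n" for i j using acc that unfolding accepts_def by blast
  have "pair_graph G"
  proof
    show "finite (pverts G)" by (simp add: G_def)
    have "parcs G \<subseteq> {..<n} \<times> {..<n}" by (auto simp: G_def)
    then show "finite (parcs G)" using finite_subset by blast
    have "w ! (i * n + j) \<longleftrightarrow> w ! (j * n + i)" if "i < n" "j < n" for i j
      unfolding arc[OF that] arc[OF that(2,1)] by (simp only: insert_commute[of i j "{}"] eq_commute[of i j])
    then show "symmetric G" by (auto simp: G_def symmetric_def arcs_ends_def sym_def arc_to_ends_def)
    show "fst e \<in> pverts G" "snd e \<in> pverts G" if "e \<in> parcs G" for e using that by (auto simp: G_def)
    show "fst e \<noteq> snd e" if "e \<in> parcs G" for e using that arc by (auto simp: G_def)
  qed
  moreover have "graph_code G = w"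
  proof (rule nth_equalityI)
    have c: "card (pverts G) = n" by (simp add: G_def)
    show len: "length (graph_code G) = length w" unfolding graph_code_def Let_def by (simp add: length_concat_rows G_def n)
    fix k assume "k < length (graph_code G)"
    then have k: "k < n * n" using len n by simp
    then have "n > 0" by (cases n) auto
    then have ij: "k div n < n" "k mod n < n" using k by (auto simp: less_mult_imp_div_less)
    have "graph_code G ! (k div n * n + k mod n) = ((k div n, k mod n) \<in> parcs G)"
      unfolding graph_code_def Let_def c by (rule nth_concat_rows[OF ij])
    then show "graph_code G ! k = w ! k" using ij by (simp add: G_def)
  qed
  moreover have "tolerance_graph G"
  proof -
    \<comment> \<open>The certified right end may lie before the left one. Raising it to
      \<open>l v\<close> yields an interval of length 0, and such a vertex stays isolated because
      all tolerances are positive.\<close>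
    define l r t where "l v = real (number n U v)" and "r v = max (l v) (real (number n U (n + v)))"
      and "t v = real (number n U (2 * n + v) + 1)" for v
    have t: "t v > 0" for v by (simp add: t_def)
    have adj: "(i, j) \<in> parcs G \<longleftrightarrow> tol_adj l r t i j" if "i < n" "j < n" "i \<noteq> j" for i j
    proof -
      have leq: "leq n U x y z \<longleftrightarrow> l y + t z \<le> real (number n U (n + x))" if "x \<in> {i, j}" "y \<in> {i, j}" "z \<in> {i, j}" for x y z
      proof -
        have "leq_ok n U x y z" using acc that \<open>i < n\<close> \<open>j < n\<close> unfolding accepts_def by blast
        then show ?thesis unfolding l_def t_def by (simp only: leq_iff of_nat_add[symmetric] of_nat_le_iff)
      qed
      have "tol_adj l r t i j \<longleftrightarrow> tol_adj l (\<lambda>v. real (number n U (n + v))) t i j"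
      proof
        assume "tol_adj l r t i j"
        then obtain z where z: "z \<in> {i, j}" "\<forall>x \<in> {i, j}. \<forall>y \<in> {i, j}. l y + t z \<le> r x" unfolding tol_adj_def by blast
        have "r x = real (number n U (n + x))" if "x \<in> {i, j}" for x
        proof -
          have "l x + t z \<le> r x" using z(2) that by blast
          then show ?thesis using t[of z] by (auto simp: r_def max_def split: if_splits)
        qed
        then have "\<forall>x \<in> {i, j}. \<forall>y \<in> {i, j}. l y + t z \<le> real (number n U (n + x))" using z(2) by metis
        then show "tol_adj l (\<lambda>v. real (number n U (n + v))) t i j" unfolding tol_adj_def using z(1) by blast
      next
        assume "tol_adj l (\<lambda>v. real (number n U (n + v))) t i j"
        then show "tol_adj l r t i j" unfolding tol_adj_def r_def by (meson max.coboundedI2)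
      qed
      also have "\<dots> \<longleftrightarrow> (\<exists>z \<in> {i, j}. \<forall>x \<in> {i, j}. \<forall>y \<in> {i, j}. leq n U x y z)"
        unfolding tol_adj_def using leq by blast
      finally show ?thesis using arc[OF that(1,2)] that by (simp add: G_def)
    qed
    show ?thesis unfolding tolerance_graph_def
    proof (intro conjI exI ballI impI)
      show "pair_graph G" by fact
      show "l v \<le> r v" for v by (simp add: r_def)
      show "t v > 0" for v by (rule t)
      show "(i, j) \<in> parcs G \<longleftrightarrow> min (t i) (t j) \<le> measure lborel ({l i..r i} \<inter> {l j..r j})"
        if "i \<in> pverts G" "j \<in> pverts G" "i \<noteq> j" for i j
        using adj[of i j] that min_le_measure_iff[of t i j l r, OF t t] by (simp add: G_def)
    qed
  qed
  ultimately have "graph_instance G" "tolerance_graph G" "graph_code G = w" by (auto simp: graph_instance_def G_def)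
  then show "w \<in> graph_code ` {G. graph_instance G \<and> tolerance_graph G}" by blast
qed

text \<open>
  Variable \<open>2\<close> is the length of the graph code and variable \<open>3\<close> the number of vertices; variables
  \<open>4\<close>, \<open>5\<close> and \<open>6\<close> range over vertices, variable \<open>7\<close> over digits, and the later ones hold bits of
  the certificate.
\<close>

definition Ub :: "trm \<Rightarrow> fm" where "Ub a = Bt (Pl (Pl (Ti (Cn 2) (V 2)) (Cn 2)) a)"

text \<open>Turns a truth value into a number 0 or 1 stored in variable \<open>v\<close>, so that
  digits and borrows can be used in arithmetic terms.\<close>

definition Bit :: "nat \<Rightarrow> trm \<Rightarrow> fm \<Rightarrow> fm" where
  "Bit v a \<phi> = Ex v (Cn 2) (An (Iff (Eq (V v) (Cn 1)) (Ub a)) \<phi>)"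

definition wT :: trm where "wT = Ti (Cn 9) (Ti (V 3) (V 3))"

definition dT :: "trm \<Rightarrow> trm" where "dT g = Pl (Ti g wT) (V 7)"

definition bT :: "trm \<Rightarrow> trm \<Rightarrow> trm \<Rightarrow> trm \<Rightarrow> nat \<Rightarrow> trm" where
  "bT x y z b c = Pl (Ti (Ti (Cn 3) (V 3)) wT)
    (Pl (Ti (Pl (Ti (Pl (Ti (Pl (Ti x (V 3)) y) (V 3)) z) (Pl wT (Cn 1))) b) (Cn 2)) (Cn c))"

definition okF :: fm where
  "okF = (let B = bT (V 4) (V 5) (V 6) in
    An (Iff (Ub (B (Cn 0) 0)) (Ng (Ub (B (Cn 0) 1)))) (An (Ng (Ub (B wT 1)))
      (All 7 wT (Bit 8 (dT (V 5)) (Bit 9 (dT (Pl (Ti (Cn 2) (V 3)) (V 6))) (Bit 10 (dT (Pl (V 3) (V 4)))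
        (Bit 11 (B (V 7) 0) (Bit 12 (B (V 7) 1) (Bit 13 (B (Pl (V 7) (Cn 1)) 0) (Bit 14 (B (Pl (V 7) (Cn 1)) 1)
          (Ite (Ub (B (Cn 0) 1))
            (Ls (Pl (Pl (V 8) (V 9)) (Pl (V 11) (Ti (Cn 2) (V 12)))) (Pl (V 10) (Ti (Cn 2) (Pl (V 13) (Ti (Cn 2) (V 14))))))
            (Ls (Pl (V 10) (Pl (V 11) (Ti (Cn 2) (V 12)))) (Pl (Pl (V 8) (V 9)) (Ti (Cn 2) (Pl (V 13) (Ti (Cn 2) (V 14)))))))))))))))))"

definition adjF :: "trm \<Rightarrow> fm" where
  "adjF z = (let L = (\<lambda>x y. Ub (bT x y z (Cn 0) 1)) in
    An (An (L (V 4) (V 4)) (L (V 4) (V 5))) (An (L (V 5) (V 4)) (L (V 5) (V 5))))"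

definition acceptF :: fm where
  "acceptF = An (All 4 (V 3) (All 5 (V 3) (All 6 (V 3) okF)))
    (All 4 (V 3) (All 5 (V 3) (Iff (Bt (Ti (Cn 2) (Pl (Ti (V 4) (V 3)) (V 5))))
      (An (Ng (Eq (V 4) (V 5))) (Or (adjF (V 4)) (adjF (V 5)))))))"

text \<open>The first unequal pair of bits determines the length of the graph code, guessed as
  variable 2; its square root, the number of vertices, is guessed as variable 3.\<close>

definition verifierF :: fm where
  "verifierF = Ex 2 (V 0) (An (An (Ls (Pl (Ti (Cn 2) (V 2)) (Cn 1)) (V 0))
      (All 3 (V 2) (Iff (Bt (Ti (Cn 2) (V 3))) (Bt (Pl (Ti (Cn 2) (V 3)) (Cn 1))))))
    (An (An (Bt (Ti (Cn 2) (V 2))) (Ng (Bt (Pl (Ti (Cn 2) (V 2)) (Cn 1)))))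
      (Ex 3 (Pl (V 2) (Cn 1)) (An (Eq (Ti (V 3) (V 3)) (V 2)) acceptF))))"

lemma wff_verifierF: "wff 2 verifierF"
  by (simp add: verifierF_def acceptF_def adjF_def okF_def Let_def Bit_def Ub_def bT_def dT_def wT_def)

section \<open>The meaning of the verifier formula\<close>

context
  fixes x u :: "bool list" and w U
  defines "w \<equiv> pair_code x u" and "U \<equiv> \<lambda>i. i < length u \<and> u ! i"
begin

lemma fv_Ub: "e 2 = length x \<Longrightarrow> fv w e (Ub a) \<longleftrightarrow> U (tv e a)"
  using nth_pair_code(4)[of x u "tv e a"] by (simp add: Ub_def w_def U_def length_pair_code)

lemma fv_Bit:
  assumes "e 2 = length x" "v \<noteq> 2" "v \<notin> tvs a"
  shows "fv w e (Bit v a \<phi>) \<longleftrightarrow> fv w (e(v := of_bool (U (tv e a)))) \<phi>"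
proof -
  have "tv (e(v := i)) a = tv e a" for i using assms(3) by (intro tv_eq) auto
  then have "fv w e (Bit v a \<phi>) \<longleftrightarrow> (\<exists>i < 2. (i = 1 \<longleftrightarrow> U (tv e a)) \<and> fv w (e(v := i)) \<phi>)"
    using assms by (simp add: Bit_def fv_Ub)
  also have "\<dots> \<longleftrightarrow> fv w (e(v := of_bool (U (tv e a)))) \<phi>"
    by (cases "U (tv e a)") (auto simp: less_2_cases_iff)
  finally show ?thesis .
qed

lemma tv_bT: "tv e (bT a b c d i) = bpos (e 3) (tv e a) (tv e b) (tv e c) (tv e d) i"
  by (simp add: bT_def bpos_def wT_def width_def)

lemma tv_wT: "tv e wT = width (e 3)" by (simp add: wT_def width_def)

lemma tv_dT: "tv e (dT g) = tv e g * width (e 3) + e 7" by (simp add: dT_def tv_wT)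

lemma tvs_bdT: "tvs (bT a b c d i) = {3} \<union> tvs a \<union> tvs b \<union> tvs c \<union> tvs d" "tvs (dT g) = {3, 7} \<union> tvs g"
  by (auto simp: bT_def dT_def wT_def)

lemma fv_okF: "e 2 = length x \<Longrightarrow> fv w e okF \<longleftrightarrow> leq_ok (e 3) U (e 4) (e 5) (e 6)"
  by (simp add: okF_def Let_def fv_Ub fv_Bit tv_bT tv_wT tv_dT tvs_bdT leq_ok_def leq_def digit_def borrow_def
      algebra_simps)

lemma fv_adjF: "e 2 = length x \<Longrightarrow> fv w e (adjF z) \<longleftrightarrow>
    (\<forall>a \<in> {e 4, e 5}. \<forall>b \<in> {e 4, e 5}. leq (e 3) U a b (tv e z))"
  by (simp add: adjF_def Let_def fv_Ub tv_bT leq_def)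

lemma fv_acceptF:
  assumes e: "e 2 = length x" "e 3 * e 3 = length x"
  shows "fv w e acceptF \<longleftrightarrow> accepts (e 3) U (\<lambda>i. x ! i)"
proof -
  have "fv w (e(4 := i, 5 := j)) (Bt (Ti (Cn 2) (Pl (Ti (V 4) (V 3)) (V 5)))) \<longleftrightarrow> x ! (i * e 3 + j)"
    if ij: "i < e 3" "j < e 3" for i j
  proof -
    have "i * e 3 + j < Suc i * e 3" using ij by simp
    also have "\<dots> \<le> e 3 * e 3" using ij by (intro mult_right_mono) auto
    finally have "i * e 3 + j < length x" using e by simp
    then show ?thesis using nth_pair_code(1)[of "2 * (i * e 3 + j)" x u] by (simp add: w_def length_pair_code)
  qed
  then show ?thesis using e(1)
    by (simp add: acceptF_def accepts_def fv_okF fv_adjF del: fv.simps(2))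
qed

lemma fv_verifierF:
  assumes "e 0 = length w"
  shows "fv w e verifierF \<longleftrightarrow> (\<exists>n. n * n = length x \<and> accepts n U (\<lambda>i. x ! i))"
proof -
  define B where "B i \<longleftrightarrow> i < length w \<and> w ! i" for i
  have lw: "length w = 2 * length x + 2 + length u" by (simp add: w_def length_pair_code)
  have Bx: "B (2 * i) \<longleftrightarrow> B (2 * i + 1)" if "i < length x" for i
    using nth_pair_code(1)[of "2 * i" x u] nth_pair_code(1)[of "2 * i + 1" x u] that lw by (simp add: B_def w_def)
  have B1: "B (2 * length x)" "\<not> B (2 * length x + 1)"
    using nth_pair_code(2,3)[of x u] lw by (simp_all add: B_def w_def)
  have m: "(2 * m + 1 < length w \<and> (\<forall>j < m. B (2 * j) \<longleftrightarrow> B (2 * j + 1))) \<and> B (2 * m) \<and> \<not> B (2 * m + 1) \<longleftrightarrow> m = length x" for m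
  proof
    assume A: "(2 * m + 1 < length w \<and> (\<forall>j < m. B (2 * j) \<longleftrightarrow> B (2 * j + 1))) \<and> B (2 * m) \<and> \<not> B (2 * m + 1)"
    then have "\<not> m < length x" using Bx by blast
    moreover have "\<not> length x < m" using A B1 by blast
    ultimately show "m = length x" by simp
  qed (use Bx B1 lw in auto)
  have "fv w e verifierF \<longleftrightarrow> (\<exists>m < length w. ((2 * m + 1 < length w \<and> (\<forall>j < m. B (2 * j) \<longleftrightarrow> B (2 * j + 1))) \<and> B (2 * m) \<and> \<not> B (2 * m + 1)) \<and>
      (\<exists>n < m + 1. n * n = m \<and> fv w (e(2 := m, 3 := n)) acceptF))"
    using assms by (simp add: verifierF_def B_def)
  also have "\<dots> \<longleftrightarrow> (\<exists>n < length x + 1. n * n = length x \<and> fv w (e(2 := length x, 3 := n)) acceptF)"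
    unfolding m using lw by auto
  also have "\<dots> \<longleftrightarrow> (\<exists>n. n * n = length x \<and> accepts n U (\<lambda>i. x ! i))"
  proof -
    have "n < length x + 1" if "n * n = length x" for n using that le_square[of n] by simp
    moreover have "fv w (e(2 := length x, 3 := n)) acceptF \<longleftrightarrow> accepts n U (\<lambda>i. x ! i)" if "n * n = length x" for n
      using that by (subst fv_acceptF) auto
    ultimately show ?thesis by blast
  qed
  finally show ?thesis .
qed

end

definition verifier :: "bool list \<Rightarrow> bool list" where
  "verifier w = [fv w (env2 (length w) 0) verifierF]"

lemma polytime_verifier: "polytime verifier"
  by (rule polytime_fo[of "Cn 1", OF _ wff_verifierF]) (simp_all add: verifier_def)

lemma has_certificate_verifier:
  "has_certificate verifier [:0, 0, 29, 18:] x \<longleftrightarrow> x \<in> graph_code ` {G. graph_instance G \<and> tolerance_graph G}"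
proof -
  have "verifier (pair_code x u) = [True] \<longleftrightarrow>
      (\<exists>n. n * n = length x \<and> accepts n (\<lambda>i. i < length u \<and> u ! i) (\<lambda>i. x ! i))" for u
    by (simp add: verifier_def fv_verifierF)
  then show ?thesis unfolding has_certificate_def tolerance_iff_accepts by simp
qed

theorem theorem4p1:
  shows "NP_complete (graph_code ` {G. graph_instance G \<and> tolerance_graph G})
    \<and> promise_NP_complete
        (graph_code ` {G. graph_instance G \<and> trapezoid_graph G \<and> tolerance_graph G})
        (graph_code ` {G. graph_instance G \<and> trapezoid_graph G \<and> \<not> tolerance_graph G})"
    (is "NP_complete ?L \<and> promise_NP_complete ?Y ?N")
proof
  have Y: "?Y \<subseteq> ?L" by blast
  \<comment> \<open>The code determines the graph, so a no-instance never shares its code with a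
    tolerance graph.\<close>
  have N: "?N \<inter> ?L = {}" using inj_on_graph_code unfolding inj_on_def by blast
  have "?L \<in> NP" unfolding NP_def using polytime_verifier has_certificate_verifier by blast
  moreover have "L \<le>\<^sub>p ?L" if "L \<in> NP" for L
  proof -
    from NP_reduces_to_tolerance[OF that] obtain f where f: "polytime f"
      "\<forall>x. (x \<in> L \<longrightarrow> f x \<in> ?Y) \<and> (x \<notin> L \<longrightarrow> f x \<in> ?N)" by (elim exE conjE)
    have "x \<in> L \<longleftrightarrow> f x \<in> ?L" for x using f(2)[rule_format, of x] Y N by blast
    then show ?thesis unfolding poly_reducible_def using f(1) by blast
  qed
  ultimately show "NP_complete ?L" unfolding NP_complete_def by blast
  show "promise_NP_complete ?Y ?N" unfolding promise_NP_complete_def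
  proof (intro conjI ballI)
    show "\<exists>v p. polytime v \<and> (\<forall>x \<in> ?Y. has_certificate v p x) \<and> (\<forall>x \<in> ?N. \<not> has_certificate v p x)"
    proof (intro exI conjI ballI)
      show "polytime verifier" by (rule polytime_verifier)
      show "has_certificate verifier [:0, 0, 29, 18:] x" if "x \<in> ?Y" for x
        unfolding has_certificate_verifier using Y that by blast
      show "\<not> has_certificate verifier [:0, 0, 29, 18:] x" if "x \<in> ?N" for x
        unfolding has_certificate_verifier using N that by blast
    qed
    show "\<exists>f. polytime f \<and> (\<forall>x. (x \<in> L \<longrightarrow> f x \<in> ?Y) \<and> (x \<notin> L \<longrightarrow> f x \<in> ?N))" if "L \<in> NP" for L
      using that by (rule NP_reduces_to_tolerance)
  qed
qed

end
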